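(* Let $V\subseteq L^2(\mathbb{R}^d)$ be a shift-invariant space with range function $J$ such that $\dim J(\omega)<\infty$ for a.e. $\omega\in[0,1)^d$, and let $L:V\to V$ be a shift-preserving operator with associated range operator $R$. Then $R(\omega)$ has a matrix representation for a.e. $\omega\in[0,1)^d$ with measurable entries. More precisely, if $\dim J(\omega)=n$ for a.e. $\omega\in B$, where $B\subseteq[0,1)^d$ is measurable, then there exist $n^2$ measurable bounded functions $\{m_{i,j}\}_{i,j=1}^n$ defined on $B$ such that, for a.e. $\omega\in B$, the $n\times n$ matrix $\big(m_{i,j}(\omega)\big)_{i,j=1}^n$ is a matrix representation of $R(\omega)$ (with respect to a basis of $J(\omega)$).
   Context: For $k\in\mathbb{Z}^d$, $T_kf(x)=f(x-k)$. A closed subspace $V\subseteq L^2(\mathbb{R}^d)$ is shift invariant if $T_kf\in V$ for all $f\in V$, $k\in\mathbb{Z}^d$. Let $\hat f(\omega)=\int f(x)e^{-2\pi i\langle\omega,x\rangle}dx$, and let $\mathcal{T}:L^2(\mathbb{R}^d)\to L^2([0,1)^d,\ell^2(\mathbb{Z}^d))$ be the isometric isomorphism $\mathcal{T}f(\omega)=\{\hat f(\omega+k)\}_{k\in\mathbb{Z}^d}$. A range function is a map $J$ from $[0,1)^d$ to the closed subspaces of $\ell^2(\mathbb{Z}^d)$; it is measurable if $\omega\mapsto\langle P_{J(\omega)}u,v\rangle$ is measurable for all $u,v\in\ell^2(\mathbb{Z}^d)$ ($P_S$ is the orthogonal projection onto $S$). Each shift-invariant $V$ has a measurable range function $J=J_V$,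 unique up to null sets, with $f\in V$ iff $\mathcal{T}f(\omega)\in J(\omega)$ for a.e. $\omega$. An operator $L:V\to V$ is shift preserving if it is bounded, linear and $LT_k=T_kL$ for all $k\in\mathbb{Z}^d$. Its range operator $R$ is the (a.e. unique) measurable field of bounded operators $R(\omega):J(\omega)\to J(\omega)$ with $\mathcal{T}(Lf)(\omega)=R(\omega)(\mathcal{T}f(\omega))$ for a.e. $\omega$ and all $f\in V$; measurable means $\omega\mapsto\langle R(\omega)P_{J(\omega)}u,v\rangle$ is measurable for all $u,v\in\ell^2(\mathbb{Z}^d)$. *)

theory Defs
  imports "HOL-Analysis.Analysis" "HOL-Library.Function_Algebras"
begin

text \<open>Complex-valued functions as a complex vector space; addition is the pointwise one of
  \<^theory>\<open>HOL-Library.Function_Algebras\<close>.\<close>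

definition cscale :: "complex \<Rightarrow> ('a \<Rightarrow> complex) \<Rightarrow> 'a \<Rightarrow> complex"
  where "cscale c f = (\<lambda>x. c * f x)"

interpretation cfun: vector_space cscale
  by unfold_locales (auto simp: cscale_def fun_eq_iff algebra_simps)

definition finite_dimensional :: "('a \<Rightarrow> complex) set \<Rightarrow> bool"
  where "finite_dimensional S \<longleftrightarrow> (\<exists>b. finite b \<and> cfun.span b = S)"

text \<open>Elements of an \<open>L\<^sup>2\<close> space are represented by square-integrable functions, with equality
  read almost everywhere. For \<open>M = count_space UNIV\<close> this is \<open>\<ell>\<^sup>2\<close>, and almost everywhere
  means everywhere.\<close>

definition L2 :: "'a measure \<Rightarrow> ('a \<Rightarrow> complex) set"
  where "L2 M = {f \<in> borel_measurable M. integrable M (\<lambda>x. (norm (f x))\<^sup>2)}"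

definition L2_inner :: "'a measure \<Rightarrow> ('a \<Rightarrow> complex) \<Rightarrow> ('a \<Rightarrow> complex) \<Rightarrow> complex"
  where "L2_inner M f g = (LINT x|M. f x * cnj (g x))"

definition L2_norm :: "'a measure \<Rightarrow> ('a \<Rightarrow> complex) \<Rightarrow> real"
  where "L2_norm M f = sqrt (LINT x|M. (norm (f x))\<^sup>2)"

text \<open>Sequential closedness, applied to constant sequences, also makes such a set of
  representatives closed under almost everywhere equality.\<close>

definition L2_closed_subspace :: "'a measure \<Rightarrow> ('a \<Rightarrow> complex) set \<Rightarrow> bool"
  where "L2_closed_subspace M V \<longleftrightarrow> V \<subseteq> L2 M \<and> cfun.subspace V \<and>
    (\<forall>f g. (\<forall>n. f n \<in> V) \<and> g \<in> L2 M \<and> (\<lambda>n. L2_norm M (f n - g)) \<longlonglongrightarrow> 0 \<longrightarrow> g \<in> V)"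

text \<open>By linearity and boundedness, such an operator respects almost everywhere equality.\<close>

definition L2_bounded_operator ::
    "'a measure \<Rightarrow> ('a \<Rightarrow> complex) set \<Rightarrow> (('a \<Rightarrow> complex) \<Rightarrow> 'a \<Rightarrow> complex) \<Rightarrow> bool"
  where "L2_bounded_operator M V L \<longleftrightarrow>
    (\<forall>f\<in>V. L f \<in> V) \<and>
    (\<forall>f\<in>V. \<forall>g\<in>V. AE x in M. L (f + g) x = L f x + L g x) \<and>
    (\<forall>c. \<forall>f\<in>V. AE x in M. L (cscale c f) x = c * L f x) \<and>
    (\<exists>C. \<forall>f\<in>V. L2_norm M (L f) \<le> C * L2_norm M f)"

type_synonym 'd seq = "int ^ 'd \<Rightarrow> complex"

abbreviation ell2 :: "'d::finite seq set"
  where "ell2 \<equiv> L2 (count_space UNIV)"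

abbreviation ell2_inner :: "'d::finite seq \<Rightarrow> 'd seq \<Rightarrow> complex"
  where "ell2_inner \<equiv> L2_inner (count_space UNIV)"

definition orth_proj :: "'d::finite seq set \<Rightarrow> 'd seq \<Rightarrow> 'd seq"
  where "orth_proj S u = (THE p. p \<in> S \<and> (\<forall>v\<in>S. ell2_inner (u - p) v = 0))"

definition real_vec :: "int ^ 'd \<Rightarrow> real ^ 'd::finite"
  where "real_vec k = (\<chi> i. of_int (k $ i))"

definition unit_cube :: "(real ^ 'd::finite) set"
  where "unit_cube = {\<omega>. \<forall>i. 0 \<le> \<omega> $ i \<and> \<omega> $ i < 1}"

definition translate :: "int ^ 'd \<Rightarrow> (real ^ 'd \<Rightarrow> complex) \<Rightarrow> real ^ 'd::finite \<Rightarrow> complex"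
  where "translate k f = (\<lambda>x. f (x - real_vec k))"

definition shift_invariant :: "(real ^ 'd::finite \<Rightarrow> complex) set \<Rightarrow> bool"
  where "shift_invariant V \<longleftrightarrow>
    L2_closed_subspace lebesgue V \<and> (\<forall>k. \<forall>f\<in>V. translate k f \<in> V)"

definition fourier_integral :: "(real ^ 'd::finite \<Rightarrow> complex) \<Rightarrow> real ^ 'd \<Rightarrow> complex"
  where "fourier_integral f \<omega> =
    (LINT x|lebesgue. f x * exp (- (2 * of_real pi * \<i> * of_real (\<omega> \<bullet> x))))"

text \<open>On \<open>L\<^sup>2\<close> the Fourier transform is the continuous extension of the integral above from
  \<open>L\<^sup>1 \<inter> L\<^sup>2\<close>: the limit in \<open>L\<^sup>2\<close> of the transforms of the truncations of \<open>f\<close> to balls. It is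
  determined up to null sets; an arbitrary representative is chosen.\<close>

definition fourier :: "(real ^ 'd::finite \<Rightarrow> complex) \<Rightarrow> real ^ 'd \<Rightarrow> complex"
  where "fourier f = (SOME g. g \<in> L2 lebesgue \<and>
    (\<lambda>n::nat. L2_norm lebesgue
      (fourier_integral (\<lambda>x. indicator (cball 0 (real n)) x * f x) - g)) \<longlonglongrightarrow> 0)"

definition fiber :: "(real ^ 'd::finite \<Rightarrow> complex) \<Rightarrow> real ^ 'd \<Rightarrow> 'd seq"
  where "fiber f \<omega> = (\<lambda>k. fourier f (\<omega> + real_vec k))"

definition measurable_range_function :: "(real ^ 'd::finite \<Rightarrow> 'd seq set) \<Rightarrow> bool"
  where "measurable_range_function J \<longleftrightarrow>
    (\<forall>\<omega>\<in>unit_cube. L2_closed_subspace (count_space UNIV) (J \<omega>)) \<and>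
    (\<forall>u\<in>ell2. \<forall>v\<in>ell2.
      (\<lambda>\<omega>. ell2_inner (orth_proj (J \<omega>) u) v) \<in> borel_measurable (lebesgue_on unit_cube))"

definition range_function_of ::
    "(real ^ 'd::finite \<Rightarrow> complex) set \<Rightarrow> (real ^ 'd \<Rightarrow> 'd seq set) \<Rightarrow> bool"
  where "range_function_of V J \<longleftrightarrow> measurable_range_function J \<and>
    (\<forall>f\<in>L2 lebesgue. f \<in> V \<longleftrightarrow> (AE \<omega> in lebesgue_on unit_cube. fiber f \<omega> \<in> J \<omega>))"

definition shift_preserving ::
    "(real ^ 'd::finite \<Rightarrow> complex) set \<Rightarrow>
     ((real ^ 'd \<Rightarrow> complex) \<Rightarrow> real ^ 'd \<Rightarrow> complex) \<Rightarrow> bool"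
  where "shift_preserving V L \<longleftrightarrow> L2_bounded_operator lebesgue V L \<and>
    (\<forall>k. \<forall>f\<in>V. AE x in lebesgue. L (translate k f) x = translate k (L f) x)"

text \<open>The values of \<open>R \<omega>\<close> outside \<open>J \<omega>\<close> are irrelevant. No bound on the operator norms uniform
  in \<open>\<omega>\<close> is assumed.\<close>

definition range_operator_of ::
    "(real ^ 'd::finite \<Rightarrow> complex) set \<Rightarrow> (real ^ 'd \<Rightarrow> 'd seq set) \<Rightarrow>
     ((real ^ 'd \<Rightarrow> complex) \<Rightarrow> real ^ 'd \<Rightarrow> complex) \<Rightarrow>
     (real ^ 'd \<Rightarrow> 'd seq \<Rightarrow> 'd seq) \<Rightarrow> bool"
  where "range_operator_of V J L R \<longleftrightarrow>
    (\<forall>\<omega>\<in>unit_cube. L2_bounded_operator (count_space UNIV) (J \<omega>) (R \<omega>)) \<and>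
    (\<forall>u\<in>ell2. \<forall>v\<in>ell2.
      (\<lambda>\<omega>. ell2_inner (R \<omega> (orth_proj (J \<omega>) u)) v) \<in> borel_measurable (lebesgue_on unit_cube)) \<and>
    (\<forall>f\<in>V. AE \<omega> in lebesgue_on unit_cube. fiber (L f) \<omega> = R \<omega> (fiber f \<omega>))"

text \<open>Matrices are indexed by \<open>{..<n}\<close>; column \<open>j\<close> holds the coordinates of \<open>A (e j)\<close>.\<close>

definition matrix_representation ::
    "('a \<Rightarrow> complex) set \<Rightarrow> (('a \<Rightarrow> complex) \<Rightarrow> 'a \<Rightarrow> complex) \<Rightarrow> nat \<Rightarrow>
     (nat \<Rightarrow> nat \<Rightarrow> complex) \<Rightarrow> bool"
  where "matrix_representation S A n m \<longleftrightarrow>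
    (\<exists>e. inj_on e {..<n} \<and> cfun.independent (e ` {..<n}) \<and> cfun.span (e ` {..<n}) = S \<and>
      (\<forall>j<n. A (e j) = (\<Sum>i<n. cscale (m i j) (e i))))"

end

theory Submission
  imports Defs "HOL-Probability.Characteristic_Functions"
begin

text \<open>
  The matrix is taken in a measurable field of orthonormal bases \<open>b\<^sub>0 w, b\<^sub>1 w, \<dots>\<close> of the fibre spaces
  \<open>J w\<close>. Such bases come from a Gram--Schmidt process applied to the projections onto \<open>J w\<close> of the
  unit vectors of \<open>\<ell>\<^sup>2\<close>, which span \<open>J w\<close> and are measurable in \<open>w\<close> (\<open>gram_schmidt\<close>, \<open>fiber_basis\<close>).
  The entries are then \<open>\<langle>R w (b\<^sub>j w), b\<^sub>i w\<rangle>\<close>, so that what has to be shown is that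
  \<open>w \<mapsto> R w (b\<^sub>j w)\<close> is measurable and essentially bounded.

  A uniform bound on the operators \<open>R w\<close> is not among the hypotheses and has to be derived from the
  boundedness of \<open>L\<close>. A bounded measurable section \<open>s\<close> of \<open>J\<close> is the fibre of some square-integrable
  \<open>f\<close>, because the Fourier transform maps onto \<open>L\<^sup>2\<close> (\<open>section_is_fiber\<close>), and \<open>f\<close> belongs to \<open>V\<close> because its
  fibres lie in \<open>J\<close>. Then \<open>R w (s w)\<close> is the fibre of \<open>L f\<close>, which gives measurability, and the
  Plancherel identity turns \<open>\<parallel>L f\<parallel> \<le> C * \<parallel>f\<parallel>\<close> into an inequality between the integrals of
  \<open>\<parallel>R w (s w)\<parallel>\<^sup>2\<close> and \<open>C\<^sup>2 * \<parallel>s w\<parallel>\<^sup>2\<close>. As \<open>s\<close> may be multiplied by the indicator of any measurable set,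
  the inequality holds pointwise almost everywhere (\<open>range_operator_on_sections\<close>).

  The analytic core is therefore that the Fourier transform is isometric and surjective on \<open>L\<^sup>2\<close>. For an
  integrable and square-integrable \<open>f\<close>, inserting a Gaussian weight into the integral of
  \<open>|fourier_integral f|\<^sup>2\<close> gives the inner product of \<open>f\<close> with its convolution with the heat kernel
  (\<open>plancherel_gauss\<close>). Removing the weight amounts to showing that a mean square oscillation of \<open>f\<close> tends to
  zero (\<open>oscillation_eps_tendsto_0\<close>). The isometry extends to \<open>L\<^sup>2\<close> by completeness
  (\<open>L2_norm_fourier\<close>), and surjectivity holds because the adjoint of the transform is its conjugate
  and hence an isometry too (\<open>fourier_surjective\<close>).
\<close>

section \<open>Square-integrable functions\<close>

lemma L2_measurable: "f \<in> L2 M \<Longrightarrow> f \<in> borel_measurable M"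
  and L2_integrable: "f \<in> L2 M \<Longrightarrow> integrable M (\<lambda>x. (norm (f x))\<^sup>2)"
  by (auto simp: L2_def)

lemma norm_add_sq_le: "(norm (a + b :: 'a::real_normed_vector))\<^sup>2 \<le> 2 * (norm a)\<^sup>2 + 2 * (norm b)\<^sup>2"
proof -
  have "(norm (a + b))\<^sup>2 \<le> (norm a + norm b)\<^sup>2"
    by (simp add: norm_triangle_ineq power_mono)
  also have "\<dots> \<le> 2 * (norm a)\<^sup>2 + 2 * (norm b)\<^sup>2"
    using sum_squares_bound[of "norm a" "norm b"] by (simp add: power2_sum)
  finally show ?thesis .
qed

lemma L2_add:
  assumes "f \<in> L2 M" "g \<in> L2 M"
  shows "f + g \<in> L2 M"
proof -
  have [measurable]: "f \<in> borel_measurable M" "g \<in> borel_measurable M"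
    using assms by (auto simp: L2_def)
  have "integrable M (\<lambda>x. (norm (f x + g x))\<^sup>2)"
    by (rule Bochner_Integration.integrable_bound
        [of M "\<lambda>x. 2 * (norm (f x))\<^sup>2 + 2 * (norm (g x))\<^sup>2"])
      (use assms norm_add_sq_le in \<open>auto simp: L2_def\<close>)
  then show ?thesis
    by (simp add: L2_def plus_fun_def)
qed

lemma L2_cscale: "f \<in> L2 M \<Longrightarrow> cscale c f \<in> L2 M"
  by (auto simp: L2_def cscale_def norm_mult power_mult_distrib)

lemma L2_zero: "0 \<in> L2 M"
  by (auto simp: L2_def zero_fun_def)

lemma cscale_minus_one: "cscale (-1) f = - f"
  by (auto simp: cscale_def)

lemma L2_uminus: "f \<in> L2 M \<Longrightarrow> - f \<in> L2 M"
  using L2_cscale[of f M "-1"] by (simp add: cscale_minus_one)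

lemma L2_diff: "f \<in> L2 M \<Longrightarrow> g \<in> L2 M \<Longrightarrow> f - g \<in> L2 M"
  using L2_add[of f M "- g"] L2_uminus[of g M] by simp

lemma measurable_cnj [measurable (raw)]:
  "f \<in> borel_measurable M \<Longrightarrow> (\<lambda>x. cnj (f x)) \<in> borel_measurable M"
  by (intro borel_measurable_continuous_on[where f = cnj] continuous_intros)

lemma L2_cnj: "f \<in> L2 M \<Longrightarrow> cnj \<circ> f \<in> L2 M"
  by (auto simp: L2_def o_def intro: measurable_cnj)

lemma L2_subspace: "cfun.subspace (L2 M)"
  by (rule cfun.subspaceI) (auto intro: L2_zero L2_add L2_cscale)

lemma L2_integrable_mult_cnj:
  assumes "f \<in> L2 M" "g \<in> L2 M"
  shows "integrable M (\<lambda>x. f x * cnj (g x))"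
proof -
  have [measurable]: "f \<in> borel_measurable M" "g \<in> borel_measurable M"
    using assms by (auto simp: L2_def)
  have *: "norm a * norm b \<le> (norm a)\<^sup>2 + (norm b)\<^sup>2" for a b :: complex
    using sum_squares_bound[of "norm a" "norm b"] zero_le_power2[of "norm a"]
      zero_le_power2[of "norm b"] mult_nonneg_nonneg[OF norm_ge_zero[of a] norm_ge_zero[of b]]
    by linarith
  show ?thesis
    by (rule Bochner_Integration.integrable_bound
        [of M "\<lambda>x. (norm (f x))\<^sup>2 + (norm (g x))\<^sup>2"])
      (use assms * in \<open>auto simp: L2_def norm_mult\<close>)
qed

lemma L2_inner_add_left:
  "f \<in> L2 M \<Longrightarrow> g \<in> L2 M \<Longrightarrow> h \<in> L2 M \<Longrightarrow>
    L2_inner M (f + g) h = L2_inner M f h + L2_inner M g h"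
  unfolding L2_inner_def
  by (subst Bochner_Integration.integral_add[symmetric])
    (auto simp: algebra_simps intro: L2_integrable_mult_cnj)

lemma L2_inner_cscale_left: "L2_inner M (cscale c f) g = c * L2_inner M f g"
  unfolding L2_inner_def cscale_def by (simp add: mult.assoc)

lemma L2_inner_commute: "L2_inner M g f = cnj (L2_inner M f g)"
  unfolding L2_inner_def
  by (subst Bochner_Integration.integral_cnj[symmetric]) (simp add: mult.commute)

lemma L2_inner_diff_left:
  "f \<in> L2 M \<Longrightarrow> g \<in> L2 M \<Longrightarrow> h \<in> L2 M \<Longrightarrow>
    L2_inner M (f - g) h = L2_inner M f h - L2_inner M g h"
  unfolding L2_inner_def
  by (subst Bochner_Integration.integral_diff[symmetric])
    (auto simp: algebra_simps intro: L2_integrable_mult_cnj)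

lemma L2_inner_zero_left: "L2_inner M 0 h = 0"
  by (simp add: L2_inner_def)

lemma L2_inner_sum_left:
  assumes "\<And>i. i \<in> I \<Longrightarrow> f i \<in> L2 M" "h \<in> L2 M"
  shows "L2_inner M (\<Sum>i\<in>I. f i) h = (\<Sum>i\<in>I. L2_inner M (f i) h)"
  using assms
proof (induction I rule: infinite_finite_induct)
  case (insert i I)
  then have "(\<Sum>i\<in>I. f i) \<in> L2 M"
    by (intro cfun.subspace_sum[OF L2_subspace]) auto
  with insert show ?case
    by (simp only: sum.insert L2_inner_add_left insert_iff simp_thms)
qed (simp_all add: L2_inner_zero_left)

lemma L2_norm_nonneg: "0 \<le> L2_norm M f"
  by (simp add: L2_norm_def)

lemma L2_norm_sq: "(L2_norm M f)\<^sup>2 = (LINT x|M. (norm (f x))\<^sup>2)"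
  by (simp add: L2_norm_def)

lemma L2_inner_self: "L2_inner M f f = complex_of_real ((L2_norm M f)\<^sup>2)"
proof -
  have "f x * cnj (f x) = complex_of_real ((norm (f x))\<^sup>2)" for x
    by (metis complex_norm_square of_real_power)
  then show ?thesis
    by (simp only: L2_inner_def L2_norm_sq integral_complex_of_real)
qed

lemma nn_integral_L2_norm_sq:
  assumes "f \<in> L2 M"
  shows "(\<integral>\<^sup>+ x. ennreal ((norm (f x))\<^sup>2) \<partial>M) = ennreal ((L2_norm M f)\<^sup>2)"
  unfolding L2_norm_sq by (rule nn_integral_eq_integral) (use L2_integrable[OF assms] in auto)

lemma L2_iff_nn_integral:
  assumes "f \<in> borel_measurable M"
  shows "f \<in> L2 M \<longleftrightarrow> (\<integral>\<^sup>+ x. ennreal ((norm (f x))\<^sup>2) \<partial>M) < \<infinity>"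
  using assms by (auto simp: L2_def integrable_iff_bounded)

lemma L2_norm_zero_AE:
  assumes "f \<in> L2 M" "L2_norm M f = 0"
  shows "AE x in M. f x = 0"
  using integral_nonneg_eq_0_iff_AE[OF L2_integrable[OF assms(1)]] assms(2) L2_norm_sq[of M f]
  by auto

lemma L2_norm_minus_commute: "L2_norm M (f - g) = L2_norm M (g - f)"
  by (simp add: L2_norm_def norm_minus_commute)

lemma L2_norm_add_sq:
  assumes "f \<in> L2 M" "g \<in> L2 M"
  shows "(L2_norm M (f + g))\<^sup>2 = (L2_norm M f)\<^sup>2 + (L2_norm M g)\<^sup>2 + 2 * Re (L2_inner M f g)"
proof -
  have "(norm (f x + g x))\<^sup>2 = (norm (f x))\<^sup>2 + (norm (g x))\<^sup>2 + 2 * Re (f x * cnj (g x))" for x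
    unfolding cmod_power2 by (simp add: power2_eq_square algebra_simps)
  moreover have "integrable M (\<lambda>x. Re (f x * cnj (g x)))"
    by (intro integrable_Re L2_integrable_mult_cnj assms)
  moreover have "(LINT x|M. Re (f x * cnj (g x))) = Re (L2_inner M f g)"
    unfolding L2_inner_def by (intro integral_Re L2_integrable_mult_cnj assms)
  ultimately show ?thesis
    using L2_integrable[OF assms(1)] L2_integrable[OF assms(2)]
    by (simp add: L2_norm_sq del: times_complex.simps)
qed

lemma L2_norm_cscale: "L2_norm M (cscale c f) = norm c * L2_norm M f"
  by (simp add: L2_norm_def cscale_def norm_mult power_mult_distrib real_sqrt_mult)

lemma L2_Cauchy_Schwarz:
  assumes "f \<in> L2 M" "g \<in> L2 M"
  shows "norm (L2_inner M f g) \<le> L2_norm M f * L2_norm M g"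
proof -
  define c where "c = L2_inner M f g"
  define a where "a = L2_norm M f"
  define b where "b = L2_norm M g"
  have "a \<ge> 0" "b \<ge> 0" by (simp_all add: a_def b_def L2_norm_nonneg)
  have main: "2 * t * (norm c)\<^sup>2 \<le> a\<^sup>2 + t\<^sup>2 * (norm c)\<^sup>2 * b\<^sup>2" for t :: real
  proof -
    define s where "s = - of_real t * c"
    have "L2_inner M f (cscale s g) = cnj s * c"
      unfolding c_def by (metis L2_inner_commute L2_inner_cscale_left complex_cnj_mult)
    moreover have "L2_norm M (cscale s g) = \<bar>t\<bar> * norm c * b"
      by (simp only: L2_norm_cscale s_def b_def norm_mult norm_minus_cancel norm_of_real)
    moreover have "0 \<le> (L2_norm M (f + cscale s g))\<^sup>2"
      by simp
    ultimately have "0 \<le> a\<^sup>2 + (\<bar>t\<bar> * norm c * b)\<^sup>2 + 2 * Re (cnj (- of_real t * c) * c)"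
      using L2_norm_add_sq[OF assms(1) L2_cscale[OF assms(2)], of s] by (simp only: s_def a_def)
    also have "cnj (- of_real t * c) * c = of_real (- t * (norm c)\<^sup>2)"
      by (simp add: complex_norm_square mult.commute del: of_real_power)
    finally show ?thesis by (simp add: power_mult_distrib)
  qed
  have "(norm c)\<^sup>2 \<le> (a * b)\<^sup>2"
  proof (cases "c = 0")
    case False
    show ?thesis
    proof (cases "b = 0")
      case True
      have "2 * ((a\<^sup>2 + 1) / (norm c)\<^sup>2) * (norm c)\<^sup>2 \<le> a\<^sup>2"
        using main[of "(a\<^sup>2 + 1) / (norm c)\<^sup>2"] True by simp
      moreover have "2 * ((a\<^sup>2 + 1) / (norm c)\<^sup>2) * (norm c)\<^sup>2 = 2 * (a\<^sup>2 + 1)"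
        using False by simp
      ultimately have "a\<^sup>2 + 2 \<le> 0"
        by (simp only: distrib_left)
      then have False
        using zero_le_power2[of a] by linarith
      then show ?thesis ..
    next
      case False
      have "2 * (1 / b\<^sup>2) * (norm c)\<^sup>2 \<le> a\<^sup>2 + (1 / b\<^sup>2)\<^sup>2 * (norm c)\<^sup>2 * b\<^sup>2"
        by (rule main)
      moreover have "(1 / b\<^sup>2)\<^sup>2 * (norm c)\<^sup>2 * b\<^sup>2 = (1 / b\<^sup>2) * (norm c)\<^sup>2"
        using False by (simp add: power2_eq_square)
      ultimately have "(1 / b\<^sup>2) * (norm c)\<^sup>2 \<le> a\<^sup>2"
        by linarith
      then show ?thesis
        using False by (simp add: divide_le_eq power_mult_distrib)
    qed
  qed simp
  then show ?thesis
    unfolding a_def[symmetric] b_def[symmetric] c_def[symmetric]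
    using \<open>a \<ge> 0\<close> \<open>b \<ge> 0\<close> by (rule power2_le_imp_le[OF _ mult_nonneg_nonneg])
qed

lemma L2_norm_triangle:
  assumes "f \<in> L2 M" "g \<in> L2 M"
  shows "L2_norm M (f + g) \<le> L2_norm M f + L2_norm M g"
proof (rule power2_le_imp_le)
  have "Re (L2_inner M f g) \<le> L2_norm M f * L2_norm M g"
    using L2_Cauchy_Schwarz[OF assms] complex_Re_le_cmod order_trans by blast
  then show "(L2_norm M (f + g))\<^sup>2 \<le> (L2_norm M f + L2_norm M g)\<^sup>2"
    using L2_norm_add_sq[OF assms] by (simp add: power2_sum)
qed (simp add: L2_norm_nonneg)

lemma L2_norm_diff_le:
  assumes "f \<in> L2 M" "g \<in> L2 M"
  shows "\<bar>L2_norm M f - L2_norm M g\<bar> \<le> L2_norm M (f - g)"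
  using L2_norm_triangle[OF L2_diff[OF assms] assms(2)]
    L2_norm_triangle[OF L2_diff[OF assms(2,1)] assms(1)]
  by (simp add: L2_norm_minus_commute[of M g f])

lemma L2_norm_tendsto:
  assumes "\<And>n. f n \<in> L2 M" "g \<in> L2 M" "(\<lambda>n. L2_norm M (f n - g)) \<longlonglongrightarrow> 0"
  shows "(\<lambda>n. L2_norm M (f n)) \<longlonglongrightarrow> L2_norm M g"
proof -
  have "(\<lambda>n. L2_norm M (f n) - L2_norm M g) \<longlonglongrightarrow> 0"
    by (rule Lim_null_comparison[OF always_eventually assms(3)])
      (use L2_norm_diff_le[OF assms(1,2)] in auto)
  then show ?thesis by (simp add: LIM_zero_iff)
qed

lemma L2_inner_tendsto:
  assumes "\<And>n. f n \<in> L2 M" "f' \<in> L2 M" "(\<lambda>n. L2_norm M (f n - f')) \<longlonglongrightarrow> 0"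
    and "\<And>n. g n \<in> L2 M" "g' \<in> L2 M" "(\<lambda>n. L2_norm M (g n - g')) \<longlonglongrightarrow> 0"
  shows "(\<lambda>n. L2_inner M (f n) (g n)) \<longlonglongrightarrow> L2_inner M f' g'"
proof -
  have bound: "norm (L2_inner M (f n) (g n) - L2_inner M f' g')
      \<le> L2_norm M (f n - f') * L2_norm M (g n) + L2_norm M f' * L2_norm M (g n - g')" for n
  proof -
    have "L2_inner M f' (g n - g') = L2_inner M f' (g n) - L2_inner M f' g'"
      by (metis L2_inner_commute L2_inner_diff_left assms(2,4,5) complex_cnj_diff)
    then have eq: "L2_inner M (f n) (g n) - L2_inner M f' g'
        = L2_inner M (f n - f') (g n) + L2_inner M f' (g n - g')"
      using L2_inner_diff_left[OF assms(1,2,4), of n n] by simp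
    show ?thesis
      unfolding eq
      by (rule norm_triangle_le, rule add_mono)
        (intro L2_Cauchy_Schwarz L2_diff assms)+
  qed
  have "(\<lambda>n. L2_norm M (f n - f') * L2_norm M (g n)
      + L2_norm M f' * L2_norm M (g n - g')) \<longlonglongrightarrow> 0 * L2_norm M g' + L2_norm M f' * 0"
    by (intro tendsto_intros assms L2_norm_tendsto)
  then have "(\<lambda>n. L2_inner M (f n) (g n) - L2_inner M f' g') \<longlonglongrightarrow> 0"
    by (intro Lim_null_comparison[OF always_eventually[OF allI[OF bound]]]) simp
  then show ?thesis by (simp add: LIM_zero_iff)
qed

text \<open>A subsequence with rapidly decreasing consecutive distances converges almost everywhere:
  the increments \<open>D\<^sub>k\<close> satisfy \<open>\<Sum>k. 2\<^sup>k |D\<^sub>k|\<^sup>2 < \<infinity>\<close> almost everywhere, and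
  \<open>|D\<^sub>k| \<le> 2\<^sup>k |D\<^sub>k|\<^sup>2 + 2\<^sup>-\<^sup>k\<close>. Fatou's lemma turns the almost everywhere limit
  into a limit in norm.\<close>

lemma L2_complete:
  assumes f: "\<And>n::nat. f n \<in> L2 M"
    and Cauchy: "\<And>e. e > 0 \<Longrightarrow> \<exists>N. \<forall>m\<ge>N. \<forall>n\<ge>N. L2_norm M (f m - f n) < e"
  obtains g where "g \<in> L2 M" "(\<lambda>n. L2_norm M (f n - g)) \<longlonglongrightarrow> 0"
proof -
  have [measurable]: "f n \<in> borel_measurable M" for n
    using f by (rule L2_measurable)
  obtain N where N: "\<And>k m n. m \<ge> N k \<Longrightarrow> n \<ge> N k \<Longrightarrow> L2_norm M (f m - f n) < (1/2)^k"
    using Cauchy[of "(1/2)^_"] by (metis zero_less_power half_gt_zero zero_less_one)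
  \<comment> \<open>a monotone sequence of indices above \<open>N\<close>\<close>
  define r where "r k = (\<Sum>i\<le>k. N i)" for k
  have r: "N k \<le> r k" "r k \<le> r (Suc k)" for k
    by (simp_all add: r_def member_le_sum)
  have rk: "N k \<le> r (Suc k)" for k using r[of k] by linarith
  define D where "D k x = f (r (Suc k)) x - f (r k) x" for k x
  have [measurable]: "D k \<in> borel_measurable M" for k
    unfolding D_def by measurable
  have D: "(\<integral>\<^sup>+ x. ennreal ((norm (D k x))\<^sup>2) \<partial>M) \<le> ennreal ((1/4)^k)" for k
  proof -
    have "(\<integral>\<^sup>+ x. ennreal ((norm (D k x))\<^sup>2) \<partial>M) = ennreal ((L2_norm M (f (r (Suc k)) - f (r k)))\<^sup>2)"
      using nn_integral_L2_norm_sq[OF L2_diff[OF f f], of "r (Suc k)" "r k"]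
      by (simp add: D_def)
    also have "\<dots> \<le> ennreal (((1/2)^k)\<^sup>2)"
      using N[OF rk r(1), of k] by (intro ennreal_leI power_mono) (auto simp: L2_norm_nonneg)
    also have "((1/2::real)^k)\<^sup>2 = (1/4)^k"
      by (simp add: power_mult_distrib[symmetric] power2_eq_square)
    finally show ?thesis .
  qed
  have "(\<integral>\<^sup>+ x. (\<Sum>k. ennreal (2^k * (norm (D k x))\<^sup>2)) \<partial>M)
      = (\<Sum>k. ennreal (2^k) * (\<integral>\<^sup>+ x. ennreal ((norm (D k x))\<^sup>2) \<partial>M))"
    by (subst nn_integral_suminf) (simp_all add: nn_integral_cmult[symmetric] ennreal_mult)
  also have "\<dots> \<le> (\<Sum>k. ennreal ((1/2)^k))"
  proof (intro suminf_le allI)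
    fix k
    have "ennreal (2^k) * (\<integral>\<^sup>+ x. ennreal ((norm (D k x))\<^sup>2) \<partial>M) \<le> ennreal (2^k) * ennreal ((1/4)^k)"
      using D by (intro mult_left_mono) auto
    also have "\<dots> = ennreal ((1/2)^k)"
      by (simp add: ennreal_mult[symmetric] power_mult_distrib[symmetric])
    finally show "ennreal (2^k) * (\<integral>\<^sup>+ x. ennreal ((norm (D k x))\<^sup>2) \<partial>M) \<le> ennreal ((1/2)^k)" .
  qed auto
  also have "\<dots> < \<infinity>"
    using suminf_ennreal_eq[of "\<lambda>k. (1/2::real)^k" 2] power_half_series
    by (simp add: suminf_ennreal2 summable_geometric)
  finally have "(\<integral>\<^sup>+ x. (\<Sum>k. ennreal (2^k * (norm (D k x))\<^sup>2)) \<partial>M) < \<infinity>" .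
  then have "AE x in M. (\<Sum>k. ennreal (2^k * (norm (D k x))\<^sup>2)) \<noteq> \<infinity>"
    by (intro nn_integral_PInf_AE) auto
  then have conv: "AE x in M. convergent (\<lambda>k. f (r k) x)"
  proof (rule AE_mp, intro AE_I2 impI)
    fix x assume *: "(\<Sum>k. ennreal (2^k * (norm (D k x))\<^sup>2)) \<noteq> \<infinity>"
    have "summable (\<lambda>k. 2^k * (norm (D k x))\<^sup>2)"
      using * by (intro summable_suminf_not_top) auto
    then have "summable (\<lambda>k. 2^k * (norm (D k x))\<^sup>2 + (1/2)^k)"
      by (intro summable_add summable_geometric) auto
    then have "summable (\<lambda>k. D k x)"
    proof (rule summable_comparison_test'[where N=0])
      fix k
      define s where "s = sqrt (2^k)"
      have s: "s > 0" "s\<^sup>2 = 2^k" by (auto simp: s_def)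
      have "norm (D k x) = (s * norm (D k x)) * (1 / s)" using s by simp
      also have "\<dots> \<le> (s * norm (D k x))\<^sup>2 + (1/s)\<^sup>2"
        using sum_squares_bound[of "s * norm (D k x)" "1/s"] s norm_ge_zero[of "D k x"]
        by (auto simp del: norm_ge_zero)
      also have "\<dots> = 2^k * (norm (D k x))\<^sup>2 + (1/2)^k"
        using s by (simp add: power_mult_distrib power_divide)
      finally show "norm (D k x) \<le> 2^k * (norm (D k x))\<^sup>2 + (1/2)^k" .
    qed
    then have "convergent (\<lambda>n. (\<Sum>k<n. D k x) + f (r 0) x)"
      by (intro convergent_add convergent_const) (simp add: summable_iff_convergent)
    also have "(\<lambda>n. (\<Sum>k<n. D k x) + f (r 0) x) = (\<lambda>n. f (r n) x)"
      unfolding D_def by (subst sum_lessThan_telescope) simp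
    finally show "convergent (\<lambda>k. f (r k) x)" .
  qed
  define g where "g x = lim (\<lambda>k. f (r k) x)" for x
  have [measurable]: "g \<in> borel_measurable M"
    unfolding g_def by measurable
  have lim: "AE x in M. (\<lambda>k. f (r k) x) \<longlonglongrightarrow> g x"
    using conv by eventually_elim (simp add: g_def convergent_LIMSEQ_iff)
  have close: "(\<integral>\<^sup>+ x. ennreal ((norm (f n x - g x))\<^sup>2) \<partial>M) \<le> ennreal (((1/2)^j)\<^sup>2)"
    if n: "n \<ge> N j" for n j
  proof -
    have "(\<integral>\<^sup>+ x. ennreal ((norm (f n x - g x))\<^sup>2) \<partial>M)
        = (\<integral>\<^sup>+ x. liminf (\<lambda>k. ennreal ((norm (f n x - f (r k) x))\<^sup>2)) \<partial>M)"
    proof (rule nn_integral_cong_AE, use lim in eventually_elim)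
      case (elim x)
      then have "(\<lambda>k. ennreal ((norm (f n x - f (r k) x))\<^sup>2)) \<longlonglongrightarrow> ennreal ((norm (f n x - g x))\<^sup>2)"
        by (intro tendsto_intros)
      from lim_imp_Liminf[OF sequentially_bot this] show ?case by (rule sym)
    qed
    also have "\<dots> \<le> liminf (\<lambda>k. \<integral>\<^sup>+ x. ennreal ((norm (f n x - f (r k) x))\<^sup>2) \<partial>M)"
      by (rule nn_integral_liminf) measurable
    also have "\<dots> \<le> limsup (\<lambda>k. \<integral>\<^sup>+ x. ennreal ((norm (f n x - f (r k) x))\<^sup>2) \<partial>M)"
      by (rule Liminf_le_Limsup) simp
    also have "\<dots> \<le> ennreal (((1/2)^j)\<^sup>2)"
    proof (rule Limsup_bounded, rule eventually_sequentiallyI[of j])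
      fix k assume "j \<le> k"
      then have "N j \<le> r k"
        unfolding r_def by (intro member_le_sum) auto
      then have "(L2_norm M (f n - f (r k)))\<^sup>2 \<le> ((1/2)^j)\<^sup>2"
        using N[OF n, of "r k"] by (intro power_mono) (auto simp: L2_norm_nonneg)
      then show "(\<integral>\<^sup>+ x. ennreal ((norm (f n x - f (r k) x))\<^sup>2) \<partial>M) \<le> ennreal (((1/2)^j)\<^sup>2)"
        using nn_integral_L2_norm_sq[OF L2_diff[OF f f], of n "r k"] by (simp add: ennreal_leI)
    qed
    finally show ?thesis .
  qed
  have "f (N 0) - g \<in> L2 M"
    by (subst L2_iff_nn_integral)
      (use close[of 0 "N 0"] in \<open>auto simp: less_top[symmetric] top_unique fun_diff_def\<close>)
  then have g: "g \<in> L2 M"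
    using L2_diff[OF f[of "N 0"], of "f (N 0) - g"] by simp
  have norm_le: "L2_norm M (f n - g) \<le> (1/2)^j" if "n \<ge> N j" for n j
  proof (rule power2_le_imp_le)
    have "ennreal ((L2_norm M (f n - g))\<^sup>2) \<le> ennreal (((1/2)^j)\<^sup>2)"
      using close[OF that] nn_integral_L2_norm_sq[OF L2_diff[OF f g], of n] by simp
    then show "(L2_norm M (f n - g))\<^sup>2 \<le> ((1/2)^j)\<^sup>2"
      by (subst (asm) ennreal_le_iff) auto
  qed simp
  have "(\<lambda>n. L2_norm M (f n - g)) \<longlonglongrightarrow> 0"
  proof (rule LIMSEQ_I)
    fix e :: real assume "e > 0"
    then obtain j where "(1/2::real)^j < e"
      using real_arch_pow_inv[of e "1/2"] by auto
    then show "\<exists>n0. \<forall>n\<ge>n0. norm (L2_norm M (f n - g) - 0) < e"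
      using norm_le[of j] L2_norm_nonneg[of M]
      by (intro exI[of _ "N j"] allI impI)
        (simp only: diff_zero real_norm_def abs_of_nonneg, rule le_less_trans)
  qed
  with g that show thesis by blast
qed

section \<open>The Gaussian and its Fourier transform\<close>

interpretation lebesgue: sigma_finite_measure "lebesgue :: 'a::euclidean_space measure"
proof
  obtain A :: "'a set set" where "countable A" "A \<subseteq> sets lborel" "\<Union>A = space lborel"
    "\<forall>a\<in>A. emeasure lborel a \<noteq> \<infinity>"
    using lborel.sigma_finite_countable by blast
  then show "\<exists>A. countable A \<and> A \<subseteq> sets lebesgue \<and> \<Union>A = space lebesgue \<and>
      (\<forall>a\<in>A. emeasure (lebesgue :: 'a measure) a \<noteq> \<infinity>)"
    by (intro exI[of _ A]) auto
qed

interpretation lebesgue_pair: pair_sigma_finite "lebesgue :: 'a::euclidean_space measure" "lebesgue :: 'b::euclidean_space measure"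
  ..

lemma measurable_lebesgue_ident: "(\<lambda>x. x) \<in> borel_measurable lebesgue"
  using id_borel_measurable_lebesgue by (simp add: id_def)

lemma borel_measurable_lebesgueI: "f \<in> borel_measurable borel \<Longrightarrow> f \<in> borel_measurable lebesgue"
  by (rule measurable_completion) simp

lemma measurable_fst_lebesgue [measurable]: "fst \<in> borel_measurable (lebesgue \<Otimes>\<^sub>M M)"
  by (rule measurable_compose[OF measurable_fst measurable_lebesgue_ident])

lemma measurable_snd_lebesgue [measurable]: "snd \<in> borel_measurable (M \<Otimes>\<^sub>M lebesgue)"
  by (rule measurable_compose[OF measurable_snd measurable_lebesgue_ident])

text \<open>\<open>heat s\<close> is the Fourier transform of \<open>gauss s\<close>. Up to the
  parametrization of time it is the heat kernel: it has total mass one and concentrates at the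
  origin as \<open>s\<close> tends to zero, while \<open>gauss s\<close> increases to one.\<close>

definition gauss :: "real \<Rightarrow> 'a::euclidean_space \<Rightarrow> real"
  where "gauss s x = exp (- pi * (s * norm x)\<^sup>2)"

definition heat :: "real \<Rightarrow> 'a::euclidean_space \<Rightarrow> real"
  where "heat s x = gauss (1 / s) x / s ^ DIM('a)"

definition character :: "'a::euclidean_space \<Rightarrow> 'a \<Rightarrow> complex"
  where "character w x = exp (- (2 * of_real pi * \<i> * of_real (w \<bullet> x)))"

lemma norm_character [simp]: "norm (character w x) = 1"
proof -
  have "character w x = cis (- (2 * pi * (w \<bullet> x)))"
    by (simp add: character_def cis_conv_exp algebra_simps)
  then show ?thesis by simp
qed

lemma measurable_gauss [measurable]: "gauss s \<in> borel_measurable borel"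
  unfolding gauss_def[abs_def] by measurable

lemma measurable_heat [measurable]: "heat s \<in> borel_measurable borel"
  unfolding heat_def[abs_def] by measurable

lemma gauss_pos: "0 < gauss s x"
  by (simp add: gauss_def)

lemma heat_nonneg: "0 < s \<Longrightarrow> 0 \<le> heat s x"
  by (simp add: heat_def gauss_pos less_imp_le)

lemma heat_minus: "heat s (x - y) = heat s (y - x)"
  by (simp add: heat_def gauss_def norm_minus_commute)

text \<open>This is the characteristic function of the standard normal distribution after the
  substitution \<open>x = sqrt (2 * pi) * s * y\<close>.\<close>

lemma gauss_fourier_real:
  fixes s z :: real
  assumes "0 < s"
  shows "integrable lborel (\<lambda>y. of_real (gauss s y) * character y z)"
    and "(CLBINT y. of_real (gauss s y) * character y z) = of_real (heat s z)"
proof -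
  define c where "c = sqrt (2 * pi) * s"
  define t where "t = - sqrt (2 * pi) * z / s"
  have c: "c > 0" using assms by (simp add: c_def)
  have ct: "c * t = - (2 * pi * z)"
    using assms by (simp add: c_def t_def)
  define h where "h x = std_normal_density x *\<^sub>R iexp (t * x)" for x
  have [measurable]: "h \<in> borel_measurable borel"
    unfolding h_def[abs_def] by measurable
  have "integrable lborel std_normal_density"
    using integrable_std_normal_moment[of 0] by simp
  then have int_h: "integrable lborel h"
    by (rule Bochner_Integration.integrable_bound) (auto simp: h_def norm_mult)
  have "(CLBINT x. h x) = of_real (exp (- (t\<^sup>2) / 2))"
    using fun_cong[OF char_std_normal_distribution, of t]
    unfolding char_def h_def by (subst (asm) integral_density) (auto simp: algebra_simps)
  then have val: "(CLBINT y. h (0 + c * y)) = of_real (exp (- (t\<^sup>2) / 2) / c)"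
    using lborel_integral_real_affine[of c h 0] c by (simp add: scaleR_conv_of_real field_simps)
  have int: "integrable lborel (\<lambda>y. h (0 + c * y))"
    using int_h c by (subst lborel_integrable_real_affine_iff) auto
  have h: "sqrt (2 * pi) *\<^sub>R h (0 + c * y) = of_real (gauss s y) * character y z" for y
  proof -
    have "(c * y)\<^sup>2 / 2 = pi * (s * y)\<^sup>2"
      by (simp add: c_def power_mult_distrib)
    then have "sqrt (2 * pi) * std_normal_density (c * y) = gauss s y"
      by (simp add: std_normal_density_def gauss_def power_mult_distrib)
    moreover have "iexp (t * (c * y)) = character y z"
    proof -
      have "t * (c * y) = (c * t) * y"
        by (simp only: ac_simps)
      also have "\<dots> = - (2 * pi * (y * z))"
        by (simp add: ct)
      finally have "t * (c * y) = - (2 * pi * (y * z))" .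
      then show ?thesis by (simp add: character_def algebra_simps)
    qed
    ultimately show ?thesis
      by (simp add: h_def scaleR_conv_of_real mult.assoc[symmetric] flip: of_real_mult)
  qed
  show "integrable lborel (\<lambda>y. of_real (gauss s y) * character y z)"
    unfolding h[symmetric] using int by (intro integrable_scaleR_right) auto
  have "t\<^sup>2 / 2 = pi * (1 / s * norm z)\<^sup>2"
    using assms by (simp add: t_def power_mult_distrib power_divide)
  then have "sqrt (2 * pi) * (exp (- (t\<^sup>2) / 2) / c) = heat s z"
    using assms by (simp add: heat_def gauss_def c_def)
  then show "(CLBINT y. of_real (gauss s y) * character y z) = of_real (heat s z)"
    unfolding h[symmetric] integral_scaleR_right val
    by (simp only: scaleR_conv_of_real flip: of_real_mult)
qed

text \<open>Lebesgue measure is the product measure over the coordinates, so that integrals of products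
  of functions of one coordinate factor. This is what reduces the Gaussian to dimension one.\<close>

lemma lborel_Basis_product:
  fixes f :: "'a::euclidean_space \<Rightarrow> real \<Rightarrow> complex"
  assumes "\<And>b. b \<in> Basis \<Longrightarrow> integrable lborel (f b)"
  shows "integrable lborel (\<lambda>x. \<Prod>b\<in>Basis. f b (x \<bullet> b))"
    and "(LINT x|lborel. (\<Prod>b\<in>Basis. f b (x \<bullet> b))) = (\<Prod>b\<in>Basis. LINT y|lborel. f b y)"
proof -
  interpret product_sigma_finite "\<lambda>_::'a. lborel :: real measure" ..
  have [measurable]: "b \<in> Basis \<Longrightarrow> f b \<in> borel_measurable borel" for b
    using borel_measurable_integrable[OF assms] by simp
  have [measurable]: "(\<lambda>x. \<Prod>b\<in>Basis. f b (x \<bullet> b)) \<in> borel_measurable borel"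
    by measurable
  have [measurable]: "(\<lambda>p. \<Sum>b\<in>Basis. p b *\<^sub>R b) \<in> measurable (\<Pi>\<^sub>M b\<in>(Basis::'a set). lborel) borel"
    by (intro borel_measurable_sum borel_measurable_scaleR borel_measurable_const) simp
  have eq: "(\<Prod>b\<in>Basis. f b ((\<Sum>b\<in>Basis. p b *\<^sub>R b) \<bullet> b)) = (\<Prod>b\<in>Basis. f b (p b))" for p
    by (intro prod.cong refl) (simp add: inner_sum_left inner_Basis if_distrib cong: if_cong)
  show "integrable lborel (\<lambda>x. \<Prod>b\<in>Basis. f b (x \<bullet> b))"
    by (subst lborel_eq, subst integrable_distr_eq) (auto simp: eq intro!: product_integrable_prod assms)
  show "(LINT x|lborel. (\<Prod>b\<in>Basis. f b (x \<bullet> b))) = (\<Prod>b\<in>Basis. LINT y|lborel. f b y)"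
    by (subst lborel_eq, subst integral_distr) (auto simp: eq intro!: product_integral_prod assms)
qed

lemma gauss_fourier:
  fixes z :: "'a::euclidean_space"
  assumes "0 < s"
  shows "integrable lborel (\<lambda>y. of_real (gauss s y) * character y z)"
    and "(CLBINT y. of_real (gauss s y) * character y z) = of_real (heat s z)"
proof -
  have norm_sq: "(r * norm x)\<^sup>2 = (\<Sum>b\<in>Basis. (r * norm (x \<bullet> b))\<^sup>2)" for x :: 'a and r
    by (simp add: power_mult_distrib norm_eq_sqrt_inner[of x] euclidean_inner[of x x]
        sum_distrib_left power2_eq_square[of "_ \<bullet> _"] sum_nonneg)
  have gauss_prod: "gauss r x = (\<Prod>b\<in>Basis. gauss r (x \<bullet> b))" for x :: 'a and r
    by (simp only: gauss_def norm_sq sum_distrib_left exp_sum finite_Basis)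
  have char_prod: "character x z = (\<Prod>b\<in>Basis. character (x \<bullet> b) (z \<bullet> b))" for x
    by (simp add: character_def euclidean_inner[of x z] sum_distrib_left exp_sum
        flip: sum_negf)
  have eq: "of_real (gauss s x) * character x z
      = (\<Prod>b\<in>Basis. of_real (gauss s (x \<bullet> b)) * character (x \<bullet> b) (z \<bullet> b))" for x
    by (simp add: gauss_prod[of _ x] char_prod prod.distrib)
  have heat: "heat s z = (\<Prod>b\<in>Basis. heat s (z \<bullet> b))"
    by (simp add: heat_def gauss_prod[of _ z] prod_dividef)
  show "integrable lborel (\<lambda>y. of_real (gauss s y) * character y z)"
    unfolding eq by (rule lborel_Basis_product(1)) (rule gauss_fourier_real(1)[OF assms])
  show "(CLBINT y. of_real (gauss s y) * character y z) = of_real (heat s z)"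
    unfolding eq heat of_real_prod gauss_fourier_real(2)[OF assms, symmetric]
    by (rule lborel_Basis_product(2)) (rule gauss_fourier_real(1)[OF assms])
qed

lemma gauss_integral:
  assumes "0 < s"
  shows "integrable lborel (gauss s :: 'a::euclidean_space \<Rightarrow> real)"
    and "(LBINT y::'a. gauss s y) = 1 / s ^ DIM('a)"
proof -
  have char0: "character y 0 = 1" for y :: 'a by (simp add: character_def)
  have *: "integrable lborel (\<lambda>y::'a. complex_of_real (gauss s y))"
    "(CLBINT y::'a. of_real (gauss s y)) = of_real (heat s (0::'a))"
    using gauss_fourier[OF assms, of "0::'a"] by (simp_all add: char0)
  then show "integrable lborel (gauss s :: 'a \<Rightarrow> real)"
    by (simp add: complex_of_real_integrable_eq)
  show "(LBINT y::'a. gauss s y) = 1 / s ^ DIM('a)"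
    using *(2) 
    by (simp only: integral_complex_of_real of_real_eq_iff) (simp add: heat_def gauss_def[of _ 0])
qed

lemma nn_integral_heat:
  assumes "0 < s"
  shows "(\<integral>\<^sup>+ z. ennreal (heat s (z :: 'a::euclidean_space)) \<partial>lborel) = 1"
proof -
  have "0 < 1 / s" using assms by simp
  note * = gauss_integral[OF this, where 'a='a]
  have "(\<integral>\<^sup>+ z. ennreal (heat s (z :: 'a)) \<partial>lborel) = ennreal (LBINT z::'a. heat s z)"
    by (rule nn_integral_eq_integral)
      (use *(1) heat_nonneg[OF assms] in \<open>auto simp: heat_def[abs_def]\<close>)
  also have "(LBINT z::'a. heat s z) = 1"
    using *(2) assms by (simp add: heat_def[abs_def] power_divide)
  finally show ?thesis by simp
qed

lemma nn_integral_lborel_reflect: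
  fixes f :: "'a::euclidean_space \<Rightarrow> ennreal"
  assumes [measurable]: "f \<in> borel_measurable borel"
  shows "(\<integral>\<^sup>+ y. f (x - y) \<partial>lborel) = (\<integral>\<^sup>+ y. f y \<partial>lborel)"
  by (subst (2) lborel_affine[of "-1" x]) (simp_all add: nn_integral_density nn_integral_distr)

lemma nn_integral_heat_shift:
  assumes "0 < s"
  shows "(\<integral>\<^sup>+ y. ennreal (heat s (x - y :: 'a::euclidean_space)) \<partial>lebesgue) = 1"
  using nn_integral_lborel_reflect[of "\<lambda>z::'a. ennreal (heat s z)" x]
  by (simp add: nn_integral_completion nn_integral_heat[OF assms])

text \<open>At distance at least \<open>\<delta>\<close> from the origin, half of the exponent of the kernel is spent on a factor
  that is uniformly small, and the other half is a kernel with parameter \<open>sqrt 2 * s\<close>, which again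
  has mass one.\<close>

lemma heat_mass_away:
  fixes x :: "'a::euclidean_space"
  assumes "0 < s" "0 < \<delta>" and S: "S \<in> sets lebesgue" "\<And>y. y \<in> S \<Longrightarrow> \<delta> \<le> dist x y"
  shows "(\<integral>\<^sup>+ y. ennreal (heat s (x - y)) * indicator S y \<partial>lebesgue)
    \<le> ennreal (sqrt 2 ^ DIM('a) * gauss (\<delta> / (sqrt 2 * s)) (1::real))"
proof -
  let ?c = "sqrt 2 ^ DIM('a) * gauss (\<delta> / (sqrt 2 * s)) (1::real)"
  have pt: "heat s z \<le> ?c * heat (sqrt 2 * s) z" if "\<delta> \<le> norm z" for z :: 'a
  proof -
    define a where "a = pi * (norm z)\<^sup>2 / (2 * s\<^sup>2)"
    have "\<delta>\<^sup>2 \<le> (norm z)\<^sup>2" using that assms by (intro power_mono) auto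
    then have le: "pi * \<delta>\<^sup>2 / (2 * s\<^sup>2) \<le> a"
      unfolding a_def by (intro divide_right_mono mult_left_mono) auto
    have "heat s z = exp (- a) * exp (- a) / s ^ DIM('a)"
      by (simp add: heat_def gauss_def a_def power_mult_distrib power_divide flip: exp_add)
    also have "\<dots> \<le> exp (- (pi * \<delta>\<^sup>2 / (2 * s\<^sup>2))) * exp (- a) / s ^ DIM('a)"
      using le assms by (intro divide_right_mono mult_right_mono) auto
    also have "\<dots> = ?c * heat (sqrt 2 * s) z"
      by (simp add: heat_def gauss_def a_def power_mult_distrib power_divide)
    finally show ?thesis .
  qed
  have "(\<integral>\<^sup>+ y. ennreal (heat s (x - y)) * indicator S y \<partial>lebesgue)
      \<le> (\<integral>\<^sup>+ y. ennreal ?c * ennreal (heat (sqrt 2 * s) (x - y)) \<partial>lebesgue)"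
  proof (rule nn_integral_mono)
    fix y
    show "ennreal (heat s (x - y)) * indicator S y \<le> ennreal ?c * ennreal (heat (sqrt 2 * s) (x - y))"
      using pt[of "x - y"] S(2)[of y] assms gauss_pos[of "\<delta> / (sqrt 2 * s)" "1::real"]
      by (cases "y \<in> S") (auto simp: dist_norm ennreal_mult[symmetric] heat_nonneg intro!: ennreal_leI)
  qed
  also have "\<dots> = ennreal ?c * (\<integral>\<^sup>+ y. ennreal (heat (sqrt 2 * s) (x - y)) \<partial>lebesgue)"
    by (rule nn_integral_cmult, rule borel_measurable_lebesgueI) measurable
  also have "\<dots> = ennreal ?c"
    using nn_integral_heat_shift[of "sqrt 2 * s" x] assms by simp
  finally show ?thesis .
qed

section \<open>Approximation of the identity\<close>

text \<open>The mean square oscillation of \<open>f\<close> at scale \<open>s\<close>. It measures how far \<open>f\<close> is from its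
  convolution with the heat kernel, \<open>\<parallel>f\<parallel>\<^sup>2 - \<langle>heat s * f, f\<rangle> = oscillation s f / 2\<close>, and has the
  advantage of being a nonnegative integral that is defined for every measurable \<open>f\<close>.\<close>

definition oscillation :: "real \<Rightarrow> ('a::euclidean_space \<Rightarrow> 'b::real_normed_vector) \<Rightarrow> ennreal"
  where "oscillation s f =
    (\<integral>\<^sup>+ x. \<integral>\<^sup>+ y. ennreal (heat s (x - y) * (norm (f x - f y))\<^sup>2) \<partial>lebesgue \<partial>lebesgue)"

lemma measurable_heat_diff [measurable]:
  "(\<lambda>p. heat s (fst p - snd p)) \<in> borel_measurable (lebesgue \<Otimes>\<^sub>M lebesgue)"
  by (rule measurable_compose[OF _ measurable_heat]) measurable

lemma nn_integral_heat_left: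
  assumes "0 < s" and [measurable]: "u \<in> borel_measurable lebesgue"
  shows "(\<integral>\<^sup>+ x. \<integral>\<^sup>+ y. ennreal (heat s (x - y)) * u x \<partial>lebesgue \<partial>lebesgue)
    = (\<integral>\<^sup>+ x. u x \<partial>(lebesgue :: 'a::euclidean_space measure))"
proof (rule nn_integral_cong)
  fix x :: 'a
  have "(\<lambda>y. ennreal (heat s (x - y))) \<in> borel_measurable lebesgue"
    by (rule borel_measurable_lebesgueI) measurable
  then show "(\<integral>\<^sup>+ y. ennreal (heat s (x - y)) * u x \<partial>lebesgue) = u x"
    by (simp add: nn_integral_multc nn_integral_heat_shift[OF assms(1)])
qed

lemma nn_integral_heat_right:
  assumes "0 < s" and [measurable]: "u \<in> borel_measurable lebesgue"
  shows "(\<integral>\<^sup>+ x. \<integral>\<^sup>+ y. ennreal (heat s (x - y)) * u y \<partial>lebesgue \<partial>lebesgue)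
    = (\<integral>\<^sup>+ x. u x \<partial>(lebesgue :: 'a::euclidean_space measure))"
proof -
  have "(\<lambda>(x, y). ennreal (heat s (x - y)) * u y)
      \<in> borel_measurable (lebesgue \<Otimes>\<^sub>M (lebesgue :: 'a measure))"
    unfolding split_beta by measurable
  then have "(\<integral>\<^sup>+ x. \<integral>\<^sup>+ y. ennreal (heat s (x - y)) * u y \<partial>lebesgue \<partial>(lebesgue :: 'a measure))
      = (\<integral>\<^sup>+ y. \<integral>\<^sup>+ x. ennreal (heat s (x - y)) * u y \<partial>lebesgue \<partial>lebesgue)"
    by (rule lebesgue_pair.Fubini'[symmetric])
  also have "\<dots> = (\<integral>\<^sup>+ y. \<integral>\<^sup>+ x. ennreal (heat s (y - x)) * u y \<partial>lebesgue \<partial>lebesgue)"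
    by (simp add: heat_minus)
  finally show ?thesis
    using nn_integral_heat_left[OF assms] by simp
qed

lemma ennreal_mult_double:
  assumes "0 \<le> a" "0 \<le> u" "0 \<le> v"
  shows "ennreal (a * (2 * u + 2 * v)) = 2 * ennreal (a * u) + 2 * ennreal (a * v)"
proof -
  have "ennreal (2 * w) = 2 * ennreal w" if "0 \<le> w" for w
    using that by (simp add: ennreal_mult')
  moreover have "a * (2 * u + 2 * v) = 2 * (a * u) + 2 * (a * v)"
    by (simp add: algebra_simps)
  ultimately show ?thesis
    using assms by (simp add: ennreal_plus)
qed

lemma oscillation_mono_sum:
  fixes f :: "'a::euclidean_space \<Rightarrow> 'b::{real_normed_vector, second_countable_topology}"
    and g :: "'a \<Rightarrow> 'c::{real_normed_vector, second_countable_topology}"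
    and h :: "'a \<Rightarrow> 'd::{real_normed_vector, second_countable_topology}"
  assumes "0 < s"
    and [measurable]: "f \<in> borel_measurable lebesgue" "g \<in> borel_measurable lebesgue"
      "h \<in> borel_measurable lebesgue"
    and le: "\<And>x y. (norm (f x - f y))\<^sup>2 \<le> 2 * (norm (g x - g y))\<^sup>2 + 2 * (norm (h x - h y))\<^sup>2"
  shows "oscillation s f \<le> 2 * oscillation s g + 2 * oscillation s h"
proof -
  have [measurable]: "(\<lambda>(x, y). ennreal (heat s (x - y) * (norm (k x - k y))\<^sup>2))
      \<in> borel_measurable (lebesgue \<Otimes>\<^sub>M (lebesgue :: 'a measure))"
    if [measurable]: "k \<in> borel_measurable lebesgue"
    for k :: "'a \<Rightarrow> 'e::{real_normed_vector, second_countable_topology}"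
    unfolding split_beta by measurable
  let ?I = "\<lambda>k x y. ennreal (heat s (x - y) * (norm (k x - k y :: 'e::real_normed_vector))\<^sup>2)"
  have "oscillation s f \<le> (\<integral>\<^sup>+ x. \<integral>\<^sup>+ y. 2 * ennreal (heat s (x - y) * (norm (g x - g y))\<^sup>2)
      + 2 * ennreal (heat s (x - y) * (norm (h x - h y))\<^sup>2) \<partial>lebesgue \<partial>lebesgue)"
    unfolding oscillation_def
  proof (intro nn_integral_mono)
    fix x y :: 'a
    have "heat s (x - y) * (norm (f x - f y))\<^sup>2
        \<le> heat s (x - y) * (2 * (norm (g x - g y))\<^sup>2 + 2 * (norm (h x - h y))\<^sup>2)"
      using le heat_nonneg[OF assms(1)] by (intro mult_left_mono) auto
    also have "ennreal \<dots> = 2 * ennreal (heat s (x - y) * (norm (g x - g y))\<^sup>2)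
      + 2 * ennreal (heat s (x - y) * (norm (h x - h y))\<^sup>2)"
      by (rule ennreal_mult_double) (simp_all add: heat_nonneg assms)
    finally show "ennreal (heat s (x - y) * (norm (f x - f y))\<^sup>2)
        \<le> 2 * ennreal (heat s (x - y) * (norm (g x - g y))\<^sup>2)
          + 2 * ennreal (heat s (x - y) * (norm (h x - h y))\<^sup>2)"
      by (auto intro: ennreal_leI)
  qed
  also have "\<dots> = 2 * oscillation s g + 2 * oscillation s h"
    unfolding oscillation_def
    by (simp add: nn_integral_add nn_integral_cmult)
  finally show ?thesis .
qed

lemma oscillation_le:
  fixes f :: "'a::euclidean_space \<Rightarrow> 'b::{real_normed_vector, second_countable_topology}"
  assumes "0 < s" and [measurable]: "f \<in> borel_measurable lebesgue"
  shows "oscillation s f \<le> 4 * (\<integral>\<^sup>+ x. ennreal ((norm (f x))\<^sup>2) \<partial>lebesgue)"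
proof -
  have [measurable]: "(\<lambda>x. ennreal ((norm (f x))\<^sup>2)) \<in> borel_measurable lebesgue"
    by measurable
  have "oscillation s f \<le> (\<integral>\<^sup>+ x. \<integral>\<^sup>+ y. 2 * (ennreal (heat s (x - y)) * ennreal ((norm (f x))\<^sup>2))
      + 2 * (ennreal (heat s (x - y)) * ennreal ((norm (f y))\<^sup>2)) \<partial>lebesgue \<partial>lebesgue)"
    unfolding oscillation_def
  proof (intro nn_integral_mono)
    fix x y :: 'a
    have "heat s (x - y) * (norm (f x - f y))\<^sup>2
        \<le> heat s (x - y) * (2 * (norm (f x))\<^sup>2 + 2 * (norm (f y))\<^sup>2)"
      using norm_add_sq_le[of "f x" "- f y"] heat_nonneg[OF assms(1)]
      by (intro mult_left_mono) auto
    also have "ennreal \<dots> = 2 * (ennreal (heat s (x - y)) * ennreal ((norm (f x))\<^sup>2))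
      + 2 * (ennreal (heat s (x - y)) * ennreal ((norm (f y))\<^sup>2))"
      by (simp add: ennreal_mult_double heat_nonneg assms flip: ennreal_mult)
    finally show "ennreal (heat s (x - y) * (norm (f x - f y))\<^sup>2)
        \<le> 2 * (ennreal (heat s (x - y)) * ennreal ((norm (f x))\<^sup>2))
          + 2 * (ennreal (heat s (x - y)) * ennreal ((norm (f y))\<^sup>2))"
      by (auto intro: ennreal_leI)
  qed
  also have "\<dots> = 2 * (\<integral>\<^sup>+ x. \<integral>\<^sup>+ y. ennreal (heat s (x - y)) * ennreal ((norm (f x))\<^sup>2) \<partial>lebesgue \<partial>lebesgue)
      + 2 * (\<integral>\<^sup>+ x. \<integral>\<^sup>+ y. ennreal (heat s (x - y)) * ennreal ((norm (f y))\<^sup>2) \<partial>lebesgue \<partial>lebesgue)"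
  proof -
    have [measurable]: "(\<lambda>(x, y). ennreal (heat s (x - y)) * ennreal ((norm (f x))\<^sup>2))
        \<in> borel_measurable (lebesgue \<Otimes>\<^sub>M (lebesgue :: 'a measure))"
      "(\<lambda>(x, y). ennreal (heat s (x - y)) * ennreal ((norm (f y))\<^sup>2))
        \<in> borel_measurable (lebesgue \<Otimes>\<^sub>M (lebesgue :: 'a measure))"
      unfolding split_beta by measurable
    show ?thesis by (simp add: nn_integral_add nn_integral_cmult)
  qed
  also have "\<dots> = 4 * (\<integral>\<^sup>+ x. ennreal ((norm (f x))\<^sup>2) \<partial>lebesgue)"
    by (simp add: nn_integral_heat_left[OF assms(1)] nn_integral_heat_right[OF assms(1)]
        distrib_right[symmetric])
  finally show ?thesis .
qed

lemma ennreal_tendsto_0_le: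
  fixes f g :: "nat \<Rightarrow> ennreal"
  assumes "\<And>n. f n \<le> g n" "g \<longlonglongrightarrow> 0"
  shows "f \<longlonglongrightarrow> 0"
  by (rule tendsto_sandwich[OF _ _ tendsto_const assms(2)]) (simp_all add: assms(1))

text \<open>Choose an open \<open>U\<close> containing \<open>A\<close> with \<open>U - A\<close> of measure less than \<open>e\<close>. A pair of points of which
  exactly one lies in \<open>A\<close> either has a point in \<open>U - A\<close>, which contributes at most \<open>2 * e\<close>, or
  has one point in \<open>U\<close> and the other outside. The latter contribution tends to zero by dominated
  convergence, because every point of \<open>U\<close> has positive distance from the complement of \<open>U\<close>.\<close>

lemma oscillation_eps_tendsto_0_indicator:
  assumes "A \<in> sets lebesgue" "emeasure lebesgue A < \<infinity>"
  shows "(\<lambda>n. oscillation (1 / real (Suc n)) (indicator A :: 'a::euclidean_space \<Rightarrow> real)) \<longlonglongrightarrow> 0"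
proof -
  define s where "s n = 1 / real (Suc n)" for n
  have s: "0 < s n" for n by (simp add: s_def)
  have bound: "\<exists>b. (\<forall>n. oscillation (s n) (indicator A :: 'a \<Rightarrow> real) \<le> ennreal (2 * e) + b n) \<and> b \<longlonglongrightarrow> 0"
    if "e > 0" for e :: real
  proof -
    obtain U where U: "open U" "A \<subseteq> U" "U - A \<in> lmeasurable" "emeasure lebesgue (U - A) < ennreal e"
      using sets_lebesgue_outer_open[OF assms(1) \<open>e > 0\<close>] by blast
    have [measurable]: "U \<in> sets lebesgue" "U - A \<in> sets lebesgue"
      using U assms(1) by auto
    have CU [measurable]: "- U \<in> sets lebesgue"
      by (simp add: Compl_in_sets_lebesgue)
    have "emeasure lebesgue U \<le> emeasure lebesgue A + emeasure lebesgue (U - A)"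
      using U(2) assms(1) emeasure_subadditive[of A lebesgue "U - A"] by (simp add: Un_absorb1)
    then have finU: "emeasure lebesgue U < \<infinity>"
      using U(4) assms(2) by (auto simp: less_top[symmetric] top_unique intro: le_less_trans)
    define a where "a n x = (\<integral>\<^sup>+ y. ennreal (heat (s n) (x - y)) * indicator (- U) y \<partial>lebesgue)"
      for n and x :: 'a
    have ms: "(\<lambda>(x, y). ennreal (heat r (x - y)) * indicator S y)
        \<in> borel_measurable (lebesgue \<Otimes>\<^sub>M (lebesgue :: 'a measure))"
      "(\<lambda>(x, y). ennreal (heat r (x - y)) * indicator S x)
        \<in> borel_measurable (lebesgue \<Otimes>\<^sub>M (lebesgue :: 'a measure))"
      "(\<lambda>(x, y). ennreal (heat r (x - y)) * (indicator S x * indicator T y))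
        \<in> borel_measurable (lebesgue \<Otimes>\<^sub>M (lebesgue :: 'a measure))"
      if [measurable]: "S \<in> sets lebesgue" "T \<in> sets lebesgue" for S T :: "'a set" and r
      unfolding split_beta by measurable
    have [measurable]: "a n \<in> borel_measurable lebesgue" for n
      unfolding a_def
      by (rule lebesgue.borel_measurable_nn_integral) (rule ms(1)[OF CU CU])
    have a_le: "a n x \<le> 1" for n x
    proof -
      have "a n x \<le> (\<integral>\<^sup>+ y. ennreal (heat (s n) (x - y)) \<partial>lebesgue)"
        unfolding a_def by (intro nn_integral_mono) (auto simp: indicator_def)
      then show ?thesis by (simp add: nn_integral_heat_shift[OF s])
    qed
    have a_lim: "(\<lambda>n. a n x * indicator U x) \<longlonglongrightarrow> 0" for x
    proof (cases "x \<in> U")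
      case True
      then obtain \<delta> where \<delta>: "\<delta> > 0" "ball x \<delta> \<subseteq> U"
        using U(1) open_contains_ball by blast
      have "a n x \<le> ennreal (sqrt 2 ^ DIM('a) * gauss (\<delta> / (sqrt 2 * s n)) (1::real))" for n
        unfolding a_def using s[of n] \<delta> CU
          by (intro heat_mass_away) (auto simp: subset_iff not_less[symmetric])
      moreover have "(\<lambda>n. ennreal (sqrt 2 ^ DIM('a) * gauss (\<delta> / (sqrt 2 * s n)) (1::real)))
          \<longlonglongrightarrow> ennreal (sqrt 2 ^ DIM('a) * 0)"
      proof (rule tendsto_ennrealI, rule tendsto_mult_left)
        define k where "k = pi * \<delta>\<^sup>2 / 2"
        have "k > 0" using \<delta> by (simp add: k_def)
        have le: "gauss (\<delta> / (sqrt 2 * s n)) (1::real) \<le> inverse (k * real (Suc n))" for n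
        proof -
          have e: "gauss (\<delta> / (sqrt 2 * s n)) (1::real) = exp (- (k * (real (Suc n))\<^sup>2))"
            by (simp add: gauss_def k_def s_def power_mult_distrib power_divide)
          have "k * real (Suc n) \<le> k * (real (Suc n))\<^sup>2"
            using \<open>k > 0\<close> by (intro mult_left_mono) (auto simp: power2_eq_square)
          also have "\<dots> \<le> exp (k * (real (Suc n))\<^sup>2)"
            using exp_ge_add_one_self[of "k * (real (Suc n))\<^sup>2"] by linarith
          finally show ?thesis
            unfolding e exp_minus using \<open>k > 0\<close> by (intro le_imp_inverse_le) auto
        qed
        have "(\<lambda>n. inverse (k * real (Suc n))) \<longlonglongrightarrow> 0"
          using LIMSEQ_inverse_real_of_nat[THEN tendsto_mult_left, of "inverse k"] by simp
        then show "(\<lambda>n. gauss (\<delta> / (sqrt 2 * s n)) (1::real)) \<longlonglongrightarrow> 0"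
          by (rule Lim_null_comparison[OF always_eventually[OF allI], rotated])
            (simp only: real_norm_def abs_of_pos[OF gauss_pos] le)
      qed
      ultimately have "(\<lambda>n. a n x) \<longlonglongrightarrow> 0"
        unfolding mult_zero_right ennreal_0 by (rule ennreal_tendsto_0_le)
      with True show ?thesis by simp
    qed simp
    have lim: "(\<lambda>n. \<integral>\<^sup>+ x. a n x * indicator U x \<partial>lebesgue) \<longlonglongrightarrow> (\<integral>\<^sup>+ x. 0 \<partial>(lebesgue :: 'a measure))"
    proof (rule nn_integral_dominated_convergence[where w = "indicator U"])
      show "(\<integral>\<^sup>+ x. indicator U x \<partial>lebesgue) < \<infinity>" using finU by simp
      show "AE x in lebesgue. a n x * indicator U x \<le> indicator U x" for n
        using a_le[of n] by (auto simp: indicator_def)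
    qed (use a_lim in auto)
    have "oscillation (s n) (indicator A :: 'a \<Rightarrow> real)
        \<le> ennreal (2 * e) + 2 * (\<integral>\<^sup>+ x. a n x * indicator U x \<partial>lebesgue)" for n
    proof -
      let ?h = "\<lambda>x y. ennreal (heat (s n) (x - y :: 'a))"
      let ?R = "U - A"
      have "oscillation (s n) (indicator A :: 'a \<Rightarrow> real)
        \<le> (\<integral>\<^sup>+ x. \<integral>\<^sup>+ y. ?h x y * indicator ?R x + ?h x y * indicator ?R y
            + ?h x y * (indicator U x * indicator (- U) y)
            + ?h x y * (indicator (- U) x * indicator U y) \<partial>lebesgue \<partial>lebesgue)"
        unfolding oscillation_def
      proof (intro nn_integral_mono)
        fix x y
        show "ennreal (heat (s n) (x - y) * (norm (indicator A x - indicator A y :: real))\<^sup>2)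
          \<le> ?h x y * indicator ?R x + ?h x y * indicator ?R y
            + ?h x y * (indicator U x * indicator (- U) y)
            + ?h x y * (indicator (- U) x * indicator U y)"
          using U(2) by (cases "x \<in> A"; cases "y \<in> A"; cases "x \<in> U"; cases "y \<in> U") auto
      qed
      also have "\<dots> = (\<integral>\<^sup>+ x. \<integral>\<^sup>+ y. ?h x y * indicator ?R x \<partial>lebesgue \<partial>lebesgue)
          + (\<integral>\<^sup>+ x. \<integral>\<^sup>+ y. ?h x y * indicator ?R y \<partial>lebesgue \<partial>lebesgue)
          + (\<integral>\<^sup>+ x. \<integral>\<^sup>+ y. ?h x y * (indicator U x * indicator (- U) y) \<partial>lebesgue \<partial>lebesgue)
          + (\<integral>\<^sup>+ x. \<integral>\<^sup>+ y. ?h x y * (indicator (- U) x * indicator U y) \<partial>lebesgue \<partial>lebesgue)"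
      proof -
        note [measurable] = ms[OF \<open>?R \<in> sets lebesgue\<close> \<open>?R \<in> sets lebesgue\<close>]
          ms(3)[OF \<open>U \<in> sets lebesgue\<close> \<open>- U \<in> sets lebesgue\<close>]
          ms(3)[OF \<open>- U \<in> sets lebesgue\<close> \<open>U \<in> sets lebesgue\<close>]
        show ?thesis by (simp add: nn_integral_add)
      qed
      also have "(\<integral>\<^sup>+ x. \<integral>\<^sup>+ y. ?h x y * (indicator (- U) x * indicator U y) \<partial>lebesgue \<partial>lebesgue)
          = (\<integral>\<^sup>+ y. \<integral>\<^sup>+ x. ?h x y * (indicator (- U) x * indicator U y) \<partial>lebesgue \<partial>lebesgue)"
        by (rule lebesgue_pair.Fubini'[symmetric]) (rule ms(3); measurable)
      also have "\<dots> = (\<integral>\<^sup>+ x. \<integral>\<^sup>+ y. ?h x y * (indicator U x * indicator (- U) y) \<partial>lebesgue \<partial>lebesgue)"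
        by (simp add: heat_minus mult.commute[of "indicator U _"])
      also have "(\<integral>\<^sup>+ x. \<integral>\<^sup>+ y. ?h x y * (indicator U x * indicator (- U) y) \<partial>lebesgue \<partial>lebesgue)
          = (\<integral>\<^sup>+ x. a n x * indicator U x \<partial>lebesgue)"
        by (intro nn_integral_cong) (auto simp: a_def indicator_def)
      also have "(\<integral>\<^sup>+ x. \<integral>\<^sup>+ y. ?h x y * indicator ?R x \<partial>lebesgue \<partial>lebesgue) = emeasure lebesgue ?R"
        by (simp add: nn_integral_heat_left[OF s])
      also have "(\<integral>\<^sup>+ x. \<integral>\<^sup>+ y. ?h x y * indicator ?R y \<partial>lebesgue \<partial>lebesgue) = emeasure lebesgue ?R"
        by (simp add: nn_integral_heat_right[OF s])
      also have "emeasure lebesgue ?R + emeasure lebesgue ?R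
          + (\<integral>\<^sup>+ x. a n x * indicator U x \<partial>lebesgue) + (\<integral>\<^sup>+ x. a n x * indicator U x \<partial>lebesgue)
          \<le> ennreal e + ennreal e
            + (\<integral>\<^sup>+ x. a n x * indicator U x \<partial>lebesgue) + (\<integral>\<^sup>+ x. a n x * indicator U x \<partial>lebesgue)"
        using U(4) by (intro add_mono) (auto simp: less_imp_le)
      also have "\<dots> = ennreal (2 * e) + 2 * (\<integral>\<^sup>+ x. a n x * indicator U x \<partial>lebesgue)"
      proof -
        have e: "ennreal (2 * e) = ennreal e + ennreal e"
          using ennreal_plus[of e e] that by simp
        show ?thesis unfolding e by (simp add: mult_2 add.assoc)
      qed
      finally show ?thesis .
    qed
    moreover have "(\<lambda>n. 2 * (\<integral>\<^sup>+ x. a n x * indicator U x \<partial>lebesgue)) \<longlonglongrightarrow> 2 * 0"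
      using lim by (intro ennreal_tendsto_cmult) auto
    ultimately show ?thesis by (intro exI conjI allI) auto
  qed
  have "limsup (\<lambda>n. oscillation (s n) (indicator A :: 'a \<Rightarrow> real)) \<le> 0"
  proof (rule ennreal_le_epsilon)
    fix e :: real assume "e > 0"
    then obtain b where b: "\<And>n. oscillation (s n) (indicator A :: 'a \<Rightarrow> real) \<le> ennreal (2 * (e/2)) + b n"
      "b \<longlonglongrightarrow> 0"
      using bound[of "e/2"] by auto
    have "limsup (\<lambda>n. oscillation (s n) (indicator A :: 'a \<Rightarrow> real)) \<le> limsup (\<lambda>n. ennreal (2 * (e/2)) + b n)"
      by (intro Limsup_mono always_eventually allI b)
    also have "\<dots> = ennreal (2 * (e/2)) + 0"
      using b(2) by (intro lim_imp_Limsup tendsto_intros) auto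
    finally show "limsup (\<lambda>n. oscillation (s n) (indicator A :: 'a \<Rightarrow> real)) \<le> 0 + ennreal e"
      by simp
  qed
  then show ?thesis
    unfolding s_def by (intro tendsto_0_if_Limsup_eq_0_ennreal) simp
qed

lemma oscillation_eps_tendsto_0_mono:
  fixes f :: "'a::euclidean_space \<Rightarrow> 'b::{real_normed_vector, second_countable_topology}"
    and g :: "'a \<Rightarrow> 'c::{real_normed_vector, second_countable_topology}"
    and h :: "'a \<Rightarrow> 'd::{real_normed_vector, second_countable_topology}"
  assumes "f \<in> borel_measurable lebesgue" "g \<in> borel_measurable lebesgue" "h \<in> borel_measurable lebesgue"
    and le: "\<And>x y. (norm (f x - f y))\<^sup>2 \<le> 2 * (norm (g x - g y))\<^sup>2 + 2 * (norm (h x - h y))\<^sup>2"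
    and "(\<lambda>n. oscillation (1 / real (Suc n)) g) \<longlonglongrightarrow> 0" "(\<lambda>n. oscillation (1 / real (Suc n)) h) \<longlonglongrightarrow> 0"
  shows "(\<lambda>n. oscillation (1 / real (Suc n)) f) \<longlonglongrightarrow> 0"
proof (rule tendsto_sandwich[OF _ _ tendsto_const])
  show "\<forall>\<^sub>F n in sequentially. oscillation (1 / real (Suc n)) f
      \<le> 2 * oscillation (1 / real (Suc n)) g + 2 * oscillation (1 / real (Suc n)) h"
    by (intro always_eventually allI oscillation_mono_sum assms) simp
  have "(\<lambda>n. 2 * oscillation (1 / real (Suc n)) g + 2 * oscillation (1 / real (Suc n)) h)
      \<longlonglongrightarrow> 2 * 0 + 2 * 0"
    using assms(5,6) by (intro tendsto_add ennreal_tendsto_cmult) auto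
  then show "(\<lambda>n. 2 * oscillation (1 / real (Suc n)) g + 2 * oscillation (1 / real (Suc n)) h)
      \<longlonglongrightarrow> 0"
    by simp
qed simp

text \<open>The oscillation is subadditive up to a factor two and bounded by four times the squared norm,
  so the class of functions whose oscillation vanishes in the limit is closed under sums and under
  limits in norm. Restricting to nonnegative functions ensures that both summands are
  square integrable when the sum is.\<close>

lemma oscillation_eps_tendsto_0_nonneg:
  fixes f :: "'a::euclidean_space \<Rightarrow> real"
  assumes "f \<in> borel_measurable lebesgue" "\<And>x. 0 \<le> f x"
    and "(\<integral>\<^sup>+ x. ennreal ((f x)\<^sup>2) \<partial>lebesgue) < \<infinity>"
  shows "(\<lambda>n. oscillation (1 / real (Suc n)) f) \<longlonglongrightarrow> 0"
  using assms
proof (induction f rule: borel_measurable_induct_real)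
  case (set A)
  have "(\<lambda>x. ennreal ((indicator A x)\<^sup>2)) = (indicator A :: 'a \<Rightarrow> ennreal)"
    by (auto simp: indicator_def)
  with set have "emeasure lebesgue A < \<infinity>" by simp
  with set show ?case by (intro oscillation_eps_tendsto_0_indicator)
next
  case (mult u c)
  show ?case
  proof (cases "c = 0")
    case True
    then show ?thesis by (simp add: oscillation_def)
  next
    case False
    have [measurable]: "u \<in> borel_measurable lebesgue" by fact
    have "(\<integral>\<^sup>+ x. ennreal ((c * u x)\<^sup>2) \<partial>lebesgue) = ennreal (c\<^sup>2) * (\<integral>\<^sup>+ x. ennreal ((u x)\<^sup>2) \<partial>lebesgue)"
      by (subst nn_integral_cmult[symmetric]) (auto simp: power_mult_distrib ennreal_mult)
    with mult.prems False have "(\<integral>\<^sup>+ x. ennreal ((u x)\<^sup>2) \<partial>lebesgue) < \<infinity>"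
      by (auto simp: less_top[symmetric] ennreal_mult_eq_top_iff)
    then have lim: "(\<lambda>n. oscillation (1 / real (Suc n)) u) \<longlonglongrightarrow> 0"
      by (rule mult.IH)
    have "oscillation r (\<lambda>x. c * u x) = ennreal (c\<^sup>2) * oscillation r u" if "0 < r" for r
    proof -
      have [measurable]: "(\<lambda>(x, y). ennreal (heat r (x - y) * (u x - u y)\<^sup>2))
        \<in> borel_measurable (lebesgue \<Otimes>\<^sub>M (lebesgue :: 'a measure))"
        unfolding split_beta by measurable
      have "ennreal (heat r (x - y) * (norm (c * u x - c * u y))\<^sup>2)
        = ennreal (c\<^sup>2) * ennreal (heat r (x - y) * (norm (u x - u y))\<^sup>2)" for x y
        using heat_nonneg[OF that, of "x - y"]
        by (simp add: ennreal_mult[symmetric] power_mult_distrib norm_mult mult.left_commute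
            flip: right_diff_distrib)
      then show ?thesis
        by (simp add: oscillation_def nn_integral_cmult)
    qed
    then have "(\<lambda>n. oscillation (1 / real (Suc n)) (\<lambda>x. c * u x))
        = (\<lambda>n. ennreal (c\<^sup>2) * oscillation (1 / real (Suc n)) u)"
      by simp
    moreover have "(\<lambda>n. ennreal (c\<^sup>2) * oscillation (1 / real (Suc n)) u) \<longlonglongrightarrow> ennreal (c\<^sup>2) * 0"
      using lim by (intro ennreal_tendsto_cmult) auto
    ultimately show ?thesis by simp
  qed
next
  case (add u v)
  have [measurable]: "u \<in> borel_measurable lebesgue" "v \<in> borel_measurable lebesgue" by fact+
  have "(\<integral>\<^sup>+ x. ennreal ((u x)\<^sup>2) \<partial>lebesgue) \<le> (\<integral>\<^sup>+ x. ennreal ((v x + u x)\<^sup>2) \<partial>lebesgue)"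
    "(\<integral>\<^sup>+ x. ennreal ((v x)\<^sup>2) \<partial>lebesgue) \<le> (\<integral>\<^sup>+ x. ennreal ((v x + u x)\<^sup>2) \<partial>lebesgue)"
    using add.hyps by (auto intro!: nn_integral_mono ennreal_leI power_mono)
  then have "(\<lambda>n. oscillation (1 / real (Suc n)) u) \<longlonglongrightarrow> 0" "(\<lambda>n. oscillation (1 / real (Suc n)) v) \<longlonglongrightarrow> 0"
    by (auto intro!: add.IH intro: le_less_trans[OF _ add.prems] simp del: of_nat_Suc)
  then show ?case
  proof (rule oscillation_eps_tendsto_0_mono[rotated -2])
    show "(norm (v x + u x - (v y + u y)))\<^sup>2 \<le> 2 * (norm (u x - u y))\<^sup>2 + 2 * (norm (v x - v y))\<^sup>2" for x y
      using norm_add_sq_le[of "u x - u y" "v x - v y"] by (simp add: algebra_simps)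
  qed auto
next
  case (seq U)
  have [measurable]: "U i \<in> borel_measurable lebesgue" for i by fact
  have [measurable]: "f \<in> borel_measurable lebesgue" by fact
  have Uf: "U i x \<le> f x" for i x
    using incseq_le[of "\<lambda>i. U i x" "f x" i] seq.hyps(3,4)
    by (auto simp: incseq_def le_fun_def)
  let ?N = "\<lambda>u. \<integral>\<^sup>+ x. ennreal ((u x :: real)\<^sup>2) \<partial>lebesgue"
  have "?N (U i) \<le> ?N f" for i
    using Uf seq.hyps(2) by (auto intro!: nn_integral_mono ennreal_leI power_mono)
  then have IH: "(\<lambda>n. oscillation (1 / real (Suc n)) (U i)) \<longlonglongrightarrow> 0" for i
    using seq.prems by (intro seq.IH) (auto intro: le_less_trans)
  have lim: "(\<lambda>i. ?N (\<lambda>x. f x - U i x)) \<longlonglongrightarrow> (\<integral>\<^sup>+ x. 0 \<partial>(lebesgue :: 'a measure))"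
  proof (rule nn_integral_dominated_convergence[where w = "\<lambda>x. ennreal ((f x)\<^sup>2)"])
    show "AE x in lebesgue. ennreal ((f x - U i x)\<^sup>2) \<le> ennreal ((f x)\<^sup>2)" for i
      using Uf seq.hyps(2) by (auto intro!: ennreal_leI power_mono)
    have "(\<lambda>i. ennreal ((f x - U i x)\<^sup>2)) \<longlonglongrightarrow> ennreal ((f x - f x)\<^sup>2)" for x
      by (intro tendsto_intros seq.hyps) simp
    then show "AE x in lebesgue. (\<lambda>i. ennreal ((f x - U i x)\<^sup>2)) \<longlonglongrightarrow> 0" by simp
  qed (use seq.prems in auto)
  have "limsup (\<lambda>n. oscillation (1 / real (Suc n)) f) \<le> 8 * ?N (\<lambda>x. f x - U i x)" for i
  proof -
    have "oscillation (1 / real (Suc n)) f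
        \<le> 8 * ?N (\<lambda>x. f x - U i x) + 2 * oscillation (1 / real (Suc n)) (U i)" for n
    proof -
      have "oscillation (1 / real (Suc n)) f
          \<le> 2 * oscillation (1 / real (Suc n)) (\<lambda>x. f x - U i x) + 2 * oscillation (1 / real (Suc n)) (U i)"
      proof (rule oscillation_mono_sum)
        show "(norm (f x - f y))\<^sup>2 \<le> 2 * (norm (f x - U i x - (f y - U i y)))\<^sup>2 + 2 * (norm (U i x - U i y))\<^sup>2"
          for x y
          using norm_add_sq_le[of "f x - U i x - (f y - U i y)" "U i x - U i y"] by (simp add: algebra_simps)
      qed auto
      also have "oscillation (1 / real (Suc n)) (\<lambda>x. f x - U i x) \<le> 4 * ?N (\<lambda>x. f x - U i x)"
        using oscillation_le[of "1 / real (Suc n)" "\<lambda>x. f x - U i x"] by simp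
      finally show ?thesis
        by (simp add: mult_left_mono mult.assoc[symmetric])
    qed
    then have "limsup (\<lambda>n. oscillation (1 / real (Suc n)) f)
        \<le> limsup (\<lambda>n. 8 * ?N (\<lambda>x. f x - U i x) + 2 * oscillation (1 / real (Suc n)) (U i))"
      by (intro Limsup_mono always_eventually allI)
    also have "\<dots> = 8 * ?N (\<lambda>x. f x - U i x) + 2 * 0"
      using IH[of i] by (intro lim_imp_Limsup tendsto_add tendsto_const ennreal_tendsto_cmult) auto
    finally show ?thesis by simp
  qed
  moreover have "(\<lambda>i. 8 * ?N (\<lambda>x. f x - U i x)) \<longlonglongrightarrow> 8 * 0"
    using lim by (intro ennreal_tendsto_cmult) auto
  ultimately have "limsup (\<lambda>n. oscillation (1 / real (Suc n)) f) \<le> 8 * 0"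
    by (intro LIMSEQ_le_const[of _ "8 * 0"]) auto
  then show ?case by (intro tendsto_0_if_Limsup_eq_0_ennreal) simp
qed

lemma oscillation_eps_tendsto_0:
  fixes f :: "'a::euclidean_space \<Rightarrow> complex"
  assumes "f \<in> L2 lebesgue"
  shows "(\<lambda>n. oscillation (1 / real (Suc n)) f) \<longlonglongrightarrow> 0"
proof -
  have [measurable]: "f \<in> borel_measurable lebesgue"
    using assms by (rule L2_measurable)
  have fin: "(\<integral>\<^sup>+ x. ennreal ((norm (f x))\<^sup>2) \<partial>lebesgue) < \<infinity>"
    using assms by (subst (asm) L2_iff_nn_integral) auto
  have real: "(\<lambda>n. oscillation (1 / real (Suc n)) u) \<longlonglongrightarrow> 0"
    if [measurable]: "u \<in> borel_measurable lebesgue" and le: "\<And>x. \<bar>u x\<bar> \<le> norm (f x)"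
    for u :: "'a \<Rightarrow> real"
  proof (rule oscillation_eps_tendsto_0_mono[where g = "\<lambda>x. max (u x) 0" and h = "\<lambda>x. max (- u x) 0"])
    have nn: "(\<integral>\<^sup>+ x. ennreal ((w x)\<^sup>2) \<partial>lebesgue) < \<infinity>"
      if "\<And>x. \<bar>w x\<bar> \<le> \<bar>u x\<bar>" for w :: "'a \<Rightarrow> real"
    proof (rule le_less_trans[OF nn_integral_mono fin])
      show "ennreal ((w x)\<^sup>2) \<le> ennreal ((norm (f x))\<^sup>2)" for x
        using order_trans[OF that le] by (intro ennreal_leI) (simp add: abs_le_square_iff[symmetric])
    qed
    show "(\<lambda>n. oscillation (1 / real (Suc n)) (\<lambda>x. max (u x) 0)) \<longlonglongrightarrow> 0"
      "(\<lambda>n. oscillation (1 / real (Suc n)) (\<lambda>x. max (- u x) 0)) \<longlonglongrightarrow> 0"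
      by (rule oscillation_eps_tendsto_0_nonneg; (rule nn)?; auto)+
    fix x y
    have "u x - u y = (max (u x) 0 - max (u y) 0) + - (max (- u x) 0 - max (- u y) 0)"
      by (auto simp: max_def)
    then show "(norm (u x - u y))\<^sup>2 \<le> 2 * (norm (max (u x) 0 - max (u y) 0))\<^sup>2
        + 2 * (norm (max (- u x) 0 - max (- u y) 0))\<^sup>2"
      by (metis norm_add_sq_le norm_minus_cancel)
  qed auto
  show ?thesis
  proof (rule oscillation_eps_tendsto_0_mono[where g = "\<lambda>x. Re (f x)" and h = "\<lambda>x. Im (f x)"])
    show "(\<lambda>n. oscillation (1 / real (Suc n)) (\<lambda>x. Re (f x))) \<longlonglongrightarrow> 0"
      "(\<lambda>n. oscillation (1 / real (Suc n)) (\<lambda>x. Im (f x))) \<longlonglongrightarrow> 0"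
      by (rule real; simp add: abs_Re_le_cmod abs_Im_le_cmod)+
    show "(norm (f x - f y))\<^sup>2 \<le> 2 * (norm (Re (f x) - Re (f y)))\<^sup>2 + 2 * (norm (Im (f x) - Im (f y)))\<^sup>2"
      for x y by (simp add: cmod_power2)
  qed auto
qed

section \<open>The Plancherel identity for integrable functions\<close>

lemma measurable_character_pair [measurable]:
  "(\<lambda>p. character (fst p) (snd p)) \<in> borel_measurable (lebesgue \<Otimes>\<^sub>M lebesgue)"
  unfolding character_def by measurable

lemma measurable_character [measurable]: "character w \<in> borel_measurable lebesgue"
  unfolding character_def by (rule borel_measurable_lebesgueI) measurable

lemma character_commute: "character w x = character x w"
  by (simp add: character_def inner_commute)

lemma character_mult_cnj: "character w x * cnj (character w y) = character w (x - y)"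
  by (simp add: character_def exp_cnj inner_diff_right algebra_simps flip: exp_add)

lemma fourier_integral_character:
  "fourier_integral f w = (LINT x|lebesgue. f x * character w x)"
  by (simp add: fourier_integral_def character_def)

lemma integrable_mult_character:
  assumes "integrable lebesgue f"
  shows "integrable lebesgue (\<lambda>x. f x * character w x)"
proof -
  have [measurable]: "f \<in> borel_measurable lebesgue"
    using assms by (rule borel_measurable_integrable)
  show ?thesis
    by (rule Bochner_Integration.integrable_bound[OF assms]) (auto simp: norm_mult)
qed

lemma fourier_integral_measurable [measurable]:
  assumes [measurable]: "f \<in> borel_measurable lebesgue"
  shows "fourier_integral f \<in> borel_measurable lebesgue"
proof -
  have "(\<lambda>w. LINT x|lebesgue. f x * character w x) \<in> borel_measurable lebesgue"
    by (rule lebesgue.borel_measurable_lebesgue_integral) (unfold split_beta, measurable)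
  then show ?thesis
    by (simp add: fourier_integral_character[abs_def])
qed

lemma norm_fourier_integral_le: "norm (fourier_integral f w) \<le> (LINT x|lebesgue. norm (f x))"
proof -
  have "norm (fourier_integral f w) \<le> (LINT x|lebesgue. norm (f x * character w x))"
    unfolding fourier_integral_character by (rule integral_norm_bound)
  then show ?thesis by (simp add: norm_mult)
qed

lemma fourier_integral_diff:
  assumes "integrable lebesgue f" "integrable lebesgue g"
  shows "fourier_integral (f - g) = fourier_integral f - fourier_integral g"
  using assms by (auto simp: fourier_integral_character fun_eq_iff left_diff_distrib integrable_mult_character)

text \<open>The kernel \<open>character w x\<close> is symmetric, so both sides are the same double integral.\<close>

lemma fourier_integral_duality:
  fixes f g :: "real ^ 'd::finite \<Rightarrow> complex"
  assumes f: "integrable lebesgue f" and g: "integrable lebesgue g"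
  shows "(LINT w|lebesgue. fourier_integral f w * g w) = (LINT x|lebesgue. f x * fourier_integral g x)"
proof -
  have [measurable]: "f \<in> borel_measurable lebesgue" "g \<in> borel_measurable lebesgue"
    using f g by auto
  let ?k = "\<lambda>(w, x). f x * character w x * g w"
  have [measurable]: "?k \<in> borel_measurable (lebesgue \<Otimes>\<^sub>M lebesgue)"
    unfolding split_beta by measurable
  have "integrable (lebesgue \<Otimes>\<^sub>M lebesgue) ?k"
  proof (rule lebesgue_pair.Fubini_integrable)
    show "integrable lebesgue (\<lambda>w. LINT x|lebesgue. norm (?k (w, x)))"
      using g by (simp add: norm_mult)
    show "AE w in lebesgue. integrable lebesgue (\<lambda>x. ?k (w, x))"
      by (auto intro!: AE_I2 integrable_mult_character f)
  qed simp
  then have "(LINT x|lebesgue. LINT w|lebesgue. f x * character w x * g w)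
      = (LINT w|lebesgue. LINT x|lebesgue. f x * character w x * g w)"
    by (rule lebesgue_pair.Fubini_integral)
  moreover have "(LINT w|lebesgue. f x * character w x * g w) = f x * fourier_integral g x" for x
    by (simp add: fourier_integral_character mult.assoc mult.commute[of "character _ _"]
        character_commute[of _ x])
  ultimately show ?thesis
    by (simp add: fourier_integral_character)
qed

lemma gauss_fourier_lebesgue:
  fixes z :: "'a::euclidean_space"
  assumes "0 < s"
  shows "integrable lebesgue (gauss s :: 'a \<Rightarrow> real)"
    and "(LINT y|lebesgue. of_real (gauss s y) * character y z) = of_real (heat s z)"
proof -
  show "integrable lebesgue (gauss s :: 'a \<Rightarrow> real)"
    using gauss_integral(1)[OF assms] by (simp add: integrable_completion)
  have "(\<lambda>y. of_real (gauss s y) * character y z) \<in> borel_measurable borel"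
    unfolding character_def by measurable
  then show "(LINT y|lebesgue. of_real (gauss s y) * character y z) = of_real (heat s z)"
    using gauss_fourier(2)[OF assms, of z] by (simp add: integral_completion)
qed

text \<open>The Gaussian weight makes all integrals absolutely convergent. Two applications of
  duality move the two Fourier transforms of \<open>f\<close> onto the Gaussian.\<close>

lemma plancherel_gauss:
  fixes f :: "real ^ 'd::finite \<Rightarrow> complex"
  assumes f: "integrable lebesgue f" and s: "0 < s"
  shows "integrable lebesgue (\<lambda>w. (norm (fourier_integral f w))\<^sup>2 * gauss s w)"
    and "complex_of_real (LINT w|lebesgue. (norm (fourier_integral f w))\<^sup>2 * gauss s w)
      = (LINT x|lebesgue. LINT y|lebesgue. f x * cnj (f y) * of_real (heat s (x - y)))"
proof -
  have [measurable]: "f \<in> borel_measurable lebesgue" using f by auto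
  have gi: "integrable lebesgue (gauss s :: real ^ 'd \<Rightarrow> real)" by (rule gauss_fourier_lebesgue(1)[OF s])
  have [measurable]: "gauss s \<in> borel_measurable (lebesgue :: (real ^ 'd) measure)" using gi by auto
  define C where "C = (LINT x|lebesgue. norm (f x))"
  have C: "norm (fourier_integral f w) \<le> C" for w
    unfolding C_def by (rule norm_fourier_integral_le)
  have "0 \<le> C" by (simp add: C_def)
  show "integrable lebesgue (\<lambda>w. (norm (fourier_integral f w))\<^sup>2 * gauss s w)"
  proof (rule Bochner_Integration.integrable_bound)
    show "integrable lebesgue (\<lambda>w :: real ^ 'd. C\<^sup>2 * gauss s w)" using gi by simp
    show "AE w in lebesgue. norm ((norm (fourier_integral f w))\<^sup>2 * gauss s w) \<le> norm (C\<^sup>2 * gauss s w)"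
      using C \<open>0 \<le> C\<close>
      by (auto simp: abs_mult less_imp_le[OF gauss_pos] intro!: mult_right_mono power_mono)
  qed measurable
  define H where "H w = cnj (fourier_integral f w) * of_real (gauss s w)" for w
  have [measurable]: "H \<in> borel_measurable lebesgue" unfolding H_def by measurable
  have H: "integrable lebesgue H"
  proof (rule Bochner_Integration.integrable_bound)
    show "integrable lebesgue (\<lambda>w :: real ^ 'd. C * gauss s w)" using gi by simp
    show "AE w in lebesgue. norm (H w) \<le> norm (C * gauss s w)"
      using C \<open>0 \<le> C\<close>
      by (auto simp: H_def norm_mult abs_mult less_imp_le[OF gauss_pos] intro!: mult_right_mono)
  qed measurable
  have FH: "fourier_integral H x = (LINT y|lebesgue. cnj (f y) * of_real (heat s (x - y)))" for x
  proof -
    \<comment> \<open>\<open>fourier_integral H x\<close> is the conjugate of an integral of \<open>fourier_integral f\<close> against \<open>K\<close>,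
      and the transform of \<open>K\<close> is a translated heat kernel.\<close>
    define K where "K w = of_real (gauss s w) * cnj (character w x)" for w
    have [measurable]: "K \<in> borel_measurable lebesgue"
      unfolding K_def character_commute[of _ x] by measurable
    have K: "integrable lebesgue K"
      by (rule Bochner_Integration.integrable_bound[OF gi]) (auto simp: K_def norm_mult)
    have FK: "fourier_integral K y = of_real (heat s (x - y))" for y
    proof -
      have "fourier_integral K y = (LINT w|lebesgue. of_real (gauss s w) * character w (y - x))"
        unfolding fourier_integral_character K_def
        by (simp only: character_commute[of y] mult.assoc mult.commute[of "cnj _"] character_mult_cnj)
      then show ?thesis by (simp only: gauss_fourier_lebesgue(2)[OF s] heat_minus)
    qed
    have "cnj (fourier_integral H x) = (LINT w|lebesgue. fourier_integral f w * K w)"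
      unfolding fourier_integral_character[of H]
      by (subst Bochner_Integration.integral_cnj[symmetric])
        (simp add: H_def K_def mult.assoc character_commute[of x])
    also have "\<dots> = (LINT y|lebesgue. f y * fourier_integral K y)"
      by (rule fourier_integral_duality[OF f K])
    finally have "cnj (fourier_integral H x) = (LINT y|lebesgue. f y * of_real (heat s (x - y)))"
      by (simp only: FK)
    then have "cnj (cnj (fourier_integral H x)) = cnj (LINT y|lebesgue. f y * of_real (heat s (x - y)))"
      by simp
    then show ?thesis
      by (subst (asm) Bochner_Integration.integral_cnj[symmetric]) simp
  qed
  have "complex_of_real (LINT w|lebesgue. (norm (fourier_integral f w))\<^sup>2 * gauss s w)
      = (LINT w|lebesgue. fourier_integral f w * H w)"
    unfolding integral_complex_of_real[symmetric]
    by (intro Bochner_Integration.integral_cong refl)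
      (simp add: H_def complex_norm_square mult.assoc[symmetric] del: of_real_power)
  also have "\<dots> = (LINT x|lebesgue. f x * fourier_integral H x)"
    by (rule fourier_integral_duality[OF f H])
  also have "\<dots> = (LINT x|lebesgue. LINT y|lebesgue. f x * cnj (f y) * of_real (heat s (x - y)))"
    by (simp add: FH mult.assoc)
  finally show "complex_of_real (LINT w|lebesgue. (norm (fourier_integral f w))\<^sup>2 * gauss s w)
      = (LINT x|lebesgue. LINT y|lebesgue. f x * cnj (f y) * of_real (heat s (x - y)))" .
qed

text \<open>Expand the square in the oscillation: the two square terms integrate to \<open>\<parallel>f\<parallel>\<^sup>2\<close> each because the
  heat kernel has mass one, and the cross term is the Gaussian-weighted integral of
  \<open>|fourier_integral f|\<^sup>2\<close>.\<close>

lemma oscillation_eq: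
  fixes f :: "real ^ 'd::finite \<Rightarrow> complex"
  assumes f: "integrable lebesgue f" "f \<in> L2 lebesgue" and s: "0 < s"
  defines "D \<equiv> 2 * (L2_norm lebesgue f)\<^sup>2
      - 2 * (LINT w|lebesgue. (norm (fourier_integral f w))\<^sup>2 * gauss s w)"
  shows "0 \<le> D" and "oscillation s f = ennreal D"
proof -
  let ?P = "lebesgue \<Otimes>\<^sub>M (lebesgue :: (real ^ 'd) measure)"
  define N where "N = (L2_norm lebesgue f)\<^sup>2"
  have [measurable]: "f \<in> borel_measurable lebesgue" using f by auto
  define h where "h p = heat s (fst p - snd p)" for p :: "(real ^ 'd) \<times> (real ^ 'd)"
  have [measurable]: "h \<in> borel_measurable ?P" unfolding h_def[abs_def] by measurable
  have h: "0 \<le> h p" for p by (simp add: h_def heat_nonneg[OF s])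
  have N: "(\<integral>\<^sup>+ x. ennreal ((norm (f x))\<^sup>2) \<partial>lebesgue) = ennreal N"
    unfolding N_def by (rule nn_integral_L2_norm_sq[OF f(2)])
  have "0 \<le> N" by (simp add: N_def)
  have nn1: "(\<integral>\<^sup>+ p. ennreal (h p * (norm (f (fst p)))\<^sup>2) \<partial>?P) = ennreal N"
  proof -
    have "(\<integral>\<^sup>+ p. ennreal (h p * (norm (f (fst p)))\<^sup>2) \<partial>?P)
        = (\<integral>\<^sup>+ x. \<integral>\<^sup>+ y. ennreal (h (x, y) * (norm (f (fst (x, y))))\<^sup>2) \<partial>lebesgue \<partial>lebesgue)"
      by (rule lebesgue.nn_integral_fst[symmetric]) measurable
    also have "\<dots> = (\<integral>\<^sup>+ x. \<integral>\<^sup>+ y. ennreal (heat s (x - y)) * ennreal ((norm (f x))\<^sup>2) \<partial>lebesgue \<partial>lebesgue)"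
      by (simp add: h_def ennreal_mult heat_nonneg[OF s])
    finally show ?thesis by (simp add: nn_integral_heat_left[OF s] N)
  qed
  have nn2: "(\<integral>\<^sup>+ p. ennreal (h p * (norm (f (snd p)))\<^sup>2) \<partial>?P) = ennreal N"
  proof -
    have "(\<integral>\<^sup>+ p. ennreal (h p * (norm (f (snd p)))\<^sup>2) \<partial>?P)
        = (\<integral>\<^sup>+ x. \<integral>\<^sup>+ y. ennreal (h (x, y) * (norm (f (snd (x, y))))\<^sup>2) \<partial>lebesgue \<partial>lebesgue)"
      by (rule lebesgue.nn_integral_fst[symmetric]) measurable
    also have "\<dots> = (\<integral>\<^sup>+ x. \<integral>\<^sup>+ y. ennreal (heat s (x - y)) * ennreal ((norm (f y))\<^sup>2) \<partial>lebesgue \<partial>lebesgue)"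
      by (simp add: h_def ennreal_mult heat_nonneg[OF s])
    finally show ?thesis by (simp add: nn_integral_heat_right[OF s] N)
  qed
  have i1: "integrable ?P (\<lambda>p. h p * (norm (f (fst p)))\<^sup>2)"
    and v1: "(LINT p|?P. h p * (norm (f (fst p)))\<^sup>2) = N"
    using nn1 h \<open>0 \<le> N\<close> by (auto intro!: integrableI_nonneg integral_eq_nn_integral[THEN trans])
  have i2: "integrable ?P (\<lambda>p. h p * (norm (f (snd p)))\<^sup>2)"
    and v2: "(LINT p|?P. h p * (norm (f (snd p)))\<^sup>2) = N"
    using nn2 h \<open>0 \<le> N\<close> by (auto intro!: integrableI_nonneg integral_eq_nn_integral[THEN trans])
  define C where "C = (\<lambda>(x, y). f x * cnj (f y) * of_real (heat s (x - y)))"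
  have C: "C p = f (fst p) * cnj (f (snd p)) * of_real (h p)" for p
    by (simp add: C_def h_def split_beta)
  have [measurable]: "C \<in> borel_measurable ?P" unfolding C[abs_def] by measurable
  have pt: "h p * (norm (f (fst p) - f (snd p)))\<^sup>2
      = h p * (norm (f (fst p)))\<^sup>2 + h p * (norm (f (snd p)))\<^sup>2 - 2 * Re (C p)" for p
    unfolding C cmod_power2 by (simp add: power2_eq_square algebra_simps)
  have iC: "integrable ?P C"
  proof (rule Bochner_Integration.integrable_bound[OF Bochner_Integration.integrable_add[OF i1 i2]])
    have *: "a * b \<le> a\<^sup>2 + b\<^sup>2" if "0 \<le> a" "0 \<le> b" for a b :: real
      using sum_squares_bound[of a b] mult_nonneg_nonneg[OF that] by linarith
    have "norm (f (fst p)) * norm (f (snd p)) * h p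
        \<le> ((norm (f (fst p)))\<^sup>2 + (norm (f (snd p)))\<^sup>2) * h p" for p
      by (intro mult_right_mono * h) auto
    then show "AE p in ?P. norm (C p) \<le> norm (h p * (norm (f (fst p)))\<^sup>2 + h p * (norm (f (snd p)))\<^sup>2)"
      using h by (auto simp: C norm_mult algebra_simps)
  qed measurable
  have "(LINT p|?P. C p) = (LINT x|lebesgue. LINT y|lebesgue. C (x, y))"
    using lebesgue_pair.integral_fst'[OF iC] by simp
  also have "\<dots> = complex_of_real (LINT w|lebesgue. (norm (fourier_integral f w))\<^sup>2 * gauss s w)"
    by (simp add: C_def plancherel_gauss(2)[OF f(1) s])
  finally have vC: "(LINT p|?P. C p) = complex_of_real (LINT w|lebesgue. (norm (fourier_integral f w))\<^sup>2 * gauss s w)" .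
  have iD: "integrable ?P (\<lambda>p. h p * (norm (f (fst p) - f (snd p)))\<^sup>2)"
    unfolding pt by (intro Bochner_Integration.integrable_diff Bochner_Integration.integrable_add i1 i2
        integrable_mult_right integrable_Re iC)
  have vD: "(LINT p|?P. h p * (norm (f (fst p) - f (snd p)))\<^sup>2) = D"
    unfolding pt D_def N_def[symmetric]
    using i1 i2 iC by (simp add: v1 v2 vC integral_Re)
  show "0 \<le> D" unfolding vD[symmetric] using h by simp
  have "oscillation s f = (\<integral>\<^sup>+ p. ennreal (h p * (norm (f (fst p) - f (snd p)))\<^sup>2) \<partial>?P)"
    unfolding oscillation_def
    by (subst lebesgue.nn_integral_fst[symmetric]) (simp_all add: h_def)
  also have "\<dots> = ennreal D"
    unfolding vD[symmetric] by (rule nn_integral_eq_integral[OF iD]) (simp add: h)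
  finally show "oscillation s f = ennreal D" .
qed

text \<open>As \<open>s\<close> tends to zero the oscillation vanishes and \<open>gauss s\<close> increases to one, so monotone
  convergence gives the Plancherel identity.\<close>

lemma plancherel_L1_L2:
  fixes f :: "real ^ 'd::finite \<Rightarrow> complex"
  assumes f: "integrable lebesgue f" "f \<in> L2 lebesgue"
  shows "fourier_integral f \<in> L2 lebesgue"
    and "L2_norm lebesgue (fourier_integral f) = L2_norm lebesgue f"
proof -
  have [measurable]: "f \<in> borel_measurable lebesgue" using f by auto
  have [measurable]: "gauss r \<in> borel_measurable (lebesgue :: (real ^ 'd) measure)" for r
    by (rule borel_measurable_lebesgueI) measurable
  define s where "s n = 1 / real (Suc n)" for n
  have s: "0 < s n" for n by (simp add: s_def)
  define N where "N = (L2_norm lebesgue f)\<^sup>2"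
  define I where "I n = (LINT w|lebesgue. (norm (fourier_integral f w))\<^sup>2 * gauss (s n) w)" for n
  have "(\<lambda>n. ennreal (2 * N - 2 * I n)) \<longlonglongrightarrow> ennreal 0"
    using oscillation_eps_tendsto_0[OF f(2)] oscillation_eq(2)[OF f s]
    by (simp add: s_def N_def I_def)
  then have "(\<lambda>n. 2 * N - 2 * I n) \<longlonglongrightarrow> 0"
    using oscillation_eq(1)[OF f s] by (subst (asm) tendsto_ennreal_iff) (auto simp: N_def I_def)
  then have "(\<lambda>n. N - (1/2) * (2 * N - 2 * I n)) \<longlonglongrightarrow> N - (1/2) * 0"
    by (intro tendsto_intros)
  then have "I \<longlonglongrightarrow> N" by (simp add: algebra_simps)
  then have lim: "(\<lambda>n. ennreal (I n)) \<longlonglongrightarrow> ennreal N" by (rule tendsto_ennrealI)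
  have I: "(\<integral>\<^sup>+ w. ennreal ((norm (fourier_integral f w))\<^sup>2 * gauss (s n) w) \<partial>lebesgue) = ennreal (I n)" for n
    unfolding I_def
    by (rule nn_integral_eq_integral) (use plancherel_gauss(1)[OF f(1) s] gauss_pos in \<open>auto intro!: AE_I2 mult_nonneg_nonneg less_imp_le[OF gauss_pos]\<close>)
  have "(\<lambda>n. \<integral>\<^sup>+ w. ennreal ((norm (fourier_integral f w))\<^sup>2 * gauss (s n) w) \<partial>lebesgue)
      \<longlonglongrightarrow> (\<integral>\<^sup>+ w. ennreal ((norm (fourier_integral f w))\<^sup>2) \<partial>lebesgue)"
  proof (rule nn_integral_LIMSEQ)
    show "incseq (\<lambda>n w. ennreal ((norm (fourier_integral f w))\<^sup>2 * gauss (s n) w))"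
    proof (intro incseq_SucI le_funI ennreal_leI mult_left_mono)
      fix n and w :: "real ^ 'd"
      have "s (Suc n) * norm w \<le> s n * norm w"
        by (intro mult_right_mono) (auto simp: s_def frac_le)
      then have "(s (Suc n) * norm w)\<^sup>2 \<le> (s n * norm w)\<^sup>2"
        using s[of "Suc n"] by (intro power_mono) auto
      then show "gauss (s n) w \<le> gauss (s (Suc n)) w"
        by (simp add: gauss_def)
    qed simp
    fix w :: "real ^ 'd"
    have "s \<longlonglongrightarrow> 0"
      using LIMSEQ_inverse_real_of_nat by (simp add: s_def[abs_def] inverse_eq_divide)
    then have "(\<lambda>n. gauss (s n) w) \<longlonglongrightarrow> exp (- pi * (0 * norm w)\<^sup>2)"
      unfolding gauss_def by (intro tendsto_intros)
    then have "(\<lambda>n. (norm (fourier_integral f w))\<^sup>2 * gauss (s n) w) \<longlonglongrightarrow> (norm (fourier_integral f w))\<^sup>2 * 1"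
      by (intro tendsto_mult_left) simp
    then show "(\<lambda>n. ennreal ((norm (fourier_integral f w))\<^sup>2 * gauss (s n) w))
        \<longlonglongrightarrow> ennreal ((norm (fourier_integral f w))\<^sup>2)"
      by (intro tendsto_ennrealI) simp
  qed measurable
  then have nn: "(\<integral>\<^sup>+ w. ennreal ((norm (fourier_integral f w))\<^sup>2) \<partial>lebesgue) = ennreal N"
    using lim unfolding I by (rule LIMSEQ_unique)
  then show L2: "fourier_integral f \<in> L2 lebesgue"
    by (subst L2_iff_nn_integral) auto
  have "(L2_norm lebesgue (fourier_integral f))\<^sup>2 = N"
    using nn nn_integral_L2_norm_sq[OF L2] by (simp add: N_def)
  then show "L2_norm lebesgue (fourier_integral f) = L2_norm lebesgue f"
    by (simp add: N_def L2_norm_nonneg)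
qed

section \<open>The Fourier transform on square-integrable functions\<close>

abbreviation cutoff :: "nat \<Rightarrow> (real ^ 'd::finite \<Rightarrow> complex) \<Rightarrow> real ^ 'd \<Rightarrow> complex"
  where "cutoff n f \<equiv> (\<lambda>x. indicator (cball 0 (real n)) x * f x)"

lemma measurable_cutoff [measurable]:
  assumes [measurable]: "f \<in> borel_measurable lebesgue"
  shows "cutoff n f \<in> borel_measurable lebesgue"
proof -
  have [measurable]: "indicator (cball 0 (real n)) \<in> borel_measurable (lebesgue :: (real ^ 'a) measure)"
    by (rule borel_measurable_indicator) (rule fmeasurableD[OF lmeasurable_cball])
  show ?thesis by measurable
qed

lemma cutoff_L2:
  assumes "f \<in> L2 lebesgue"
  shows "cutoff n f \<in> L2 lebesgue"
proof -
  have [measurable]: "f \<in> borel_measurable lebesgue"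
    using assms by (rule L2_measurable)
  have "integrable lebesgue (\<lambda>x. (norm (cutoff n f x))\<^sup>2)"
  proof (rule Bochner_Integration.integrable_bound[OF L2_integrable[OF assms]])
    show "AE x in lebesgue. norm ((norm (cutoff n f x))\<^sup>2) \<le> norm ((norm (f x))\<^sup>2)"
      by (auto simp: indicator_def)
  qed measurable
  then show ?thesis using measurable_cutoff[of f n] by (simp add: L2_def)
qed

lemma cutoff_integrable:
  assumes "f \<in> L2 lebesgue"
  shows "integrable lebesgue (cutoff n f)"
proof -
  have [measurable]: "f \<in> borel_measurable lebesgue"
    using assms by (rule L2_measurable)
  show ?thesis
  proof (rule Bochner_Integration.integrable_bound)
    have "integrable lebesgue (indicator (cball 0 (real n)) :: real ^ 'a \<Rightarrow> real)"
      using lmeasurable_cball[of "0 :: real ^ 'a" "real n"] by (simp add: fmeasurable_def less_top)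
    then show "integrable lebesgue (\<lambda>x. indicator (cball 0 (real n)) x + (norm (f x))\<^sup>2)"
      using L2_integrable[OF assms] by (rule Bochner_Integration.integrable_add)
    have "norm (f x) \<le> 1 + (norm (f x))\<^sup>2" for x
      using sum_squares_bound[of "norm (f x)" 1] norm_ge_zero[of "f x"]
      by (simp del: norm_ge_zero)
    then show "AE x in lebesgue. norm (cutoff n f x) \<le> norm (indicator (cball 0 (real n)) x + (norm (f x))\<^sup>2)"
      by (auto simp: indicator_def norm_mult)
  qed (rule measurable_cutoff, measurable)
qed

lemma cutoff_tendsto:
  assumes "f \<in> L2 lebesgue"
  shows "(\<lambda>n. L2_norm lebesgue (cutoff n f - f)) \<longlonglongrightarrow> 0"
proof -
  have [measurable]: "f \<in> borel_measurable lebesgue"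
    using assms by (rule L2_measurable)
  have "(\<lambda>n. LINT x|lebesgue. (norm (cutoff n f x - f x))\<^sup>2) \<longlonglongrightarrow> (LINT x|(lebesgue :: (real ^ 'a) measure). 0)"
  proof (rule integral_dominated_convergence[where w = "\<lambda>x. (norm (f x))\<^sup>2"])
    show "AE x in lebesgue. (\<lambda>n. (norm (cutoff n f x - f x))\<^sup>2) \<longlonglongrightarrow> 0"
    proof (rule AE_I2)
      fix x :: "real ^ 'a"
      obtain N where "norm x \<le> real N" using real_arch_simple by blast
      then have "\<forall>\<^sub>F n in sequentially. (norm (cutoff n f x - f x))\<^sup>2 = 0"
        by (intro eventually_sequentiallyI[of N]) auto
      then show "(\<lambda>n. (norm (cutoff n f x - f x))\<^sup>2) \<longlonglongrightarrow> 0"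
        by (rule tendsto_eventually)
    qed
    show "AE x in lebesgue. norm ((norm (cutoff n f x - f x))\<^sup>2) \<le> (norm (f x))\<^sup>2" for n
      by (auto simp: indicator_def)
  qed (use L2_integrable[OF assms] in measurable)
  then have "(\<lambda>n. sqrt (LINT x|lebesgue. (norm (cutoff n f x - f x))\<^sup>2)) \<longlonglongrightarrow> sqrt 0"
    by (intro tendsto_real_sqrt) simp
  then show ?thesis
    by (simp add: L2_norm_def)
qed

text \<open>The transforms of the cutoffs form a Cauchy sequence because the cutoffs do and the transform is
  isometric on them; completeness yields the limit that the definition of \<open>fourier\<close> selects.\<close>

lemma fourier_L2_and_limit:
  assumes f: "f \<in> L2 lebesgue"
  shows "fourier f \<in> L2 lebesgue \<and>
    (\<lambda>n. L2_norm lebesgue (fourier_integral (cutoff n f) - fourier f)) \<longlonglongrightarrow> 0"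
proof -
  let ?F = "\<lambda>n. fourier_integral (cutoff n f)"
  have "\<exists>g. g \<in> L2 lebesgue \<and> (\<lambda>n. L2_norm lebesgue (?F n - g)) \<longlonglongrightarrow> 0"
  proof (rule L2_complete[of ?F lebesgue])
    show "?F n \<in> L2 lebesgue" for n
      by (intro plancherel_L1_L2 cutoff_L2 cutoff_integrable f)
    fix e :: real assume "e > 0"
    then obtain N where N: "\<And>n. n \<ge> N \<Longrightarrow> L2_norm lebesgue (cutoff n f - f) < e / 2"
      using LIMSEQ_D[OF cutoff_tendsto[OF f], of "e / 2"] by (auto simp: L2_norm_nonneg)
    have "L2_norm lebesgue (?F m - ?F n) < e" if "m \<ge> N" "n \<ge> N" for m n
    proof -
      have "L2_norm lebesgue (?F m - ?F n) = L2_norm lebesgue (fourier_integral (cutoff m f - cutoff n f))"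
        by (simp only: fourier_integral_diff[OF cutoff_integrable[OF f] cutoff_integrable[OF f]])
      also have "\<dots> = L2_norm lebesgue (cutoff m f - cutoff n f)"
        using Bochner_Integration.integrable_diff[OF cutoff_integrable[OF f] cutoff_integrable[OF f]]
        by (intro plancherel_L1_L2 L2_diff cutoff_L2 f) (simp add: fun_diff_def)
      also have "cutoff m f - cutoff n f = (cutoff m f - f) + (f - cutoff n f)"
        by simp
      also have "L2_norm lebesgue \<dots> \<le> L2_norm lebesgue (cutoff m f - f) + L2_norm lebesgue (f - cutoff n f)"
        by (intro L2_norm_triangle L2_diff cutoff_L2 f)
      also have "\<dots> < e / 2 + e / 2"
        using N that by (intro add_strict_mono) (auto simp: L2_norm_minus_commute[of _ f])
      finally show ?thesis by (simp only: field_sum_of_halves)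
    qed
    then show "\<exists>N. \<forall>m\<ge>N. \<forall>n\<ge>N. L2_norm lebesgue (?F m - ?F n) < e" by blast
  qed blast
  then show ?thesis
    unfolding fourier_def by (rule someI_ex)
qed

lemma fourier_L2: "f \<in> L2 lebesgue \<Longrightarrow> fourier f \<in> L2 lebesgue"
  and fourier_tendsto: "f \<in> L2 lebesgue \<Longrightarrow>
    (\<lambda>n. L2_norm lebesgue (fourier_integral (cutoff n f) - fourier f)) \<longlonglongrightarrow> 0"
  using fourier_L2_and_limit by blast+

theorem L2_norm_fourier:
  assumes f: "f \<in> L2 lebesgue"
  shows "L2_norm lebesgue (fourier f) = L2_norm lebesgue f"
proof (rule LIMSEQ_unique)
  show "(\<lambda>n. L2_norm lebesgue (fourier_integral (cutoff n f))) \<longlonglongrightarrow> L2_norm lebesgue (fourier f)"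
    by (intro L2_norm_tendsto plancherel_L1_L2 cutoff_L2 cutoff_integrable fourier_L2 fourier_tendsto f)
  have "L2_norm lebesgue (fourier_integral (cutoff n f)) = L2_norm lebesgue (cutoff n f)" for n
    by (intro plancherel_L1_L2 cutoff_L2 cutoff_integrable f)
  then show "(\<lambda>n. L2_norm lebesgue (fourier_integral (cutoff n f))) \<longlonglongrightarrow> L2_norm lebesgue f"
    by (simp only:) (intro L2_norm_tendsto cutoff_L2 cutoff_tendsto f)
qed

text \<open>The inverse transform of \<open>G\<close> is \<open>f = cnj \<circ> fourier (cnj \<circ> G)\<close>, the adjoint applied to \<open>G\<close>. An
  isometry \<open>F\<close> whose adjoint is isometric as well is unitary:
  \<open>\<langle>F f, G\<rangle> = \<langle>f, f\<rangle> = \<parallel>G\<parallel>\<^sup>2\<close> and \<open>\<parallel>F f\<parallel> = \<parallel>G\<parallel>\<close> force \<open>\<parallel>F f - G\<parallel> = 0\<close>. The adjoint relation follows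
  from duality for cutoffs and passage to the limit.\<close>

theorem fourier_surjective:
  assumes G: "G \<in> L2 lebesgue"
  obtains f where "f \<in> L2 lebesgue" "AE w in lebesgue. fourier f w = G w"
proof -
  have cG: "cnj \<circ> G \<in> L2 lebesgue" using G by (rule L2_cnj)
  define f where "f = cnj \<circ> fourier (cnj \<circ> G)"
  have f: "f \<in> L2 lebesgue" unfolding f_def by (intro L2_cnj fourier_L2 cG)
  have norm_cnj: "L2_norm lebesgue (cnj \<circ> g) = L2_norm lebesgue g" for g :: "real ^ 'a \<Rightarrow> complex"
    by (simp add: L2_norm_def)
  have norm_f: "L2_norm lebesgue f = L2_norm lebesgue G"
    by (simp only: f_def norm_cnj L2_norm_fourier[OF cG])
  let ?F = "\<lambda>n. fourier_integral (cutoff n f)"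
  let ?H = "\<lambda>n. cnj \<circ> fourier_integral (cutoff n (cnj \<circ> G))"
  have inner: "L2_inner lebesgue (?F n) (cutoff n G) = L2_inner lebesgue (cutoff n f) (?H n)" for n
  proof -
    have "cnj (cutoff n G w) = cutoff n (cnj \<circ> G) w" for w
      by (simp add: indicator_def)
    then have "L2_inner lebesgue (?F n) (cutoff n G) = (LINT w|lebesgue. ?F n w * cutoff n (cnj \<circ> G) w)"
      by (simp only: L2_inner_def)
    also have "\<dots> = (LINT x|lebesgue. cutoff n f x * fourier_integral (cutoff n (cnj \<circ> G)) x)"
      by (intro fourier_integral_duality cutoff_integrable f cG)
    finally show ?thesis by (simp add: L2_inner_def)
  qed
  have "(\<lambda>n. L2_inner lebesgue (?F n) (cutoff n G)) \<longlonglongrightarrow> L2_inner lebesgue (fourier f) G"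
    by (rule L2_inner_tendsto)
      (intro plancherel_L1_L2 cutoff_L2 cutoff_integrable cutoff_tendsto fourier_L2 fourier_tendsto f G)+
  moreover have "(\<lambda>n. L2_inner lebesgue (cutoff n f) (?H n)) \<longlonglongrightarrow> L2_inner lebesgue f f"
  proof (rule L2_inner_tendsto)
    have "?H n - f = cnj \<circ> (fourier_integral (cutoff n (cnj \<circ> G)) - fourier (cnj \<circ> G))" for n
      by (auto simp: f_def)
    then show "(\<lambda>n. L2_norm lebesgue (?H n - f)) \<longlonglongrightarrow> 0"
      using fourier_tendsto[OF cG] by (simp only: norm_cnj)
  qed (intro L2_cnj plancherel_L1_L2 cutoff_L2 cutoff_integrable cutoff_tendsto f cG)+
  ultimately have "L2_inner lebesgue (fourier f) G = L2_inner lebesgue f f"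
    unfolding inner by (rule LIMSEQ_unique)
  then have val: "L2_inner lebesgue (fourier f) G = of_real ((L2_norm lebesgue G)\<^sup>2)"
    by (simp only: L2_inner_self norm_f)
  have "L2_inner lebesgue (fourier f) (- G) = - of_real ((L2_norm lebesgue G)\<^sup>2)"
    unfolding val[symmetric] by (simp add: L2_inner_def)
  moreover have "L2_norm lebesgue (- G) = L2_norm lebesgue G"
    by (simp add: L2_norm_def)
  moreover have "L2_norm lebesgue (fourier f) = L2_norm lebesgue G"
    by (simp only: L2_norm_fourier[OF f] norm_f)
  ultimately have "(L2_norm lebesgue (fourier f + - G))\<^sup>2 = 0"
    by (subst L2_norm_add_sq[OF fourier_L2[OF f] L2_uminus[OF G]]) simp
  then have "L2_norm lebesgue (fourier f - G) = 0" by simp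
  then have "AE w in lebesgue. (fourier f - G) w = 0"
    by (rule L2_norm_zero_AE[OF L2_diff[OF fourier_L2[OF f] G]])
  with f that show thesis by simp
qed

section \<open>Periodization\<close>

lemma lebesgue_distr_translation:
  fixes a :: "'a::euclidean_space"
  shows "(\<lambda>x. x + a) \<in> lebesgue \<rightarrow>\<^sub>M lebesgue" and "distr lebesgue lebesgue (\<lambda>x. x + a) = lebesgue"
proof -
  have eq: "(\<lambda>x. a + (\<Sum>j\<in>Basis. (1 * (x \<bullet> j)) *\<^sub>R j)) = (\<lambda>x. x + a)"
    by (simp add: euclidean_representation add.commute)
  show "(\<lambda>x. x + a) \<in> lebesgue \<rightarrow>\<^sub>M lebesgue"
    using lebesgue_affine_measurable[of "\<lambda>_. 1" a] unfolding eq by simp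
  show "distr lebesgue lebesgue (\<lambda>x. x + a) = lebesgue"
    using lebesgue_affine_euclidean[of "\<lambda>_. 1" a] unfolding eq by (simp add: density_1)
qed

lemma measurable_translation:
  assumes "f \<in> borel_measurable lebesgue"
  shows "(\<lambda>x. f (x + a)) \<in> borel_measurable (lebesgue :: 'a::euclidean_space measure)"
  by (rule measurable_compose[OF lebesgue_distr_translation(1) assms])

lemma nn_integral_translation:
  fixes a :: "'a::euclidean_space"
  assumes "u \<in> borel_measurable lebesgue"
  shows "(\<integral>\<^sup>+ x. u (x + a) \<partial>lebesgue) = (\<integral>\<^sup>+ x. u x \<partial>lebesgue)"
proof -
  have "u \<in> borel_measurable (distr lebesgue lebesgue (\<lambda>x. x + a))"
    using assms by simp
  from nn_integral_distr[OF lebesgue_distr_translation(1) this] show ?thesis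
    by (simp add: lebesgue_distr_translation(2))
qed

lemma AE_lebesgue_translation:
  fixes a :: "'a::euclidean_space"
  assumes "AE x in lebesgue. P x"
  shows "AE x in lebesgue. P (x + a)"
  by (rule AE_distrD[OF lebesgue_distr_translation(1)])
    (simp only: lebesgue_distr_translation(2) assms)

lemma unit_cube_sets_borel: "(unit_cube :: (real ^ 'd::finite) set) \<in> sets borel"
proof -
  have "(unit_cube :: (real ^ 'd) set) = {x \<in> space borel. \<forall>i. 0 \<le> x $ i \<and> x $ i < 1}"
    by (simp add: unit_cube_def)
  also have "\<dots> \<in> sets borel" by measurable
  finally show ?thesis .
qed

lemma unit_cube_sets [measurable]: "(unit_cube :: (real ^ 'd::finite) set) \<in> sets lebesgue"
  by (rule sets_completionI_sets) (simp add: unit_cube_sets_borel)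

lemma emeasure_unit_cube: "emeasure lebesgue (unit_cube :: (real ^ 'd::finite) set) < \<infinity>"
proof -
  have "(unit_cube :: (real ^ 'd) set) \<subseteq> cbox 0 1"
    by (auto simp: unit_cube_def mem_box_cart less_imp_le)
  then have "emeasure lebesgue (unit_cube :: (real ^ 'd) set) \<le> emeasure lebesgue (cbox 0 (1 :: real ^ 'd))"
    by (rule emeasure_mono) auto
  also have "\<dots> < \<infinity>"
    using lmeasurable_cbox[of 0 "1 :: real ^ 'd"] by (simp add: fmeasurable_def)
  finally show ?thesis .
qed

definition floor_vec :: "real ^ 'd \<Rightarrow> int ^ 'd::finite"
  where "floor_vec x = (\<chi> i. \<lfloor>x $ i\<rfloor>)"

lemma floor_vec_eq_iff: "floor_vec x = k \<longleftrightarrow> x - real_vec k \<in> unit_cube"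
  by (auto simp: floor_vec_def unit_cube_def real_vec_def vec_eq_iff floor_eq_iff algebra_simps)

lemma floor_vec_add_real_vec: "w \<in> unit_cube \<Longrightarrow> floor_vec (w + real_vec k) = k"
  by (simp add: floor_vec_eq_iff)

lemma measurable_floor_vec: "floor_vec \<in> lebesgue \<rightarrow>\<^sub>M count_space (UNIV :: (int ^ 'd::finite) set)"
  unfolding measurable_count_space_eq2_countable
proof (intro conjI ballI)
  fix k :: "int ^ 'd"
  have "(\<lambda>x. x + - real_vec k) -` unit_cube \<inter> space lebesgue \<in> sets lebesgue"
    by (rule measurable_sets[OF lebesgue_distr_translation(1) unit_cube_sets])
  also have "(\<lambda>x. x + - real_vec k) -` unit_cube \<inter> space lebesgue = floor_vec -` {k} \<inter> space lebesgue"
    by (auto simp flip: floor_vec_eq_iff)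
  finally show "floor_vec -` {k} \<inter> space lebesgue \<in> sets lebesgue" .
qed simp

text \<open>The translates of the unit cube by integer vectors tile the space.\<close>

lemma nn_integral_periodization:
  assumes [measurable]: "u \<in> borel_measurable lebesgue"
  shows "(\<integral>\<^sup>+ x. u x \<partial>lebesgue)
    = (\<integral>\<^sup>+ w. \<integral>\<^sup>+ k. u (w + real_vec k) \<partial>count_space UNIV \<partial>lebesgue_on (unit_cube :: (real ^ 'd::finite) set))"
proof -
  let ?c = "indicator unit_cube :: real ^ 'd \<Rightarrow> ennreal"
  have shift: "(\<lambda>x. f (x + a)) \<in> borel_measurable lebesgue"
    if "f \<in> borel_measurable lebesgue" for f :: "real ^ 'd \<Rightarrow> ennreal" and a
    using that by (rule measurable_translation)
  have m1: "(\<lambda>x. u x * ?c (x + - real_vec k)) \<in> borel_measurable lebesgue" for k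
    by (intro borel_measurable_times_ennreal shift) measurable
  have m2: "(\<lambda>x. u (x + real_vec k) * ?c x) \<in> borel_measurable lebesgue" for k
    by (intro borel_measurable_times_ennreal shift) measurable
  have "u x = (\<integral>\<^sup>+ k. u x * ?c (x + - real_vec k) \<partial>count_space UNIV)" for x
  proof -
    have "?c (x + - real_vec k) = indicator {floor_vec x} k" for k
      by (simp add: indicator_def floor_vec_eq_iff eq_commute[of k])
    then show ?thesis by (simp add: nn_integral_cmult one_ennreal_def[symmetric])
  qed
  then have "(\<integral>\<^sup>+ x. u x \<partial>lebesgue)
      = (\<integral>\<^sup>+ x. \<integral>\<^sup>+ k. u x * ?c (x + - real_vec k) \<partial>count_space UNIV \<partial>lebesgue)"
    by simp
  also have "\<dots> = (\<integral>\<^sup>+ k. \<integral>\<^sup>+ x. u x * ?c (x + - real_vec k) \<partial>lebesgue \<partial>count_space UNIV)"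
    by (rule nn_integral_count_space_nn_integral) (simp, rule m1)
  also have "\<dots> = (\<integral>\<^sup>+ k. \<integral>\<^sup>+ x. u (x + real_vec k) * ?c x \<partial>lebesgue \<partial>count_space UNIV)"
  proof (rule nn_integral_cong)
    fix k
    show "(\<integral>\<^sup>+ x. u x * ?c (x + - real_vec k) \<partial>lebesgue) = (\<integral>\<^sup>+ x. u (x + real_vec k) * ?c x \<partial>lebesgue)"
      using nn_integral_translation[OF m1[of k], of "real_vec k"] by simp
  qed
  also have "\<dots> = (\<integral>\<^sup>+ x. \<integral>\<^sup>+ k. u (x + real_vec k) * ?c x \<partial>count_space UNIV \<partial>lebesgue)"
    by (rule nn_integral_count_space_nn_integral[symmetric]) (simp, rule m2)
  also have "\<dots> = (\<integral>\<^sup>+ x. (\<integral>\<^sup>+ k. u (x + real_vec k) \<partial>count_space UNIV) * ?c x \<partial>lebesgue)"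
    by (simp add: nn_integral_multc)
  also have "\<dots> = (\<integral>\<^sup>+ w. \<integral>\<^sup>+ k. u (w + real_vec k) \<partial>count_space UNIV \<partial>lebesgue_on unit_cube)"
    by (simp add: nn_integral_restrict_space)
  finally show ?thesis .
qed

lemma AE_periodization:
  assumes "AE x in lebesgue. P x"
  shows "AE w in lebesgue_on (unit_cube :: (real ^ 'd::finite) set). \<forall>k. P (w + real_vec k)"
proof -
  have "AE w in lebesgue. \<forall>k. P (w + real_vec k)"
    unfolding AE_all_countable by (intro allI AE_lebesgue_translation assms)
  then show ?thesis
    by (subst AE_restrict_space_iff) auto
qed

section \<open>Fibres and sections of the range function\<close>

text \<open>The squared \<open>\<ell>\<^sup>2\<close> norm with value \<open>\<infinity>\<close> outside \<open>\<ell>\<^sup>2\<close>, so that fibres may be integrated without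
  first knowing that they are square summable.\<close>

definition ell2_nn_norm_sq :: "'d::finite seq \<Rightarrow> ennreal"
  where "ell2_nn_norm_sq u = (\<integral>\<^sup>+ k. ennreal ((norm (u k))\<^sup>2) \<partial>count_space UNIV)"

definition measurable_section :: "(real ^ 'd::finite \<Rightarrow> 'd seq) \<Rightarrow> bool"
  where "measurable_section s \<longleftrightarrow> (\<forall>k. (\<lambda>w. s w k) \<in> borel_measurable (lebesgue_on unit_cube))"

lemma measurable_sectionD:
  "measurable_section s \<Longrightarrow> (\<lambda>w. s w k) \<in> borel_measurable (lebesgue_on unit_cube)"
  by (simp add: measurable_section_def)

lemma measurable_nn_integral_count_space:
  fixes f :: "'i::countable \<Rightarrow> 'a \<Rightarrow> ennreal"
  assumes "\<And>k. f k \<in> borel_measurable M"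
  shows "(\<lambda>w. \<integral>\<^sup>+ k. f k w \<partial>count_space UNIV) \<in> borel_measurable M"
proof -
  interpret sigma_finite_measure "count_space (UNIV :: 'i set)"
    by (rule sigma_finite_measure_count_space)
  have "(\<lambda>(k, w). f k w) \<in> borel_measurable (count_space UNIV \<Otimes>\<^sub>M M)"
    by (rule measurable_pair_measure_countable1) (use assms in auto)
  then have "(\<lambda>(w, k). f k w) \<in> borel_measurable (M \<Otimes>\<^sub>M count_space UNIV)"
    by (subst measurable_pair_swap_iff) (simp add: split_beta)
  then show ?thesis
    by (rule borel_measurable_nn_integral)
qed

lemma measurable_ell2_nn_norm_sq:
  assumes "measurable_section s"
  shows "(\<lambda>w. ell2_nn_norm_sq (s w)) \<in> borel_measurable (lebesgue_on unit_cube)"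
  unfolding ell2_nn_norm_sq_def
proof (rule measurable_nn_integral_count_space)
  fix k
  have [measurable]: "(\<lambda>w. s w k) \<in> borel_measurable (lebesgue_on unit_cube)"
    using assms by (rule measurable_sectionD)
  show "(\<lambda>w. ennreal ((norm (s w k))\<^sup>2)) \<in> borel_measurable (lebesgue_on unit_cube)"
    by measurable
qed

lemma measurable_section_fiber:
  assumes "f \<in> L2 lebesgue"
  shows "measurable_section (fiber f)"
  unfolding measurable_section_def fiber_def
  by (intro allI measurable_restrict_space1 measurable_translation L2_measurable fourier_L2 assms)

lemma nn_integral_fiber:
  assumes f: "f \<in> L2 lebesgue"
  shows "(\<integral>\<^sup>+ w. ell2_nn_norm_sq (fiber f w) \<partial>lebesgue_on unit_cube) = ennreal ((L2_norm lebesgue f)\<^sup>2)"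
proof -
  have [measurable]: "fourier f \<in> borel_measurable lebesgue"
    by (intro L2_measurable fourier_L2 f)
  show ?thesis
    using nn_integral_L2_norm_sq[OF fourier_L2[OF f]]
      nn_integral_periodization[of "\<lambda>w. ennreal ((norm (fourier f w))\<^sup>2)"]
    by (simp add: ell2_nn_norm_sq_def fiber_def L2_norm_fourier[OF f])
qed

text \<open>Glue the components of \<open>s\<close> along the tiling to one function \<open>G\<close> on the whole space, which is square
  integrable, and invert the Fourier transform.\<close>

lemma section_is_fiber:
  fixes s :: "real ^ 'd::finite \<Rightarrow> 'd seq"
  assumes s: "measurable_section s"
    and fin: "(\<integral>\<^sup>+ w. ell2_nn_norm_sq (s w) \<partial>lebesgue_on unit_cube) < \<infinity>"
  obtains f where "f \<in> L2 lebesgue" "AE w in lebesgue_on unit_cube. fiber f w = s w"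
proof -
  define h where "h k w = (if w \<in> unit_cube then s w k else 0)" for k w
  have h: "h k \<in> borel_measurable lebesgue" for k
    unfolding h_def using measurable_sectionD[OF s] by (rule borel_measurable_if_I) simp
  define G where "G x = h (floor_vec x) (x + - real_vec (floor_vec x))" for x
  have Gm [measurable]: "G \<in> borel_measurable lebesgue"
    unfolding G_def[abs_def]
    by (rule measurable_compose_countable[where f = "\<lambda>k x. h k (x + - real_vec k)"])
      (intro measurable_translation h, rule measurable_floor_vec)
  have G: "G (w + real_vec k) = s w k" if "w \<in> unit_cube" for w k
    using that by (simp add: G_def floor_vec_add_real_vec h_def)
  have "(\<integral>\<^sup>+ x. ennreal ((norm (G x))\<^sup>2) \<partial>lebesgue)
      = (\<integral>\<^sup>+ w. \<integral>\<^sup>+ k. ennreal ((norm (G (w + real_vec k)))\<^sup>2) \<partial>count_space UNIV \<partial>lebesgue_on unit_cube)"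
    by (rule nn_integral_periodization) measurable
  also have "\<dots> = (\<integral>\<^sup>+ w. ell2_nn_norm_sq (s w) \<partial>lebesgue_on unit_cube)"
    by (intro nn_integral_cong) (simp add: ell2_nn_norm_sq_def G)
  finally have "G \<in> L2 lebesgue"
    using fin by (simp add: L2_iff_nn_integral)
  then obtain f where f: "f \<in> L2 lebesgue" "AE x in lebesgue. fourier f x = G x"
    by (rule fourier_surjective)
  have "AE w in lebesgue_on unit_cube. fiber f w = s w"
    using AE_periodization[OF f(2)] AE_space[of "lebesgue_on unit_cube"]
    by eventually_elim (auto simp: fiber_def G)
  with f(1) that show thesis by blast
qed

lemma range_operator_zero:
  assumes "L2_bounded_operator (count_space UNIV) S A" "cfun.subspace S"
  shows "A 0 = 0"
proof -
  have "0 \<in> S" using assms(2) by (rule cfun.subspace_0)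
  then have "AE k in count_space UNIV. A (cscale 0 0) k = 0 * A 0 k"
    using assms(1) unfolding L2_bounded_operator_def by blast
  moreover have "cscale 0 0 = 0" by (auto simp: cscale_def)
  ultimately show ?thesis by (auto simp: AE_count_space)
qed

text \<open>With one constant \<open>C\<close>, a norm bound of \<open>L\<close>, for all sections: the range operator maps the measurable
  sections of \<open>J\<close> in the unit ball to sections essentially bounded by \<open>C\<close>, which are again
  measurable, being fibres of functions in the range of \<open>L\<close>. For the pointwise bound, the integrated
  bound is applied to the section cut off to the set \<open>E\<close> where the pointwise bound fails; hence \<open>E\<close> is
  a null set.\<close>

lemma range_operator_on_sections:
  fixes V :: "(real ^ 'd::finite \<Rightarrow> complex) set"
  assumes J: "range_function_of V J"
    and L: "L2_bounded_operator lebesgue V L" and VL2: "V \<subseteq> L2 lebesgue"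
    and R: "range_operator_of V J L R"
  obtains C where "0 \<le> C"
    "\<And>s. measurable_section s \<Longrightarrow> AE w in lebesgue_on unit_cube. s w \<in> J w \<and> ell2_nn_norm_sq (s w) \<le> 1 \<Longrightarrow>
      \<exists>h. measurable_section h \<and>
        (AE w in lebesgue_on unit_cube. R w (s w) = h w \<and> ell2_nn_norm_sq (h w) \<le> ennreal (C\<^sup>2))"
proof -
  let ?Q = "unit_cube :: (real ^ 'd) set"
  obtain C0 where C0: "\<And>f. f \<in> V \<Longrightarrow> L2_norm lebesgue (L f) \<le> C0 * L2_norm lebesgue f"
    using L unfolding L2_bounded_operator_def by blast
  define C where "C = max C0 0"
  have C: "L2_norm lebesgue (L f) \<le> C * L2_norm lebesgue f" if "f \<in> V" for f
    using C0[OF that] mult_right_mono[of C0 C "L2_norm lebesgue f"] L2_norm_nonneg[of lebesgue f]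
    by (simp add: C_def)
  have LV: "L f \<in> V" if "f \<in> V" for f
    using L that unfolding L2_bounded_operator_def by blast
  have subspace_J: "cfun.subspace (J w)" and op: "L2_bounded_operator (count_space UNIV) (J w) (R w)"
    if "w \<in> ?Q" for w
    using J R that
    by (auto simp: range_function_of_def measurable_range_function_def L2_closed_subspace_def
        range_operator_of_def)
  \<comment> \<open>A square-integrable section of \<open>J\<close> is the fibre of an element of \<open>V\<close>, to which the
    norm bound of \<open>L\<close> applies; the Plancherel identity turns it into an integrated bound for \<open>R\<close>.\<close>
  have key: "\<exists>h. measurable_section h \<and> (AE w in lebesgue_on ?Q. R w (s w) = h w) \<and>
      (\<integral>\<^sup>+ w. ell2_nn_norm_sq (h w) \<partial>lebesgue_on ?Q)
        \<le> ennreal (C\<^sup>2) * (\<integral>\<^sup>+ w. ell2_nn_norm_sq (s w) \<partial>lebesgue_on ?Q)"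
    if s: "measurable_section s" and fin: "(\<integral>\<^sup>+ w. ell2_nn_norm_sq (s w) \<partial>lebesgue_on ?Q) < \<infinity>"
      and sJ: "AE w in lebesgue_on ?Q. s w \<in> J w" for s
  proof -
    obtain f where f: "f \<in> L2 lebesgue" "AE w in lebesgue_on ?Q. fiber f w = s w"
      using section_is_fiber[OF s fin] by blast
    have "AE w in lebesgue_on ?Q. fiber f w \<in> J w"
      using f(2) sJ by eventually_elim simp
    then have V: "f \<in> V"
      using J f(1) by (auto simp: range_function_of_def)
    have Lf: "L f \<in> L2 lebesgue" using LV[OF V] VL2 by blast
    have "AE w in lebesgue_on ?Q. fiber (L f) w = R w (fiber f w)"
      using R V by (auto simp: range_operator_of_def)
    then have eq: "AE w in lebesgue_on ?Q. R w (s w) = fiber (L f) w"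
      using f(2) by eventually_elim simp
    have "(\<integral>\<^sup>+ w. ell2_nn_norm_sq (fiber (L f) w) \<partial>lebesgue_on ?Q) = ennreal ((L2_norm lebesgue (L f))\<^sup>2)"
      by (rule nn_integral_fiber[OF Lf])
    also have "\<dots> \<le> ennreal ((C * L2_norm lebesgue f)\<^sup>2)"
      using C[OF V] by (intro ennreal_leI power_mono) (auto simp: L2_norm_nonneg)
    also have "\<dots> = ennreal (C\<^sup>2) * ennreal ((L2_norm lebesgue f)\<^sup>2)"
      by (simp add: power_mult_distrib ennreal_mult)
    also have "ennreal ((L2_norm lebesgue f)\<^sup>2) = (\<integral>\<^sup>+ w. ell2_nn_norm_sq (fiber f w) \<partial>lebesgue_on ?Q)"
      by (rule nn_integral_fiber[OF f(1), symmetric])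
    also have "\<dots> = (\<integral>\<^sup>+ w. ell2_nn_norm_sq (s w) \<partial>lebesgue_on ?Q)"
    proof (rule nn_integral_cong_AE)
      show "AE w in lebesgue_on ?Q. ell2_nn_norm_sq (fiber f w) = ell2_nn_norm_sq (s w)"
        using f(2) by eventually_elim simp
    qed
    finally show ?thesis
      using measurable_section_fiber[OF Lf] eq by blast
  qed
  show thesis
  proof (rule that[of C])
    show "0 \<le> C" by (simp add: C_def)
    fix s
    assume s: "measurable_section s"
      and AE_s: "AE w in lebesgue_on ?Q. s w \<in> J w \<and> ell2_nn_norm_sq (s w) \<le> 1"
    have finQ: "emeasure (lebesgue_on ?Q) (space (lebesgue_on ?Q)) < \<infinity>"
      using emeasure_unit_cube by (simp add: emeasure_restrict_space)
    have fin: "(\<integral>\<^sup>+ w. ell2_nn_norm_sq (s' w) \<partial>lebesgue_on ?Q) < \<infinity>"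
      if "AE w in lebesgue_on ?Q. ell2_nn_norm_sq (s' w) \<le> 1" for s'
    proof -
      have "(\<integral>\<^sup>+ w. ell2_nn_norm_sq (s' w) \<partial>lebesgue_on ?Q) \<le> (\<integral>\<^sup>+ w. 1 \<partial>lebesgue_on ?Q)"
        using that by (rule nn_integral_mono_AE)
      then show ?thesis using finQ by (auto intro: le_less_trans)
    qed
    have s1: "AE w in lebesgue_on ?Q. ell2_nn_norm_sq (s w) \<le> 1"
      and sJ: "AE w in lebesgue_on ?Q. s w \<in> J w"
      using AE_s by auto
    obtain h where h: "measurable_section h" "AE w in lebesgue_on ?Q. R w (s w) = h w"
      using key[OF s fin[OF s1] sJ] by blast
    have [measurable]: "(\<lambda>w. ell2_nn_norm_sq (h w)) \<in> borel_measurable (lebesgue_on ?Q)"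
      "(\<lambda>w. ell2_nn_norm_sq (s w)) \<in> borel_measurable (lebesgue_on ?Q)"
      by (intro measurable_ell2_nn_norm_sq h s)+
    define E where "E = {w \<in> space (lebesgue_on ?Q). ennreal (C\<^sup>2) * ell2_nn_norm_sq (s w) < ell2_nn_norm_sq (h w)}"
    have [measurable]: "E \<in> sets (lebesgue_on ?Q)" unfolding E_def by measurable
    define s' where "s' w = (if w \<in> E then s w else 0)" for w
    have s': "measurable_section s'"
      unfolding measurable_section_def
    proof
      fix k
      have [measurable]: "(\<lambda>w. s w k) \<in> borel_measurable (lebesgue_on ?Q)"
        using s by (rule measurable_sectionD)
      have "(\<lambda>w. if w \<in> E then s w k else 0) \<in> borel_measurable (lebesgue_on ?Q)"
        by measurable
      then show "(\<lambda>w. s' w k) \<in> borel_measurable (lebesgue_on ?Q)"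
        by (simp add: s'_def if_distrib[of "\<lambda>u. u _"] zero_fun_def)
    qed
    have zero: "ell2_nn_norm_sq 0 = 0" by (simp add: ell2_nn_norm_sq_def)
    have s'1: "AE w in lebesgue_on ?Q. ell2_nn_norm_sq (s' w) \<le> 1"
      using s1 by eventually_elim (simp add: s'_def zero)
    have s'J: "AE w in lebesgue_on ?Q. s' w \<in> J w"
      using sJ AE_space[of "lebesgue_on ?Q"]
      by eventually_elim (auto simp: s'_def intro: cfun.subspace_0 subspace_J)
    obtain h' where h': "AE w in lebesgue_on ?Q. R w (s' w) = h' w"
      and le: "(\<integral>\<^sup>+ w. ell2_nn_norm_sq (h' w) \<partial>lebesgue_on ?Q)
        \<le> ennreal (C\<^sup>2) * (\<integral>\<^sup>+ w. ell2_nn_norm_sq (s' w) \<partial>lebesgue_on ?Q)"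
      using key[OF s' fin[OF s'1] s'J] by blast
    let ?r = "\<lambda>w. ell2_nn_norm_sq (h w) * indicator E w"
    let ?t = "\<lambda>w. ennreal (C\<^sup>2) * ell2_nn_norm_sq (s w) * indicator E w"
    have "AE w in lebesgue_on ?Q. ell2_nn_norm_sq (h' w) = ?r w"
      using h' h(2) AE_space[of "lebesgue_on ?Q"]
    proof eventually_elim
      case (elim w)
      then have "h' w = (if w \<in> E then h w else 0)"
        by (auto simp: s'_def range_operator_zero[OF op subspace_J])
      then show ?case by (simp add: zero)
    qed
    then have "(\<integral>\<^sup>+ w. ell2_nn_norm_sq (h' w) \<partial>lebesgue_on ?Q) = (\<integral>\<^sup>+ w. ?r w \<partial>lebesgue_on ?Q)"
      by (rule nn_integral_cong_AE)
    moreover have "ennreal (C\<^sup>2) * (\<integral>\<^sup>+ w. ell2_nn_norm_sq (s' w) \<partial>lebesgue_on ?Q)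
        = (\<integral>\<^sup>+ w. ?t w \<partial>lebesgue_on ?Q)"
    proof -
      have "ell2_nn_norm_sq (s' w) = ell2_nn_norm_sq (s w) * indicator E w" for w
        by (simp add: s'_def zero)
      then show ?thesis
        by (simp add: mult.assoc nn_integral_cmult)
    qed
    ultimately have rt: "(\<integral>\<^sup>+ w. ?r w \<partial>lebesgue_on ?Q) \<le> (\<integral>\<^sup>+ w. ?t w \<partial>lebesgue_on ?Q)"
      using le by simp
    have tr: "?t w \<le> ?r w" for w
      by (auto simp: E_def indicator_def)
    have t_fin: "(\<integral>\<^sup>+ w. ?t w \<partial>lebesgue_on ?Q) \<noteq> \<infinity>"
    proof -
      have "(\<integral>\<^sup>+ w. ?t w \<partial>lebesgue_on ?Q) \<le> (\<integral>\<^sup>+ w. ennreal (C\<^sup>2) * ell2_nn_norm_sq (s w) \<partial>lebesgue_on ?Q)"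
        by (intro nn_integral_mono) (auto simp: indicator_def)
      also have "\<dots> = ennreal (C\<^sup>2) * (\<integral>\<^sup>+ w. ell2_nn_norm_sq (s w) \<partial>lebesgue_on ?Q)"
        by (simp add: nn_integral_cmult)
      also have "\<dots> < \<infinity>"
        using fin[OF s1] by (simp add: ennreal_mult_less_top)
      finally show ?thesis by simp
    qed
    have "(\<integral>\<^sup>+ w. ?r w - ?t w \<partial>lebesgue_on ?Q)
        = (\<integral>\<^sup>+ w. ?r w \<partial>lebesgue_on ?Q) - (\<integral>\<^sup>+ w. ?t w \<partial>lebesgue_on ?Q)"
      using t_fin tr by (intro nn_integral_diff) auto
    also have "\<dots> = 0"
    proof -
      have "(\<integral>\<^sup>+ w. ?r w \<partial>lebesgue_on ?Q) < top"
        using rt t_fin by (intro le_less_trans[OF rt]) (simp add: less_top)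
      then show ?thesis using rt by (simp add: diff_eq_0_iff_ennreal)
    qed
    finally have "AE w in lebesgue_on ?Q. ?r w - ?t w = 0"
      by (subst (asm) nn_integral_0_iff_AE) auto
    then have notE: "AE w in lebesgue_on ?Q. w \<notin> E"
    proof eventually_elim
      case (elim w)
      show ?case
      proof
        assume "w \<in> E"
        with elim show False
          by (auto simp: E_def diff_eq_0_iff_ennreal)
      qed
    qed
    have "AE w in lebesgue_on ?Q. R w (s w) = h w \<and> ell2_nn_norm_sq (h w) \<le> ennreal (C\<^sup>2)"
      using notE h(2) s1 AE_space[of "lebesgue_on ?Q"]
    proof eventually_elim
      case (elim w)
      then have "ell2_nn_norm_sq (h w) \<le> ennreal (C\<^sup>2) * ell2_nn_norm_sq (s w)"
        by (auto simp: E_def not_less)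
      also have "\<dots> \<le> ennreal (C\<^sup>2) * 1"
        using elim by (intro mult_left_mono) auto
      finally show ?case using elim by simp
    qed
    with h(1) show "\<exists>h. measurable_section h \<and>
        (AE w in lebesgue_on ?Q. R w (s w) = h w \<and> ell2_nn_norm_sq (h w) \<le> ennreal (C\<^sup>2))"
      by blast
  qed
qed

section \<open>Orthogonal projections onto finite-dimensional subspaces\<close>

lemma L2_inner_zero_right: "L2_inner M f 0 = 0"
  using L2_inner_commute[of M 0 f] by (simp add: L2_inner_zero_left)

lemma orth_span:
  assumes "w \<in> L2 M" "B \<subseteq> L2 M" "\<And>b. b \<in> B \<Longrightarrow> L2_inner M w b = 0" "v \<in> cfun.span B"
  shows "v \<in> L2 M \<and> L2_inner M w v = 0"
  using assms(4)
proof (induction rule: cfun.span_induct_alt)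
  case base
  show ?case using L2_zero L2_inner_zero_right by blast
next
  case (step c x y)
  then have x: "x \<in> L2 M" "L2_inner M x w = 0"
    using assms L2_inner_commute[of M x w] by auto
  have y: "y \<in> L2 M" "L2_inner M y w = 0"
    using step L2_inner_commute[of M y w] by auto
  have "L2_inner M (cscale c x + y) w = 0"
    using assms(1) x y by (simp only: L2_inner_add_left L2_cscale L2_inner_cscale_left) simp
  then have "L2_inner M w (cscale c x + y) = 0"
    using L2_inner_commute[of M w "cscale c x + y"] by (simp only: complex_cnj_zero)
  then show ?case
    using L2_add[OF L2_cscale[OF x(1)] y(1)] by blast
qed

lemma span_subset_L2: "B \<subseteq> L2 M \<Longrightarrow> cfun.span B \<subseteq> L2 M"
  by (rule cfun.span_minimal[OF _ L2_subspace])

lemma ell2_norm_zero: "u \<in> ell2 \<Longrightarrow> L2_norm (count_space UNIV) u = 0 \<Longrightarrow> u = 0"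
  using L2_norm_zero_AE[of u "count_space UNIV"] by (auto simp: AE_count_space)

lemma ell2_inner_self_eq_0: "u \<in> ell2 \<Longrightarrow> ell2_inner u u = 0 \<Longrightarrow> u = 0"
  by (rule ell2_norm_zero) (simp_all add: L2_inner_self)

text \<open>One Gram--Schmidt step: the component \<open>d\<close> of the new vector \<open>a\<close> orthogonal to the old span
  contributes one further term to the projection.\<close>

lemma exists_projection:
  fixes B :: "'d::finite seq set"
  assumes "finite B" "B \<subseteq> ell2" "u \<in> ell2"
  shows "\<exists>p\<in>cfun.span B. \<forall>v\<in>cfun.span B. ell2_inner (u - p) v = 0"
  using assms
proof (induction B arbitrary: u rule: finite_induct)
  case empty
  have "ell2_inner (u - 0) v = 0" if "v \<in> cfun.span {}" for v
    using that by (simp only: cfun.span_empty singleton_iff L2_inner_zero_right)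
  then show ?case using cfun.span_zero by blast
next
  case (insert a B)
  have span_L2: "cfun.span B \<subseteq> ell2" using insert.prems by (intro span_subset_L2) auto
  have a: "a \<in> ell2" and B: "B \<subseteq> ell2" using insert.prems by simp_all
  obtain q where q: "q \<in> cfun.span B" "\<And>v. v \<in> cfun.span B \<Longrightarrow> ell2_inner (a - q) v = 0"
    using insert.IH[OF B a] by blast
  obtain p where p: "p \<in> cfun.span B" "\<And>v. v \<in> cfun.span B \<Longrightarrow> ell2_inner (u - p) v = 0"
    using insert.IH[OF B insert.prems(2)] by blast
  define d where "d = a - q"
  have d: "d \<in> ell2" unfolding d_def using a q(1) span_L2 by (intro L2_diff) auto
  have span_mono: "cfun.span B \<subseteq> cfun.span (insert a B)"
    by (rule cfun.span_mono) auto
  have d_span: "d \<in> cfun.span (insert a B)"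
    unfolding d_def using q(1) span_mono by (intro cfun.span_diff) (auto intro: cfun.span_base)
  define c where "c = ell2_inner (u - p) d / ell2_inner d d"
  define p' where "p' = p + cscale c d"
  have up: "u - p \<in> ell2" using insert.prems p(1) span_L2 by (intro L2_diff) auto
  have inner: "ell2_inner (u - p') v = ell2_inner (u - p) v - c * ell2_inner d v" if "v \<in> ell2" for v
  proof -
    have "u - p' = (u - p) - cscale c d" by (simp add: p'_def)
    then show ?thesis
      using L2_inner_diff_left[OF up L2_cscale[OF d] that] by (simp only: L2_inner_cscale_left)
  qed
  have up': "u - p' \<in> ell2"
    unfolding p'_def using insert.prems p(1) span_L2 d by (intro L2_diff L2_add L2_cscale) auto
  have orth_B: "ell2_inner (u - p') v = 0" if "v \<in> cfun.span B" for v
    using inner[of v] p(2)[OF that] q(2)[OF that] that span_L2 by (auto simp: d_def)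
  have orth_d: "ell2_inner (u - p') d = 0"
  proof (cases "ell2_inner d d = 0")
    case True
    then show ?thesis using ell2_inner_self_eq_0[OF d] by (simp add: L2_inner_zero_right)
  next
    case False
    then show ?thesis using inner[OF d] by (simp add: c_def)
  qed
  have orth_a: "ell2_inner (u - p') a = 0"
  proof -
    have "ell2_inner a (u - p') = ell2_inner (d + q) (u - p')" by (simp add: d_def)
    also have "\<dots> = ell2_inner d (u - p') + ell2_inner q (u - p')"
      using d q(1) span_L2 up' by (intro L2_inner_add_left) auto
    also have "\<dots> = 0"
      using orth_d orth_B[OF q(1)] L2_inner_commute[of _ d "u - p'"] L2_inner_commute[of _ q "u - p'"]
      by simp
    finally show ?thesis using L2_inner_commute[of _ "u - p'" a] by simp
  qed
  show ?case
  proof (intro bexI ballI)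
    show "p' \<in> cfun.span (insert a B)"
      unfolding p'_def using p(1) span_mono d_span by (intro cfun.span_add cfun.span_scale) auto
    fix v assume v: "v \<in> cfun.span (insert a B)"
    show "ell2_inner (u - p') v = 0"
      using orth_span[OF up' insert.prems(1) _ v] orth_a orth_B cfun.span_base[of _ B] by blast
  qed
qed

lemma orth_proj:
  fixes S :: "'d::finite seq set"
  assumes S: "finite_dimensional S" "S \<subseteq> ell2" and u: "u \<in> ell2"
  shows "orth_proj S u \<in> S" and "v \<in> S \<Longrightarrow> ell2_inner (u - orth_proj S u) v = 0"
proof -
  obtain B where B: "finite B" "cfun.span B = S"
    using S(1) by (auto simp: finite_dimensional_def)
  have "B \<subseteq> ell2" using B(2) S(2) cfun.span_superset[of B] by auto
  obtain p where p: "p \<in> S" "\<forall>v\<in>S. ell2_inner (u - p) v = 0"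
    using exists_projection[OF B(1) \<open>B \<subseteq> ell2\<close> u] unfolding B(2) by blast
  have unique: "p' = p" if "p' \<in> S \<and> (\<forall>v\<in>S. ell2_inner (u - p') v = 0)" for p'
  proof -
    have sub: "p - p' \<in> S"
      using p(1) that unfolding B(2)[symmetric] by (intro cfun.span_diff) auto
    have m: "p \<in> ell2" "p' \<in> ell2" "p - p' \<in> ell2" using p(1) that sub S(2) by auto
    have "ell2_inner ((u - p') - (u - p)) (p - p') = 0"
      using p(2) that sub L2_inner_diff_left[OF L2_diff[OF u m(2)] L2_diff[OF u m(1)] m(3)]
      by (simp only:) simp
    then have "p - p' = 0"
      using ell2_inner_self_eq_0[OF m(3)] by (simp add: algebra_simps)
    then show ?thesis by simp
  qed
  have "orth_proj S u \<in> S \<and> (\<forall>v\<in>S. ell2_inner (u - orth_proj S u) v = 0)"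
    unfolding orth_proj_def
    by (rule theI[where a = p]) (use p unique in blast)+
  then show "orth_proj S u \<in> S" "v \<in> S \<Longrightarrow> ell2_inner (u - orth_proj S u) v = 0"
    by blast+
qed

section \<open>A measurable choice of orthonormal bases\<close>

definition residual :: "(nat \<Rightarrow> 'd::finite seq) \<Rightarrow> (nat \<Rightarrow> 'd seq) \<Rightarrow> nat \<Rightarrow> nat \<Rightarrow> 'd seq"
  where "residual x b j l = x l - (\<Sum>i<j. cscale (ell2_inner (x l) (b i)) (b i))"

definition normalize_seq :: "'d::finite seq \<Rightarrow> 'd seq"
  where "normalize_seq v = cscale (of_real (1 / L2_norm (count_space UNIV) v)) v"

lemma residual_cong [fundef_cong]:
  assumes "x = x'" "j = j'" "l = l'" "\<And>i. i < j' \<Longrightarrow> b i = b' i"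
  shows "residual x b j l = residual x' b' j' l'"
  using assms by (simp add: residual_def)

text \<open>Unlike the usual process, step \<open>j\<close> does not treat the \<open>j\<close>-th vector but the first vector with a nonzero
  residual. Hence no gaps occur: the members are orthonormal up to the first zero, and
  once a zero occurs all vectors are exhausted. If no residual is left, every candidate is zero and
  the value of \<open>LEAST\<close> is irrelevant. Picking a least index keeps the choice
  measurable in a parameter.\<close>

fun gram_schmidt :: "(nat \<Rightarrow> 'd::finite seq) \<Rightarrow> nat \<Rightarrow> 'd seq"
  where "gram_schmidt x j = normalize_seq
    (residual x (gram_schmidt x) j (LEAST l. residual x (gram_schmidt x) j l \<noteq> 0))"

declare gram_schmidt.simps [simp del]

lemma L2_norm_normalize_seq:
  assumes "v \<in> ell2" "v \<noteq> 0"
  shows "L2_norm (count_space UNIV) (normalize_seq v) = 1"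
proof -
  have "L2_norm (count_space UNIV) v \<noteq> 0"
    using ell2_norm_zero[OF assms(1)] assms(2) by blast
  then show ?thesis
    by (simp add: normalize_seq_def L2_norm_cscale norm_divide L2_norm_nonneg)
qed

lemma normalize_seq_eq_0_iff:
  assumes "v \<in> ell2"
  shows "normalize_seq v = 0 \<longleftrightarrow> v = 0"
proof
  assume *: "normalize_seq v = 0"
  show "v = 0"
  proof (rule ccontr)
    assume "v \<noteq> 0"
    then have "L2_norm (count_space UNIV) (normalize_seq v) = 1"
      by (rule L2_norm_normalize_seq[OF assms])
    then show False unfolding * by (simp add: L2_norm_def)
  qed
qed (simp add: normalize_seq_def cscale_def fun_eq_iff)

lemma inner_residual:
  assumes "x l \<in> ell2" "\<And>i. i < j \<Longrightarrow> b i \<in> ell2"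
    and "\<And>i. i < j \<Longrightarrow> b i = 0 \<or> ell2_inner (b i) (b i) = 1"
    and "\<And>i i'. i < j \<Longrightarrow> i' < j \<Longrightarrow> i \<noteq> i' \<Longrightarrow> ell2_inner (b i) (b i') = 0"
    and "m < j"
  shows "ell2_inner (residual x b j l) (b m) = 0"
proof -
  let ?c = "\<lambda>i. ell2_inner (x l) (b i)"
  have m: "b m \<in> ell2" using assms by auto
  have mem: "(\<Sum>i<j. cscale (?c i) (b i)) \<in> ell2"
    by (rule cfun.subspace_sum[OF L2_subspace]) (auto intro: L2_cscale assms)
  have "ell2_inner (\<Sum>i<j. cscale (?c i) (b i)) (b m) = (\<Sum>i<j. ?c i * ell2_inner (b i) (b m))"
    by (subst L2_inner_sum_left) (auto simp: L2_inner_cscale_left intro!: L2_cscale assms m)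
  also have "\<dots> = (\<Sum>i<j. if i = m then ?c m * ell2_inner (b m) (b m) else 0)"
    by (intro sum.cong refl) (use assms in auto)
  also have "\<dots> = ?c m * ell2_inner (b m) (b m)"
    using \<open>m < j\<close> by simp
  also have "\<dots> = ?c m"
    using assms(3)[OF \<open>m < j\<close>] by (auto simp: L2_inner_zero_right)
  finally show ?thesis
    unfolding residual_def by (subst L2_inner_diff_left[OF assms(1) mem m]) simp
qed

lemma orthonormal_independent:
  fixes b :: "nat \<Rightarrow> 'd::finite seq"
  assumes "\<And>i. i < n \<Longrightarrow> b i \<in> ell2" "\<And>i. i < n \<Longrightarrow> ell2_inner (b i) (b i) = 1"
    and "\<And>i i'. i < n \<Longrightarrow> i' < n \<Longrightarrow> i \<noteq> i' \<Longrightarrow> ell2_inner (b i) (b i') = 0"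
  shows "inj_on b {..<n}" and "cfun.independent (b ` {..<n})"
proof -
  show inj: "inj_on b {..<n}"
    using assms(2,3) by (intro inj_onI) (metis lessThan_iff zero_neq_one)
  show "cfun.independent (b ` {..<n})"
  proof (rule cfun.independent_if_scalars_zero)
    fix f u
    assume *: "(\<Sum>u\<in>b ` {..<n}. cscale (f u) u) = 0" and "u \<in> b ` {..<n}"
    then obtain m where m: "m < n" "u = b m" by auto
    have "0 = ell2_inner (\<Sum>i<n. cscale (f (b i)) (b i)) (b m)"
      using * by (simp add: sum.reindex[OF inj] L2_inner_zero_left)
    also have "\<dots> = (\<Sum>i<n. f (b i) * ell2_inner (b i) (b m))"
      by (subst L2_inner_sum_left) (auto simp: L2_inner_cscale_left intro!: L2_cscale assms m)
    also have "\<dots> = (\<Sum>i<n. if i = m then f (b m) else 0)"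
      by (intro sum.cong refl) (use assms m in auto)
    also have "\<dots> = f u" using m by simp
    finally show "f u = 0" by simp
  qed simp
qed

lemma gram_schmidt_orthonormal:
  fixes x :: "nat \<Rightarrow> 'd::finite seq"
  assumes S: "cfun.subspace S" "S \<subseteq> ell2" and x: "\<And>l. x l \<in> S"
  shows "gram_schmidt x j \<in> S"
    and "gram_schmidt x j = 0 \<or> ell2_inner (gram_schmidt x j) (gram_schmidt x j) = 1"
    and "i < j \<Longrightarrow> ell2_inner (gram_schmidt x j) (gram_schmidt x i) = 0"
proof -
  define b where "b = gram_schmidt x"
  have "b j \<in> S \<and> (b j = 0 \<or> ell2_inner (b j) (b j) = 1) \<and> (\<forall>i<j. ell2_inner (b j) (b i) = 0)"
  proof (induction j rule: less_induct)
    case (less j)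
    then have IH: "\<And>i. i < j \<Longrightarrow> b i \<in> S" "\<And>i. i < j \<Longrightarrow> b i = 0 \<or> ell2_inner (b i) (b i) = 1"
      by blast+
    have orth: "ell2_inner (b i) (b i') = 0" if "i < j" "i' < j" "i \<noteq> i'" for i i'
    proof (cases "i' < i")
      case True
      then show ?thesis using less[OF that(1)] by blast
    next
      case False
      then have "ell2_inner (b i') (b i) = 0" using less[OF that(2)] that by simp
      then show ?thesis using L2_inner_commute[of _ "b i" "b i'"] by simp
    qed
    define l where "l = (LEAST l. residual x b j l \<noteq> 0)"
    define v where "v = residual x b j l"
    have bj: "b j = normalize_seq v"
      unfolding b_def v_def l_def by (rule gram_schmidt.simps)
    have v: "v \<in> S" unfolding v_def residual_def
      by (intro cfun.subspace_diff[OF S(1)] cfun.subspace_sum[OF S(1)] cfun.subspace_scale[OF S(1)] x IH)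
        simp
    have 1: "b j \<in> S"
      unfolding bj normalize_seq_def by (intro cfun.subspace_scale[OF S(1)] v)
    have 2: "b j = 0 \<or> ell2_inner (b j) (b j) = 1"
      using normalize_seq_eq_0_iff[of v] L2_norm_normalize_seq[of v] v S(2)
      unfolding bj L2_inner_self by (cases "v = 0") auto
    have 3: "ell2_inner (b j) (b i) = 0" if "i < j" for i
    proof -
      have "ell2_inner v (b i) = 0"
        unfolding v_def using x IH orth S(2) that by (intro inner_residual) blast+
      then show ?thesis unfolding bj normalize_seq_def L2_inner_cscale_left by simp
    qed
    from 1 2 3 show ?case by blast
  qed
  then show "gram_schmidt x j \<in> S"
    "gram_schmidt x j = 0 \<or> ell2_inner (gram_schmidt x j) (gram_schmidt x j) = 1"
    "i < j \<Longrightarrow> ell2_inner (gram_schmidt x j) (gram_schmidt x i) = 0"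
    unfolding b_def by blast+
qed

lemma gram_schmidt_eq_0:
  fixes x :: "nat \<Rightarrow> 'd::finite seq"
  assumes S: "cfun.subspace S" "S \<subseteq> ell2" and x: "\<And>l. x l \<in> S" and "gram_schmidt x j = 0"
  shows "x l \<in> cfun.span (gram_schmidt x ` {..<j})"
proof -
  let ?b = "gram_schmidt x"
  have mem: "residual x ?b j l \<in> ell2" for l
  proof -
    have "residual x ?b j l \<in> S" unfolding residual_def
      by (intro cfun.subspace_diff[OF S(1)] cfun.subspace_sum[OF S(1)] cfun.subspace_scale[OF S(1)]
          x gram_schmidt_orthonormal(1)[OF S x])
    then show ?thesis using S(2) by blast
  qed
  have "residual x ?b j (LEAST l. residual x ?b j l \<noteq> 0) = 0"
    using assms(4) normalize_seq_eq_0_iff[OF mem] by (simp add: gram_schmidt.simps[of x j])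
  then have "residual x ?b j l = 0"
    using LeastI[of "\<lambda>l. residual x ?b j l \<noteq> 0" l] by blast
  then have "x l = (\<Sum>i<j. cscale (ell2_inner (x l) (?b i)) (?b i))"
    by (simp add: residual_def)
  also have "\<dots> \<in> cfun.span (?b ` {..<j})"
    by (intro cfun.span_sum cfun.span_scale cfun.span_base) auto
  finally show ?thesis .
qed

definition unit_seq :: "int ^ 'd \<Rightarrow> 'd::finite seq"
  where "unit_seq k = (\<lambda>i. if i = k then 1 else 0)"

lemma unit_seq_ell2: "unit_seq k \<in> ell2"
proof -
  have "(\<integral>\<^sup>+ i. ennreal ((norm (unit_seq k i))\<^sup>2) \<partial>count_space UNIV)
      = (\<integral>\<^sup>+ i. indicator {k} i \<partial>count_space UNIV)"
    by (intro nn_integral_cong) (auto simp: unit_seq_def indicator_def)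
  then show ?thesis by (subst L2_iff_nn_integral) auto
qed

lemma ell2_inner_unit_seq: "ell2_inner u (unit_seq k) = u k"
proof -
  let ?f = "\<lambda>i. u i * cnj (unit_seq k i)"
  have "ell2_inner u (unit_seq k) = (\<Sum>i\<in>{i. ?f i \<noteq> 0}. ?f i)"
    unfolding L2_inner_def
    by (subst lebesgue_integral_count_space_finite_support)
      (auto simp: unit_seq_def intro: finite_subset[of _ "{k}"])
  also have "\<dots> = (\<Sum>i\<in>{k}. ?f i)"
    by (rule sum.mono_neutral_left) (auto simp: unit_seq_def)
  finally show ?thesis by (simp add: unit_seq_def)
qed

text \<open>The projections of the unit vectors are a spanning family of \<open>S\<close> whose components depend
  measurably on \<open>S\<close>, by the definition of a measurable range function.\<close>

definition projected_units :: "'d::finite seq set \<Rightarrow> nat \<Rightarrow> 'd seq"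
  where "projected_units S l = orth_proj S (unit_seq (from_nat l))"

definition fiber_basis :: "'d::finite seq set \<Rightarrow> nat \<Rightarrow> 'd seq"
  where "fiber_basis S = gram_schmidt (projected_units S)"

text \<open>The process stops at some \<open>N\<close>, because independent families in \<open>S\<close> have bounded size. If
  \<open>v \<in> S\<close>, then the residual \<open>w\<close> of \<open>v\<close> is orthogonal to all projected unit vectors, and since \<open>w \<in> S\<close> also to
  all unit vectors; so \<open>w = 0\<close>, and the first \<open>N\<close> members form a basis, whence \<open>N\<close> is the dimension.\<close>

lemma fiber_basis:
  fixes S :: "'d::finite seq set"
  assumes fd: "finite_dimensional S" and L2: "S \<subseteq> ell2"
  shows fiber_basis_mem: "fiber_basis S j \<in> S"
    and fiber_basis_norm: "L2_norm (count_space UNIV) (fiber_basis S j) \<le> 1"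
    and fiber_basis_inj: "inj_on (fiber_basis S) {..<cfun.dim S}"
    and fiber_basis_independent: "cfun.independent (fiber_basis S ` {..<cfun.dim S})"
    and fiber_basis_span: "cfun.span (fiber_basis S ` {..<cfun.dim S}) = S"
    and fiber_basis_expand: "v \<in> S \<Longrightarrow>
      v = (\<Sum>i<cfun.dim S. cscale (ell2_inner v (fiber_basis S i)) (fiber_basis S i))"
proof -
  obtain B where B: "finite B" "cfun.span B = S"
    using fd by (auto simp: finite_dimensional_def)
  have sub: "cfun.subspace S" unfolding B(2)[symmetric] by (rule cfun.subspace_span)
  define b where "b = gram_schmidt (projected_units S)"
  have fb: "fiber_basis S = b" by (simp only: fiber_basis_def b_def)
  have p: "projected_units S l \<in> S" for l
    unfolding projected_units_def by (rule orth_proj(1)[OF fd L2 unit_seq_ell2])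
  note gs = gram_schmidt_orthonormal[where x = "projected_units S", OF sub L2 p, folded b_def]
  have b2: "b j \<in> ell2" for j by (rule subsetD[OF L2 gs(1)])
  have orth: "ell2_inner (b i) (b i') = 0" if "i \<noteq> i'" for i i'
    using gs(3)[of i i'] gs(3)[of i' i] that L2_inner_commute[of _ "b i" "b i'"]
    by (cases "i < i'") auto
  show "fiber_basis S j \<in> S" using gs(1) by (simp only: fb)
  show "L2_norm (count_space UNIV) (fiber_basis S j) \<le> 1"
  proof -
    have "b j = 0 \<or> (L2_norm (count_space UNIV) (b j))\<^sup>2 = 1"
      using gs(2)[of j] unfolding L2_inner_self by (metis of_real_eq_1_iff)
    then show ?thesis
      unfolding fb using L2_norm_nonneg[of "count_space UNIV" "b j"]
      by (auto simp: L2_norm_def power2_eq_1_iff)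
  qed
  have ind: "inj_on b {..<n}" "cfun.independent (b ` {..<n})" if "\<And>i. i < n \<Longrightarrow> b i \<noteq> 0" for n
  proof -
    have "ell2_inner (b i) (b i) = 1" if "i < n" for i
      using gs(2)[of i] \<open>\<And>i. i < n \<Longrightarrow> b i \<noteq> 0\<close>[OF that] by blast
    from orthonormal_independent[of n b, OF b2 this orth]
    show "inj_on b {..<n}" "cfun.independent (b ` {..<n})" by blast+
  qed
  have "\<exists>j. b j = 0"
  proof (rule ccontr)
    assume "\<nexists>j. b j = 0"
    then have *: "inj_on b {..<Suc (card B)}" "cfun.independent (b ` {..<Suc (card B)})"
      using ind[of "Suc (card B)"] by auto
    have "card (b ` {..<Suc (card B)}) \<le> card B"
      using cfun.independent_span_bound[OF B(1) *(2)] gs(1) B(2) by blast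
    then show False using card_image[OF *(1)] by simp
  qed
  define N where "N = (LEAST j. b j = 0)"
  have bN: "b N = 0" unfolding N_def by (rule LeastI_ex) fact
  have nz: "b i \<noteq> 0" if "i < N" for i
    using not_less_Least[of i "\<lambda>j. b j = 0"] that by (simp add: N_def)
  have unit: "ell2_inner (b i) (b i) = 1" if "i < N" for i
    using gs(2)[of i] nz[OF that] by blast
  have pspan: "projected_units S l \<in> cfun.span (b ` {..<N})" for l
    using gram_schmidt_eq_0[where x = "projected_units S", OF sub L2 p, folded b_def, OF bN] .
  have expand: "v = (\<Sum>i<N. cscale (ell2_inner v (b i)) (b i))" if v: "v \<in> S" for v
  proof -
    define w where "w = residual (\<lambda>_. v) b N 0"
    have w: "w \<in> S" unfolding w_def residual_def
      by (intro cfun.subspace_diff[OF sub] cfun.subspace_sum[OF sub] cfun.subspace_scale[OF sub] v gs(1))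
    have w2: "w \<in> ell2" using w L2 by blast
    have orth_b: "ell2_inner w (b m) = 0" if "m < N" for m
      unfolding w_def using that v L2 b2 unit orth by (intro inner_residual) blast+
    have "w k = 0" for k
    proof -
      let ?l = "to_nat k"
      let ?d = "unit_seq k - projected_units S ?l"
      have d2: "?d \<in> ell2" using p L2 by (intro L2_diff unit_seq_ell2) blast
      have pw: "ell2_inner w (projected_units S ?l) = 0"
        using orth_span[OF w2 _ _ pspan, of ?l] b2 orth_b by blast
      have "ell2_inner ?d w = 0"
        using orth_proj(2)[OF fd L2 unit_seq_ell2 w, of k] by (simp add: projected_units_def)
      then have dw: "ell2_inner w ?d = 0" using L2_inner_commute[of _ w ?d] by simp
      have "ell2_inner (unit_seq k) w = ell2_inner (?d + projected_units S ?l) w" by simp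
      also have "\<dots> = ell2_inner ?d w + ell2_inner (projected_units S ?l) w"
        using p L2 by (intro L2_inner_add_left d2 w2) blast
      also have "\<dots> = 0"
        using dw pw L2_inner_commute[of _ ?d w] L2_inner_commute[of _ "projected_units S ?l" w] by simp
      finally have "ell2_inner w (unit_seq k) = 0"
        using L2_inner_commute[of _ w "unit_seq k"] by simp
      then show ?thesis by (simp add: ell2_inner_unit_seq)
    qed
    then have "w = 0" by auto
    then show ?thesis by (simp add: w_def residual_def)
  qed
  have span: "cfun.span (b ` {..<N}) = S"
  proof
    show "cfun.span (b ` {..<N}) \<subseteq> S"
      using gs(1) by (intro cfun.span_minimal[OF _ sub]) auto
    show "S \<subseteq> cfun.span (b ` {..<N})"
    proof
      fix v assume "v \<in> S"
      then have "v = (\<Sum>i<N. cscale (ell2_inner v (b i)) (b i))" by (rule expand)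
      also have "\<dots> \<in> cfun.span (b ` {..<N})"
        by (intro cfun.span_sum cfun.span_scale cfun.span_base) auto
      finally show "v \<in> cfun.span (b ` {..<N})" .
    qed
  qed
  have "cfun.dim S = card (b ` {..<N})"
    using ind(2)[OF nz] span by (intro cfun.dim_eq_card) (simp_all add: cfun.span_eq_iff[THEN iffD2, OF sub])
  then have dim: "cfun.dim S = N" using card_image[OF ind(1)[OF nz]] by simp
  show "inj_on (fiber_basis S) {..<cfun.dim S}"
    "cfun.independent (fiber_basis S ` {..<cfun.dim S})"
    "cfun.span (fiber_basis S ` {..<cfun.dim S}) = S"
    "v \<in> S \<Longrightarrow> v = (\<Sum>i<cfun.dim S. cscale (ell2_inner v (fiber_basis S i)) (fiber_basis S i))"
    using ind[OF nz] span expand unfolding dim fb by blast+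
qed

section \<open>The matrix of the range operator\<close>

lemma measurable_ell2_inner:
  assumes f: "measurable_section f" and g: "measurable_section g"
  shows "(\<lambda>w. ell2_inner (f w) (g w)) \<in> borel_measurable (lebesgue_on (unit_cube :: (real ^ 'd::finite) set))"
proof -
  let ?M = "lebesgue_on (unit_cube :: (real ^ 'd) set)"
  interpret sigma_finite_measure "count_space (UNIV :: (int ^ 'd) set)"
    by (rule sigma_finite_measure_count_space)
  have [measurable]: "(\<lambda>w. f w k) \<in> borel_measurable ?M" "(\<lambda>w. g w k) \<in> borel_measurable ?M" for k
    using f g by (auto intro: measurable_sectionD)
  have "(\<lambda>(k, w). f w k * cnj (g w k)) \<in> borel_measurable (count_space UNIV \<Otimes>\<^sub>M ?M)"
    by (rule measurable_pair_measure_countable1) simp_all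
  then have "(\<lambda>(w, k). f w k * cnj (g w k)) \<in> borel_measurable (?M \<Otimes>\<^sub>M count_space UNIV)"
    by (subst measurable_pair_swap_iff) (simp add: split_beta)
  then show ?thesis
    unfolding L2_inner_def by (rule borel_measurable_lebesgue_integral)
qed

lemma measurable_section_cscale:
  assumes [measurable]: "c \<in> borel_measurable (lebesgue_on unit_cube)" and s: "measurable_section s"
  shows "measurable_section (\<lambda>w. cscale (c w) (s w))"
  unfolding measurable_section_def
proof
  fix k
  have [measurable]: "(\<lambda>w. s w k) \<in> borel_measurable (lebesgue_on unit_cube)"
    using s by (rule measurable_sectionD)
  show "(\<lambda>w. cscale (c w) (s w) k) \<in> borel_measurable (lebesgue_on unit_cube)"
    unfolding cscale_def by measurable
qed

lemma sum_seq_apply: "(\<Sum>i\<in>I. f i) k = (\<Sum>i\<in>I. f i k)" for f :: "'i \<Rightarrow> 'd::finite seq"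
  by (induction I rule: infinite_finite_induct) simp_all

lemma measurable_section_residual:
  assumes x: "measurable_section (\<lambda>w. x w l)"
    and b: "\<And>i. i < j \<Longrightarrow> measurable_section (\<lambda>w. b w i)"
  shows "measurable_section (\<lambda>w. residual (x w) (b w) j l)"
  unfolding measurable_section_def
proof
  fix k
  have eq: "residual (x w) (b w) j l k
      = x w l k - (\<Sum>i<j. cscale (ell2_inner (x w l) (b w i)) (b w i) k)" for w
    unfolding residual_def by (simp add: sum_seq_apply)
  show "(\<lambda>w. residual (x w) (b w) j l k) \<in> borel_measurable (lebesgue_on unit_cube)"
    unfolding eq
    by (intro borel_measurable_diff borel_measurable_sum measurable_sectionD
        measurable_section_cscale measurable_ell2_inner x b) auto
qed

lemma measurable_section_normalize_seq:
  assumes s: "measurable_section s"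
  shows "measurable_section (\<lambda>w. normalize_seq (s w))"
proof -
  have norm: "L2_norm (count_space UNIV) u = sqrt (Re (ell2_inner u u))" for u :: "'a seq"
    by (simp add: L2_inner_self L2_norm_nonneg)
  have [measurable]: "(\<lambda>w. ell2_inner (s w) (s w)) \<in> borel_measurable (lebesgue_on unit_cube)"
    by (rule measurable_ell2_inner[OF s s])
  show ?thesis
    unfolding normalize_seq_def norm by (rule measurable_section_cscale[OF _ s]) measurable
qed

lemma measurable_section_gram_schmidt:
  assumes x: "\<And>l. measurable_section (\<lambda>w. x w l)"
  shows "measurable_section (\<lambda>w. gram_schmidt (x w) j)"
proof (induction j rule: less_induct)
  case (less j)
  let ?M = "lebesgue_on (unit_cube :: (real ^ 'a) set)"
  let ?r = "\<lambda>l w. residual (x w) (gram_schmidt (x w)) j l"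
  have r: "measurable_section (?r l)" for l
    by (rule measurable_section_residual[OF x less])
  have [measurable]: "(\<lambda>w. ?r l w k) \<in> borel_measurable ?M" for l k
    using r by (rule measurable_sectionD)
  have "(\<lambda>w. \<exists>k. ?r l w k \<noteq> 0) \<in> measurable ?M (count_space UNIV)" for l
    by measurable
  then have least: "(\<lambda>w. LEAST l. \<exists>k. ?r l w k \<noteq> 0) \<in> measurable ?M (count_space UNIV)"
    by (rule measurable_Least)
  have "measurable_section (\<lambda>w. ?r (LEAST l. \<exists>k. ?r l w k \<noteq> 0) w)"
    unfolding measurable_section_def
    by (intro allI measurable_compose_countable[where f = "\<lambda>l w. ?r l w _", OF _ least]) measurable
  then have "measurable_section (\<lambda>w. normalize_seq (?r (LEAST l. \<exists>k. ?r l w k \<noteq> 0) w))"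
    by (rule measurable_section_normalize_seq)
  moreover have "?r l w \<noteq> 0 \<longleftrightarrow> (\<exists>k. ?r l w k \<noteq> 0)" for l w
    by (auto simp: fun_eq_iff)
  ultimately show ?case
    by (simp only: gram_schmidt.simps[of _ j])
qed

lemma measurable_section_fiber_basis:
  assumes "measurable_range_function J"
  shows "measurable_section (\<lambda>w. fiber_basis (J w) j)"
  unfolding fiber_basis_def
proof (rule measurable_section_gram_schmidt)
  fix l
  have "(\<lambda>w. ell2_inner (orth_proj (J w) (unit_seq (from_nat l))) (unit_seq k))
      \<in> borel_measurable (lebesgue_on unit_cube)" for k
    using assms unit_seq_ell2 unfolding measurable_range_function_def by blast
  then show "measurable_section (\<lambda>w. projected_units (J w) l)"
    by (simp add: measurable_section_def projected_units_def ell2_inner_unit_seq)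
qed

lemma ell2_nn_norm_sq_eq:
  assumes "u \<in> ell2"
  shows "ell2_nn_norm_sq u = ennreal ((L2_norm (count_space UNIV) u)\<^sup>2)"
  unfolding ell2_nn_norm_sq_def by (rule nn_integral_L2_norm_sq[OF assms])

text \<open>In an orthonormal basis the matrix entries are inner products
  \<open>\<langle>R w (b\<^sub>j w), b\<^sub>i w\<rangle>\<close>; they are bounded by the essential bound of \<open>R\<close> along the sections
  \<open>b\<^sub>j\<close>.\<close>

lemma bounded_measurable_matrix_representation:
  fixes V :: "(real ^ 'd::finite \<Rightarrow> complex) set"
  assumes J: "range_function_of V J"
    and fd: "AE w in lebesgue_on unit_cube. finite_dimensional (J w)"
    and L: "L2_bounded_operator lebesgue V L" and V: "V \<subseteq> L2 lebesgue"
    and R: "range_operator_of V J L R"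
  obtains m :: "nat \<Rightarrow> nat \<Rightarrow> real ^ 'd \<Rightarrow> complex" and C
  where "\<And>i j. m i j \<in> borel_measurable (lebesgue_on unit_cube)" "\<And>i j w. norm (m i j w) \<le> C"
    "AE w in lebesgue_on unit_cube.
      matrix_representation (J w) (R w) (cfun.dim (J w)) (\<lambda>i j. m i j w)"
proof -
  let ?Q = "unit_cube :: (real ^ 'd) set"
  let ?b = "\<lambda>w. fiber_basis (J w)"
  let ?n = "\<lambda>u. L2_norm (count_space UNIV) u"
  obtain C where C: "0 \<le> C"
    "\<And>s. measurable_section s \<Longrightarrow> AE w in lebesgue_on ?Q. s w \<in> J w \<and> ell2_nn_norm_sq (s w) \<le> 1 \<Longrightarrow>
      \<exists>h. measurable_section h \<and>
        (AE w in lebesgue_on ?Q. R w (s w) = h w \<and> ell2_nn_norm_sq (h w) \<le> ennreal (C\<^sup>2))"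
    using range_operator_on_sections[OF J L V R] by blast
  have Jm: "measurable_range_function J" using J by (simp add: range_function_of_def)
  have J_L2: "J w \<subseteq> ell2" if "w \<in> ?Q" for w
    using Jm that by (auto simp: measurable_range_function_def L2_closed_subspace_def)
  have R_mem: "R w v \<in> J w" if "w \<in> ?Q" "v \<in> J w" for w v
    using R that by (auto simp: range_operator_of_def L2_bounded_operator_def)
  have b_section: "measurable_section (\<lambda>w. ?b w j)" for j
    by (rule measurable_section_fiber_basis[OF Jm])
  have "AE w in lebesgue_on ?Q. ?b w j \<in> J w \<and> ell2_nn_norm_sq (?b w j) \<le> 1" for j
    using fd AE_space[of "lebesgue_on ?Q"]
  proof eventually_elim
    case (elim w)
    then have JL: "J w \<subseteq> ell2" using J_L2 by simp
    have mem: "?b w j \<in> J w" by (rule fiber_basis_mem[OF elim(1) JL])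
    have "(?n (?b w j))\<^sup>2 \<le> 1"
      using fiber_basis_norm[OF elim(1) JL, of j] by (simp add: power_le_one L2_norm_nonneg)
    then have "ell2_nn_norm_sq (?b w j) \<le> 1"
      using ell2_nn_norm_sq_eq[of "?b w j"] mem JL by auto
    with mem show ?case by blast
  qed
  then have "\<forall>j. \<exists>h. measurable_section h \<and>
      (AE w in lebesgue_on ?Q. R w (?b w j) = h w \<and> ell2_nn_norm_sq (h w) \<le> ennreal (C\<^sup>2))"
    using C(2)[OF b_section] by blast
  from choice[OF this] obtain h where h: "\<And>j. measurable_section (h j)"
    "\<And>j. AE w in lebesgue_on ?Q. R w (?b w j) = h j w \<and> ell2_nn_norm_sq (h j w) \<le> ennreal (C\<^sup>2)"
    by blast
  define M where "M i j w = ell2_inner (h j w) (?b w i)" for i j w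
  \<comment> \<open>The cutoff only changes values on a null set and makes the bound hold everywhere.\<close>
  define m where "m i j w = (if norm (M i j w) \<le> C then M i j w else 0)" for i j w
  show thesis
  proof (rule that[of m C])
    fix i j
    have [measurable]: "M i j \<in> borel_measurable (lebesgue_on ?Q)"
      unfolding M_def by (rule measurable_ell2_inner[OF h(1) b_section])
    show "m i j \<in> borel_measurable (lebesgue_on ?Q)"
      unfolding m_def by measurable
    show "norm (m i j w) \<le> C" for w
      using C(1) by (simp add: m_def)
  next
    have "AE w in lebesgue_on ?Q. \<forall>j. R w (?b w j) = h j w \<and> ell2_nn_norm_sq (h j w) \<le> ennreal (C\<^sup>2)"
      unfolding AE_all_countable using h(2) by blast
    then show "AE w in lebesgue_on ?Q.
        matrix_representation (J w) (R w) (cfun.dim (J w)) (\<lambda>i j. m i j w)"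
      using fd AE_space[of "lebesgue_on ?Q"]
    proof eventually_elim
      case (elim w)
      then have w: "w \<in> ?Q" and JL: "J w \<subseteq> ell2" using J_L2 by simp_all
      note basis = fiber_basis[OF elim(2) JL]
      have hJ: "h j w \<in> J w" for j
        using R_mem[OF w basis(1), of j] elim(1) by simp
      have "norm (M i j w) \<le> C" for i j
      proof -
        have h2: "h j w \<in> ell2" and b2: "?b w i \<in> ell2" using hJ basis(1) JL by blast+
        have "(?n (h j w))\<^sup>2 \<le> C\<^sup>2"
          using elim(1) ell2_nn_norm_sq_eq[OF h2] by (metis ennreal_le_iff zero_le_power2)
        then have hC: "?n (h j w) \<le> C" using C(1) by (rule power2_le_imp_le)
        have "norm (M i j w) \<le> ?n (h j w) * ?n (?b w i)"
          unfolding M_def by (rule L2_Cauchy_Schwarz[OF h2 b2])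
        also have "\<dots> \<le> C * 1"
          using hC basis(2) C(1) by (intro mult_mono) (auto simp: L2_norm_nonneg)
        finally show ?thesis by simp
      qed
      then have mM: "m i j w = M i j w" for i j by (simp add: m_def)
      have "R w (?b w j) = (\<Sum>i<cfun.dim (J w). cscale (m i j w) (?b w i))" for j
        using basis(6)[OF hJ, of j] elim(1) unfolding mM M_def by simp
      then show ?case
        unfolding matrix_representation_def using basis(3,4,5) by blast
    qed
  qed
qed

theorem proposition3p4:
  fixes V :: "(real ^ 'd::finite \<Rightarrow> complex) set"
    and J :: "real ^ 'd \<Rightarrow> (int ^ 'd \<Rightarrow> complex) set"
    and L :: "(real ^ 'd \<Rightarrow> complex) \<Rightarrow> real ^ 'd \<Rightarrow> complex"
    and R :: "real ^ 'd \<Rightarrow> (int ^ 'd \<Rightarrow> complex) \<Rightarrow> int ^ 'd \<Rightarrow> complex"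
  assumes "shift_invariant V"
    and "range_function_of V J"
    and "AE \<omega> in lebesgue_on unit_cube. finite_dimensional (J \<omega>)"
    and "shift_preserving V L"
    and "range_operator_of V J L R"
  shows "(\<exists>m :: nat \<Rightarrow> nat \<Rightarrow> real ^ 'd \<Rightarrow> complex.
        (\<forall>i j. m i j \<in> borel_measurable (lebesgue_on unit_cube)) \<and>
        (AE \<omega> in lebesgue_on unit_cube.
          matrix_representation (J \<omega>) (R \<omega>) (cfun.dim (J \<omega>)) (\<lambda>i j. m i j \<omega>))) \<and>
    (\<forall>n B. B \<in> sets lebesgue \<and> B \<subseteq> unit_cube \<and>
        (AE \<omega> in lebesgue_on B. cfun.dim (J \<omega>) = n) \<longrightarrow>
      (\<exists>m :: nat \<Rightarrow> nat \<Rightarrow> real ^ 'd \<Rightarrow> complex.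
        (\<forall>i<n. \<forall>j<n. m i j \<in> borel_measurable (lebesgue_on B) \<and> bounded (m i j ` B)) \<and>
        (AE \<omega> in lebesgue_on B.
          matrix_representation (J \<omega>) (R \<omega>) n (\<lambda>i j. m i j \<omega>))))"
proof -
  have V: "V \<subseteq> L2 lebesgue"
    using assms(1) by (simp add: shift_invariant_def L2_closed_subspace_def)
  have L: "L2_bounded_operator lebesgue V L"
    using assms(4) by (simp add: shift_preserving_def)
  obtain m C
    where m: "\<And>i j. m i j \<in> borel_measurable (lebesgue_on unit_cube)"
      and bound: "\<And>i j w. norm (m i j w) \<le> C"
      and rep: "AE w in lebesgue_on unit_cube.
        matrix_representation (J w) (R w) (cfun.dim (J w)) (\<lambda>i j. m i j w)"
    by (rule bounded_measurable_matrix_representation[OF assms(2,3) L V assms(5)]) (rule that)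
  have "(\<forall>i<n. \<forall>j<n. m i j \<in> borel_measurable (lebesgue_on B) \<and> bounded (m i j ` B)) \<and>
      (AE w in lebesgue_on B. matrix_representation (J w) (R w) n (\<lambda>i j. m i j w))"
    if B: "B \<in> sets lebesgue" "B \<subseteq> unit_cube" and dim: "AE w in lebesgue_on B. cfun.dim (J w) = n"
    for n B
  proof (intro conjI allI impI)
    fix i j
    show "m i j \<in> borel_measurable (lebesgue_on B)"
      by (rule measurable_restrict_mono[OF m B(2)])
    show "bounded (m i j ` B)"
      using bound by (auto intro: boundedI)
  next
    have "AE w in lebesgue_on B. matrix_representation (J w) (R w) (cfun.dim (J w)) (\<lambda>i j. m i j w)"
      using rep B by (auto simp: AE_restrict_space_iff elim: eventually_mono)
    with dim show "AE w in lebesgue_on B. matrix_representation (J w) (R w) n (\<lambda>i j. m i j w)"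
      by eventually_elim simp
  qed
  then show ?thesis using m rep by blast
qed

end
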